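(* Let $V$ be a two-sided quaternionic Banach space and let $T$ be the quaternionic infinitesimal generator of a strongly continuous group $(\mathcal{Z}_T(t))_{t\in\mathbb{R}}$ of bounded right linear operators on $V$. If $(P_n)_{n\in\mathbb{N}}$ is an inverting sequence for an intrinsic function $f\in\mathbf{V}(T)$, then $$\lim_{n\to\infty}P_n[T]f(T)u=u\qquad\text{for all }u\in V.$$
   Context: $\mathbb{H}$ denotes the quaternions, with real part $\mathrm{Re}(s)$, conjugate $\overline{s}$, modulus $|s|$. A two-sided quaternionic Banach space $V$ is a two-sided $\mathbb{H}$-vector space that is complete for a norm with $\|av\|=|a|\|v\|=\|va\|$. $T$ is right linear if $T(ua+v)=T(u)a+T(v)$. $\mathcal{B}(V)$ is the set of bounded right linear operators on $V$; $\mathcal{I}$ is the identity. A strongly continuous group is a family $(\mathcal{Z}(t))_{t\in\mathbb{R}}\subset\mathcal{B}(V)$ with $\mathcal{Z}(0)=\mathcal{I}$, $\mathcal{Z}(t_1+t_2)=\mathcal{Z}(t_1)\mathcal{Z}(t_2)$ and $t\mapsto\mathcal{Z}(t)v$ continuous for every $v\in V$. Its infinitesimal generator is $Tv=\lim_{h\to0^+}\frac1h(\mathcal{Z}(h)v-v)$ with domain $\mathcal{D}(T)$ the set of $v$ for which the limit exists; one writes $\mathcal{Z}_T(t)$ for $\mathcal{Z}(t)$. The $S$-spectrum $\sigma_S(T)$ is the complement in $\mathbb{H}$ of the set $\rho_S(T)$ of $s\in\mathbb{H}$ such that $T^2-2\mathrm{Re}(s)T+|s|^2\mathcal{I}:\mathcal{D}(T^2)\to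 V$ is injective with dense range and has inverse in $\mathcal{B}(V)$. Fix constants $M>0$, $\omega\ge0$ with $\|\mathcal{Z}_T(t)\|\le Me^{\omega|t|}$ for all $t\in\mathbb{R}$ and $\sigma_S(T)\subset\{s:-\omega<\mathrm{Re}(s)<\omega\}$. A quaternionic measure on the Borel sets $\mathbf{B}(\mathbb{R})$ is a countably additive $\mu:\mathbf{B}(\mathbb{R})\to\mathbb{H}$; $|\mu|(A)=\sup\sum_i|\mu(A_i)|$ over countable measurable partitions of $A$ is its total variation, and $d\mu=h\,d|\mu|$ with $|h|=1$. Write $\int d\mu(t)\,F(t):=\int h(t)F(t)\,d|\mu|(t)$ (Bochner integral). $\mathbf{S}(T)$ is the set of quaternionic measures $\mu$ on $\mathbf{B}(\mathbb{R})$ with $\int_{\mathbb{R}}d|\mu|(t)\,e^{(\omega+\varepsilon)|t|}<\infty$ for some $\varepsilon=\varepsilon(\mu)>0$. Put $\mathcal{L}(\mu)(s)=\int_{\mathbb{R}}d\mu(t)\,e^{-st}$ for $-(\omega+\varepsilon)<\mathrm{Re}(s)<\omega+\varepsilon$, and $\mathbf{V}(T)=\{\mathcal{L}(\mu):\mu\in\mathbf{S}(T)\}$. For $f=\mathcal{L}(\mu)\in\mathbf{V}(T)$, $\mu\in\mathbf{S}(T)$, define $f(T)v=\int_{\mathbb{R}}d\mu(t)\,\mathcal{Z}_T(-t)v$, $v\in V$. A function $f\in\mathbf{V}(T)$ is intrinsic if $f(\overline{s})=\overline{f(s)}$ for all $s$ in its strip. An intrinsic polynomial is $P(s)=\sum_{k=0}^m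 a_ks^k$ with $a_k\in\mathbb{R}$; $P[T]=\sum_{k=0}^m a_kT^k$, with domain $\mathcal{D}(T^m)$, $m$ the degree of $P$. A sequence $(P_n)_{n\in\mathbb{N}}$ of intrinsic polynomials is an inverting sequence for an intrinsic function $f\in\mathbf{V}(T)$ if: (i) the pointwise product $P_nf$ belongs to $\mathbf{V}(T)$ for all $n$; (ii) there are $\varepsilon>0$ and a constant $M'>0$ such that, in the strip $|\mathrm{Re}(s)|\le\omega+\varepsilon$, $|P_n(s)f(s)|\le M'$ for all $n\in\mathbb{N}$ and $\lim_{n\to\infty}P_n(s)f(s)=1$; (iii) there is a constant $M''>0$ with $\|(P_nf)(T)\|\le M''$ for all $n\in\mathbb{N}$. *)

theory Defs
  imports "HOL-Analysis.Analysis" "HOL-Computational_Algebra.Polynomial"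
begin

section \<open>Quaternions\<close>

codatatype quaternion = Quaternion (qRe: real) (qI: real) (qJ: real) (qK: real)

lemma quaternion_eq_iff:
  "x = y \<longleftrightarrow> qRe x = qRe y \<and> qI x = qI y \<and> qJ x = qJ y \<and> qK x = qK y"
  by (auto intro: quaternion.expand)

instantiation quaternion :: ab_group_add
begin

primcorec zero_quaternion where
  "qRe 0 = 0" | "qI 0 = 0" | "qJ 0 = 0" | "qK 0 = 0"

primcorec plus_quaternion where
  "qRe (x + y) = qRe x + qRe y"
| "qI (x + y) = qI x + qI y"
| "qJ (x + y) = qJ x + qJ y"
| "qK (x + y) = qK x + qK y"

primcorec uminus_quaternion where
  "qRe (- x) = - qRe x" | "qI (- x) = - qI x" | "qJ (- x) = - qJ x" | "qK (- x) = - qK x"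

primcorec minus_quaternion where
  "qRe (x - y) = qRe x - qRe y"
| "qI (x - y) = qI x - qI y"
| "qJ (x - y) = qJ x - qJ y"
| "qK (x - y) = qK x - qK y"

instance by standard (simp_all add: quaternion_eq_iff)

end

instantiation quaternion :: ring_1
begin

primcorec one_quaternion where
  "qRe 1 = 1" | "qI 1 = 0" | "qJ 1 = 0" | "qK 1 = 0"

primcorec times_quaternion where
  "qRe (x * y) = qRe x * qRe y - qI x * qI y - qJ x * qJ y - qK x * qK y"
| "qI (x * y) = qRe x * qI y + qI x * qRe y + qJ x * qK y - qK x * qJ y"
| "qJ (x * y) = qRe x * qJ y - qI x * qK y + qJ x * qRe y + qK x * qI y"
| "qK (x * y) = qRe x * qK y + qI x * qJ y - qJ x * qI y + qK x * qRe y"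

instance by standard (simp_all add: quaternion_eq_iff algebra_simps)

end

instantiation quaternion :: real_algebra_1
begin

primcorec scaleR_quaternion where
  "qRe (scaleR r x) = r * qRe x"
| "qI (scaleR r x) = r * qI x"
| "qJ (scaleR r x) = r * qJ x"
| "qK (scaleR r x) = r * qK x"

instance by standard (simp_all add: quaternion_eq_iff algebra_simps)

end

primcorec qcnj :: "quaternion \<Rightarrow> quaternion" where
  "qRe (qcnj z) = qRe z"
| "qI (qcnj z) = - qI z"
| "qJ (qcnj z) = - qJ z"
| "qK (qcnj z) = - qK z"

instantiation quaternion :: real_div_algebra
begin

definition "inverse x =
  inverse ((qRe x)\<^sup>2 + (qI x)\<^sup>2 + (qJ x)\<^sup>2 + (qK x)\<^sup>2) *\<^sub>R qcnj x" for x :: quaternion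

definition "x div y = x * inverse y" for x y :: quaternion

lemma quaternion_sumsq_pos:
  fixes x :: quaternion
  assumes "x \<noteq> 0"
  shows "0 < (qRe x)\<^sup>2 + (qI x)\<^sup>2 + (qJ x)\<^sup>2 + (qK x)\<^sup>2"
proof -
  have "qRe x \<noteq> 0 \<or> qI x \<noteq> 0 \<or> qJ x \<noteq> 0 \<or> qK x \<noteq> 0"
    using assms by (auto simp: quaternion_eq_iff)
  then have "0 < (qRe x)\<^sup>2 \<or> 0 < (qI x)\<^sup>2 \<or> 0 < (qJ x)\<^sup>2 \<or> 0 < (qK x)\<^sup>2"
    by auto
  then show ?thesis
    using zero_le_power2[of "qRe x"] zero_le_power2[of "qI x"]
      zero_le_power2[of "qJ x"] zero_le_power2[of "qK x"] by linarith
qed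

instance
proof
  fix x y :: quaternion
  let ?N = "(qRe x)\<^sup>2 + (qI x)\<^sup>2 + (qJ x)\<^sup>2 + (qK x)\<^sup>2"
  have "qcnj x * x = ?N *\<^sub>R 1" "x * qcnj x = ?N *\<^sub>R 1"
    by (simp_all add: quaternion_eq_iff power2_eq_square algebra_simps)
  moreover assume "x \<noteq> 0"
  ultimately show "inverse x * x = 1" "x * inverse x = 1"
    using quaternion_sumsq_pos[of x] by (simp_all add: inverse_quaternion_def)
next
  fix x y :: quaternion
  show "x div y = x * inverse y" by (simp add: divide_quaternion_def)
  show "inverse 0 = (0::quaternion)"
    by (simp add: inverse_quaternion_def quaternion_eq_iff)
qed

end

instantiation quaternion :: real_inner
begin

definition inner_quaternion_def:
  "inner x y = qRe x * qRe y + qI x * qI y + qJ x * qJ y + qK x * qK y"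

definition norm_quaternion_def:
  "norm z = sqrt ((qRe z)\<^sup>2 + (qI z)\<^sup>2 + (qJ z)\<^sup>2 + (qK z)\<^sup>2)"

definition sgn_quaternion_def: "sgn (x::quaternion) = x /\<^sub>R norm x"

definition dist_quaternion_def: "dist x (y::quaternion) = norm (x - y)"

definition uniformity_quaternion_def [code del]:
  "(uniformity :: (quaternion \<times> quaternion) filter) = (INF e\<in>{0 <..}. principal {(x, y). dist x y < e})"

definition open_quaternion_def [code del]:
  "open (U :: quaternion set) \<longleftrightarrow> (\<forall>x\<in>U. eventually (\<lambda>(x', y). x' = x \<longrightarrow> y \<in> U) uniformity)"

instance
proof
  fix x y z :: quaternion and r :: real and U :: "quaternion set"
  show "dist x y = norm (x - y)" by (rule dist_quaternion_def)
  show "sgn x = x /\<^sub>R norm x" by (rule sgn_quaternion_def)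
  show "uniformity = (INF e\<in>{0<..}. principal {(x, y::quaternion). dist x y < e})"
    by (rule uniformity_quaternion_def)
  show "open U \<longleftrightarrow> (\<forall>x\<in>U. \<forall>\<^sub>F (x', y) in uniformity. x' = x \<longrightarrow> y \<in> U)"
    by (rule open_quaternion_def)
  show "inner x y = inner y x"
    by (simp add: inner_quaternion_def mult.commute)
  show "inner (x + y) z = inner x z + inner y z"
    by (simp add: inner_quaternion_def algebra_simps)
  show "inner (scaleR r x) y = r * inner x y"
    by (simp add: inner_quaternion_def algebra_simps)
  show "0 \<le> inner x x"
    by (simp add: inner_quaternion_def)
  show "inner x x = 0 \<longleftrightarrow> x = 0"
    using quaternion_sumsq_pos[of x]
    by (cases "x = 0") (simp_all add: inner_quaternion_def power2_eq_square)
  show "norm x = sqrt (inner x x)"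
    by (simp add: norm_quaternion_def inner_quaternion_def power2_eq_square)
qed

end

instance quaternion :: real_normed_div_algebra
proof
  fix x y :: quaternion
  show "norm (x * y) = norm x * norm y"
    unfolding norm_quaternion_def real_sqrt_mult[symmetric]
    by (simp add: power2_eq_square algebra_simps)
qed

instantiation quaternion :: euclidean_space
begin

definition Basis_quaternion_def:
  "Basis = {Quaternion 1 0 0 0, Quaternion 0 1 0 0, Quaternion 0 0 1 0, Quaternion 0 0 0 1}"

instance
proof
  show "(Basis :: quaternion set) \<noteq> {}" and "finite (Basis :: quaternion set)"
    by (simp_all add: Basis_quaternion_def)
next
  fix u v :: quaternion
  assume "u \<in> Basis" "v \<in> Basis"
  then show "inner u v = (if u = v then 1 else 0)"
    unfolding Basis_quaternion_def insert_iff empty_iff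
    by (elim disjE FalseE; hypsubst) (simp_all add: inner_quaternion_def)
next
  fix x :: quaternion
  show "(\<forall>u\<in>Basis. inner x u = 0) \<longleftrightarrow> x = 0"
    unfolding Basis_quaternion_def ball_simps
    by (simp add: inner_quaternion_def quaternion_eq_iff[of x])
qed

end

section \<open>Two-sided quaternionic Banach spaces\<close>

text \<open>
  The real structure of the underlying Banach space is the restriction of the quaternionic
  ones.  This is no extra condition: additivity and the norm axioms alone force the
  actions of the real quaternions from the left and from the right to be one and the same
  real scalar multiplication.
\<close>

class quaternionic_banach = banach +
  fixes qleft :: "quaternion \<Rightarrow> 'a \<Rightarrow> 'a"
    and qright :: "'a \<Rightarrow> quaternion \<Rightarrow> 'a"
  assumes qleft_add_right: "qleft a (u + v) = qleft a u + qleft a v"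
    and qleft_add_left: "qleft (a + b) v = qleft a v + qleft b v"
    and qleft_qleft: "qleft a (qleft b v) = qleft (a * b) v"
    and qleft_of_real: "qleft (of_real r) v = r *\<^sub>R v"
    and qright_add_left: "qright (u + v) a = qright u a + qright v a"
    and qright_add_right: "qright v (a + b) = qright v a + qright v b"
    and qright_qright: "qright (qright v a) b = qright v (a * b)"
    and qright_of_real: "qright v (of_real r) = r *\<^sub>R v"
    and qleft_qright: "qright (qleft a v) b = qleft a (qright v b)"
    and norm_qleft: "norm (qleft a v) = norm a * norm v"
    and norm_qright: "norm (qright v a) = norm a * norm v"

instantiation quaternion :: quaternionic_banach
begin

definition "qleft_quaternion a v = (a * v :: quaternion)"
definition "qright_quaternion v a = (v * a :: quaternion)"

instance
  by standard
    (simp_all add: qleft_quaternion_def qright_quaternion_def algebra_simps norm_mult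
      of_real_def)

end

definition bounded_right_linear :: "('v::quaternionic_banach \<Rightarrow> 'v) \<Rightarrow> bool" where
  "bounded_right_linear A \<longleftrightarrow>
     (\<forall>u v a. A (qright u a + v) = qright (A u) a + A v) \<and>
     (\<exists>K. \<forall>v. norm (A v) \<le> K * norm v)"

section \<open>Strongly continuous groups, generators and the S-spectrum\<close>

definition strongly_continuous_group :: "(real \<Rightarrow> 'v::quaternionic_banach \<Rightarrow> 'v) \<Rightarrow> bool" where
  "strongly_continuous_group Z \<longleftrightarrow>
     (\<forall>t. bounded_right_linear (Z t)) \<and>
     Z 0 = id \<and>
     (\<forall>t\<^sub>1 t\<^sub>2. Z (t\<^sub>1 + t\<^sub>2) = Z t\<^sub>1 \<circ> Z t\<^sub>2) \<and>
     (\<forall>v. continuous_on UNIV (\<lambda>t. Z t v))"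

text \<open>
  An unbounded operator is given by its domain \<open>D\<close> and a total function \<open>T\<close>
  whose values outside \<open>D\<close> are irrelevant.
\<close>

definition is_generator ::
    "(real \<Rightarrow> 'v::quaternionic_banach \<Rightarrow> 'v) \<Rightarrow> 'v set \<Rightarrow> ('v \<Rightarrow> 'v) \<Rightarrow> bool" where
  "is_generator Z D T \<longleftrightarrow>
     D = {v. \<exists>w. ((\<lambda>h. (1 / h) *\<^sub>R (Z h v - v)) \<longlongrightarrow> w) (at_right 0)} \<and>
     (\<forall>v\<in>D. ((\<lambda>h. (1 / h) *\<^sub>R (Z h v - v)) \<longlongrightarrow> T v) (at_right 0))"

fun pow_dom :: "'v set \<Rightarrow> ('v \<Rightarrow> 'v) \<Rightarrow> nat \<Rightarrow> 'v set" where
  "pow_dom D T 0 = UNIV"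
| "pow_dom D T (Suc k) = {v \<in> D. T v \<in> pow_dom D T k}"

definition Q_op :: "('v::quaternionic_banach \<Rightarrow> 'v) \<Rightarrow> quaternion \<Rightarrow> 'v \<Rightarrow> 'v" where
  "Q_op T s v = T (T v) - (2 * qRe s) *\<^sub>R T v + (norm s)\<^sup>2 *\<^sub>R v"

definition S_resolvent_set :: "'v::quaternionic_banach set \<Rightarrow> ('v \<Rightarrow> 'v) \<Rightarrow> quaternion set" where
  "S_resolvent_set D T =
     {s. inj_on (Q_op T s) (pow_dom D T 2) \<and>
         closure (Q_op T s ` pow_dom D T 2) = UNIV \<and>
         (\<exists>B. bounded_right_linear B \<and>
              (\<forall>v\<in>pow_dom D T 2. B (Q_op T s v) = v) \<and>
              (\<forall>w. B w \<in> pow_dom D T 2 \<and> Q_op T s (B w) = w))}"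

definition S_spectrum :: "'v::quaternionic_banach set \<Rightarrow> ('v \<Rightarrow> 'v) \<Rightarrow> quaternion set" where
  "S_spectrum D T = - S_resolvent_set D T"

section \<open>Quaternionic measures on the real line\<close>

text \<open>A quaternionic measure is a set function of which only the values on Borel sets matter.\<close>

definition quaternionic_measure :: "(real set \<Rightarrow> quaternion) \<Rightarrow> bool" where
  "quaternionic_measure \<mu> \<longleftrightarrow>
     (\<forall>A :: nat \<Rightarrow> real set. range A \<subseteq> sets borel \<longrightarrow> disjoint_family A \<longrightarrow>
        (\<lambda>i. \<mu> (A i)) sums \<mu> (\<Union>i. A i))"

definition variation_fun :: "(real set \<Rightarrow> quaternion) \<Rightarrow> real set \<Rightarrow> ennreal" where
  "variation_fun \<mu> A =
     (SUP E \<in> {E :: nat \<Rightarrow> real set. range E \<subseteq> sets borel \<and> disjoint_family E \<and> (\<Union>i. E i) = A}.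
        \<Sum>i. ennreal (norm (\<mu> (E i))))"

definition variation :: "(real set \<Rightarrow> quaternion) \<Rightarrow> real measure" where
  "variation \<mu> = measure_of UNIV (sets borel) (variation_fun \<mu>)"

text \<open>The function \<open>h\<close> of the polar decomposition; it is unique up to a null set of the variation.\<close>

definition polar :: "(real set \<Rightarrow> quaternion) \<Rightarrow> real \<Rightarrow> quaternion" where
  "polar \<mu> = (SOME h. h \<in> borel_measurable borel \<and> (\<forall>t. norm (h t) = 1) \<and>
     (\<forall>A\<in>sets borel. set_integrable (variation \<mu>) A h \<and>
        \<mu> A = set_lebesgue_integral (variation \<mu>) A h))"

section \<open>Bochner integral in arbitrary Banach spaces\<close>

text \<open>
  The library's Bochner integral requires a second countable (separable) space of values.
  The following is its definition with Borel measurability replaced by strong measurability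
  (being a pointwise limit of simple functions).
\<close>

definition has_bochner_int :: "'a measure \<Rightarrow> ('a \<Rightarrow> 'b::real_normed_vector) \<Rightarrow> 'b \<Rightarrow> bool" where
  "has_bochner_int M f x \<longleftrightarrow>
     (\<exists>s :: nat \<Rightarrow> 'a \<Rightarrow> 'b. (\<forall>i. simple_function M (s i)) \<and>
        (\<forall>y\<in>space M. (\<lambda>i. s i y) \<longlonglongrightarrow> f y)) \<and>
     (\<exists>s :: nat \<Rightarrow> 'a \<Rightarrow> 'b. (\<forall>i. Bochner_Integration.simple_bochner_integrable M (s i)) \<and>
        (\<lambda>i. \<integral>\<^sup>+y. ennreal (norm (f y - s i y)) \<partial>M) \<longlonglongrightarrow> 0 \<and>
        (\<lambda>i. Bochner_Integration.simple_bochner_integral M (s i)) \<longlonglongrightarrow> x)"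

definition bochner_int :: "'a measure \<Rightarrow> ('a \<Rightarrow> 'b::real_normed_vector) \<Rightarrow> 'b" where
  "bochner_int M f = (if \<exists>x. has_bochner_int M f x then THE x. has_bochner_int M f x else 0)"

lemma has_bochner_int_iff_has_bochner_integral:
  fixes f :: "'a \<Rightarrow> 'b::{banach, second_countable_topology}"
  shows "has_bochner_int M f x \<longleftrightarrow> has_bochner_integral M f x"
proof
  assume h: "has_bochner_int M f x"
  then obtain s :: "nat \<Rightarrow> 'a \<Rightarrow> 'b" where s: "\<And>i. simple_function M (s i)"
      "\<And>y. y \<in> space M \<Longrightarrow> (\<lambda>i. s i y) \<longlonglongrightarrow> f y"
    unfolding has_bochner_int_def by blast
  have "f \<in> borel_measurable M"
    by (rule borel_measurable_LIMSEQ_metric[of s])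
      (use s in \<open>auto intro: borel_measurable_simple_function\<close>)
  moreover obtain r :: "nat \<Rightarrow> 'a \<Rightarrow> 'b" where
      "\<And>i. Bochner_Integration.simple_bochner_integrable M (r i)"
      "(\<lambda>i. \<integral>\<^sup>+y. ennreal (norm (f y - r i y)) \<partial>M) \<longlonglongrightarrow> 0"
      "(\<lambda>i. Bochner_Integration.simple_bochner_integral M (r i)) \<longlonglongrightarrow> x"
    using h unfolding has_bochner_int_def by metis
  ultimately show "has_bochner_integral M f x"
    by (rule has_bochner_integral.intros)
next
  assume h: "has_bochner_integral M f x"
  then have "f \<in> borel_measurable M" by (rule borel_measurable_has_bochner_integral)
  from borel_measurable_implies_sequence_metric[OF this, of 0]
  obtain s :: "nat \<Rightarrow> 'a \<Rightarrow> 'b" where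
      "\<forall>i. simple_function M (s i)" "\<forall>y\<in>space M. (\<lambda>i. s i y) \<longlonglongrightarrow> f y"
    by auto
  then have "\<exists>s :: nat \<Rightarrow> 'a \<Rightarrow> 'b. (\<forall>i. simple_function M (s i)) \<and>
      (\<forall>y\<in>space M. (\<lambda>i. s i y) \<longlonglongrightarrow> f y)"
    by (intro exI[of _ s] conjI)
  with h show "has_bochner_int M f x"
  proof cases
    case (1 r)
    show ?thesis
      unfolding has_bochner_int_def
      by (rule conjI, fact, intro exI[of _ r] conjI allI; fact 1)
  qed
qed

lemma bochner_int_eq_lebesgue_integral:
  fixes f :: "'a \<Rightarrow> 'b::{banach, second_countable_topology}"
  shows "bochner_int M f = integral\<^sup>L M f"
  unfolding bochner_int_def lebesgue_integral_def has_bochner_int_iff_has_bochner_integral ..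

section \<open>The functional calculus of the bilateral Laplace transform\<close>

definition exp_moment_finite :: "real \<Rightarrow> (real set \<Rightarrow> quaternion) \<Rightarrow> bool" where
  "exp_moment_finite a \<mu> \<longleftrightarrow> (\<integral>\<^sup>+t. ennreal (exp (a * \<bar>t\<bar>)) \<partial>variation \<mu>) < \<infinity>"

definition S_class :: "real \<Rightarrow> (real set \<Rightarrow> quaternion) set" where
  "S_class \<omega> = {\<mu>. quaternionic_measure \<mu> \<and> (\<exists>\<epsilon>>0. exp_moment_finite (\<omega> + \<epsilon>) \<mu>)}"

definition laplace :: "(real set \<Rightarrow> quaternion) \<Rightarrow> quaternion \<Rightarrow> quaternion" where
  "laplace \<mu> s = (\<integral>t. polar \<mu> t * exp (- (t *\<^sub>R s)) \<partial>variation \<mu>)"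

text \<open>
  The members of \<open>V(T)\<close> are functions on a strip around \<open>\<bar>Re s\<bar> \<le> \<omega>\<close>.  Here they are
  total functions, and only the values on some such strip matter:
  \<open>laplace_on \<omega> \<epsilon> \<mu> f\<close> says that \<open>f\<close> is the Laplace transform of \<open>\<mu>\<close> on
  \<open>\<bar>Re s\<bar> < \<omega> + \<epsilon>\<close>, with \<open>\<epsilon>\<close> admissible for \<open>\<mu>\<close>.
\<close>

definition laplace_on ::
    "real \<Rightarrow> real \<Rightarrow> (real set \<Rightarrow> quaternion) \<Rightarrow> (quaternion \<Rightarrow> quaternion) \<Rightarrow> bool" where
  "laplace_on \<omega> \<epsilon> \<mu> f \<longleftrightarrow>
     \<epsilon> > 0 \<and> exp_moment_finite (\<omega> + \<epsilon>) \<mu> \<and> (\<forall>s. \<bar>qRe s\<bar> < \<omega> + \<epsilon> \<longrightarrow> f s = laplace \<mu> s)"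

definition V_class :: "real \<Rightarrow> (quaternion \<Rightarrow> quaternion) set" where
  "V_class \<omega> = {f. \<exists>\<mu>\<in>S_class \<omega>. \<exists>\<epsilon>. laplace_on \<omega> \<epsilon> \<mu> f}"

definition intrinsic_V_class :: "real \<Rightarrow> (quaternion \<Rightarrow> quaternion) set" where
  "intrinsic_V_class \<omega> =
     {f. \<exists>\<mu>\<in>S_class \<omega>. \<exists>\<epsilon>. laplace_on \<omega> \<epsilon> \<mu> f \<and>
          (\<forall>s. \<bar>qRe s\<bar> < \<omega> + \<epsilon> \<longrightarrow> f (qcnj s) = qcnj (f s))}"

definition measure_op ::
    "(real \<Rightarrow> 'v::quaternionic_banach \<Rightarrow> 'v) \<Rightarrow> (real set \<Rightarrow> quaternion) \<Rightarrow> 'v \<Rightarrow> 'v" where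
  "measure_op Z \<mu> v = bochner_int (variation \<mu>) (\<lambda>t. qleft (polar \<mu> t) (Z (- t) v))"

text \<open>
  The choice of \<open>\<mu>\<close> is harmless: a Laplace transform on a strip determines the
  measure on the Borel sets.
\<close>

definition fun_calc ::
    "real \<Rightarrow> (real \<Rightarrow> 'v::quaternionic_banach \<Rightarrow> 'v) \<Rightarrow> (quaternion \<Rightarrow> quaternion) \<Rightarrow> 'v \<Rightarrow> 'v" where
  "fun_calc \<omega> Z f = measure_op Z (SOME \<mu>. \<mu> \<in> S_class \<omega> \<and> (\<exists>\<epsilon>. laplace_on \<omega> \<epsilon> \<mu> f))"

section \<open>Intrinsic polynomials and inverting sequences\<close>

definition qpoly :: "real poly \<Rightarrow> quaternion \<Rightarrow> quaternion" where
  "qpoly P s = (\<Sum>k\<le>degree P. coeff P k *\<^sub>R s ^ k)"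

text \<open>\<open>P[T]\<close>; its domain is \<open>pow_dom D T (degree P)\<close>.\<close>

definition poly_op :: "real poly \<Rightarrow> ('v::real_vector \<Rightarrow> 'v) \<Rightarrow> 'v \<Rightarrow> 'v" where
  "poly_op P T v = (\<Sum>k\<le>degree P. coeff P k *\<^sub>R (T ^^ k) v)"

definition inverting_sequence ::
    "real \<Rightarrow> (real \<Rightarrow> 'v::quaternionic_banach \<Rightarrow> 'v) \<Rightarrow> (nat \<Rightarrow> real poly) \<Rightarrow>
     (quaternion \<Rightarrow> quaternion) \<Rightarrow> bool" where
  "inverting_sequence \<omega> Z P f \<longleftrightarrow>
     (\<forall>n. (\<lambda>s. qpoly (P n) s * f s) \<in> V_class \<omega>) \<and>
     (\<exists>\<epsilon>>0. \<exists>M'>0. \<forall>s. \<bar>qRe s\<bar> \<le> \<omega> + \<epsilon> \<longrightarrow>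
        (\<forall>n. norm (qpoly (P n) s * f s) \<le> M') \<and>
        (\<lambda>n. qpoly (P n) s * f s) \<longlonglongrightarrow> 1) \<and>
     (\<exists>M''>0. \<forall>n. onorm (fun_calc \<omega> Z (\<lambda>s. qpoly (P n) s * f s)) \<le> M'')"

end

theory Submission
  imports Defs "HOL-Probability.Probability"
begin

text \<open>
  Since \<open>f\<close> and the \<open>P\<^sub>n f\<close> are symmetric under conjugation, uniqueness of characteristic functions
  shows that their representing measures \<open>\<mu>\<close> and \<open>\<nu>\<^sub>n\<close> are real, so the operators \<open>f(T)\<close> and \<open>(P\<^sub>n f)(T)\<close>
  commute with the group and with \<open>T\<close>.  For a Gaussian \<open>g\<close> of width \<open>\<delta>\<close> put
  \<open>g(T) w = \<integral> g(t) Z(-t) w dt\<close>; these vectors are smooth, \<open>T\<^sup>k g(T) = g\<^sup>(\<^sup>k\<^sup>)(T)\<close>, and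
  \<open>g(T) w \<rightarrow> w\<close> as \<open>\<delta> \<rightarrow> 0\<close>.  The derivatives of \<open>g\<close> are Fourier integrals of
  \<open>z\<^sup>k exp(\<delta>\<^sup>2z\<^sup>2/2)\<close> over any vertical line, hence \<open>\<nu>\<^sub>n * g = \<mu> * P\<^sub>n(d/dt) g\<close>, which gives
  \<open>(P\<^sub>n f)(T) = f(T) P\<^sub>n[T]\<close> on the domain of \<open>P\<^sub>n[T]\<close>; a real point of the S-resolvent set moves
  \<open>P\<^sub>n[T]\<close> in front of \<open>f(T)\<close>.  Shifting the line to \<open>Re z = \<plusminus>b\<close> with \<open>b > \<omega>\<close>, dominated convergence yields
  \<open>\<bar>\<nu>\<^sub>n * g - g\<bar> \<le> e\<^sub>n exp(-b\<bar>t\<bar>)\<close> with \<open>e\<^sub>n \<rightarrow> 0\<close>, so \<open>(P\<^sub>n f)(T) g(T) w \<rightarrow> g(T) w\<close>; the uniform bound on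
  \<open>(P\<^sub>n f)(T)\<close> extends this to all vectors.
\<close>

section \<open>Bochner integrals in nonseparable spaces\<close>

text \<open>Condition (ii) controls \<open>P\<^sub>n f\<close> only pointwise. It says nothing
  directly about the measures \<open>\<nu>\<^sub>n\<close>, whose admissible strips may shrink
  towards \<bar>Re z\<bar> \<le> \<omega> as n grows. Hence \<open>\<nu>\<^sub>n\<close> is compared
  with \<mu> on the imaginary axis alone, and lines are shifted only for
  \<open>\<mu> * P\<^sub>n(d/dt) g\<close>, whose strip does not depend on n. The Gaussian makes
  these inverse transforms absolutely convergent whatever the degree of \<open>P\<^sub>n\<close>.

  The space V may be nonseparable. Integrals along orbits are obtained as limits of Riemann sums,
  and the same sums replace an interchange of V-valued integrals in \<nu>(T) g(T) = (\<nu> * g)(T).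

  Both \<open>polar\<close> and the measure inside \<open>fun_calc\<close> are choices: the polar
  decomposition has to be shown to exist, and the argument is run for whichever measure was chosen.

  The identity \<open>(P\<^sub>n f)(T) = f(T) P\<^sub>n[T]\<close> lives on the domain of
  \<open>P\<^sub>n[T]\<close> and does not say that f(T) u belongs to that domain. This is where the
  spectral hypothesis enters: the strip is open, so the real point \<omega> lies in the S-resolvent
  set.\<close>

lemma norm_integral_le:
  fixes f :: "'a \<Rightarrow> 'b::{banach, second_countable_topology}"
  assumes "\<And>x. norm (f x) \<le> g x" "integrable M f" "integrable M g"
  shows "norm (integral\<^sup>L M f) \<le> integral\<^sup>L M g"
  by (rule order_trans[OF integral_norm_bound integral_mono]) (use assms in auto)

abbreviation "sb_integrable \<equiv> Bochner_Integration.simple_bochner_integrable"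
abbreviation "sb_integral \<equiv> Bochner_Integration.simple_bochner_integral"

definition strongly_measurable :: "'a measure \<Rightarrow> ('a \<Rightarrow> 'b::real_normed_vector) \<Rightarrow> bool" where
  "strongly_measurable M f \<longleftrightarrow> (\<exists>s :: nat \<Rightarrow> 'a \<Rightarrow> 'b. (\<forall>i. simple_function M (s i)) \<and>
     (\<forall>y\<in>space M. (\<lambda>i. s i y) \<longlonglongrightarrow> f y))"

lemma has_bochner_int_alt:
  "has_bochner_int M f x \<longleftrightarrow> strongly_measurable M f \<and>
     (\<exists>s. (\<forall>i. sb_integrable M (s i)) \<and>
        (\<lambda>i. \<integral>\<^sup>+y. ennreal (norm (f y - s i y)) \<partial>M) \<longlonglongrightarrow> 0 \<and>
        (\<lambda>i. sb_integral M (s i)) \<longlonglongrightarrow> x)"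
  unfolding has_bochner_int_def strongly_measurable_def ..

lemma strongly_measurable_simple: "simple_function M f \<Longrightarrow> strongly_measurable M f"
  unfolding strongly_measurable_def by (rule exI[of _ "\<lambda>_. f"]) simp

lemma strongly_measurable_borel:
  fixes f :: "'a \<Rightarrow> 'b::{real_normed_vector, second_countable_topology}"
  assumes "f \<in> borel_measurable M"
  shows "strongly_measurable M f"
  using borel_measurable_implies_sequence_metric[OF assms, of 0]
  unfolding strongly_measurable_def by blast

text \<open>A binary operation maps pairs of simple functions to simple functions, so sequential
  joint continuity of \<open>p\<close> is enough. In this form the lemma serves sums, differences,
  scaling and the quaternionic action alike.\<close>

lemma strongly_measurable_compose2:
  assumes "strongly_measurable M f" "strongly_measurable M g"
    and p: "\<And>u v a b. u \<longlonglongrightarrow> a \<Longrightarrow> v \<longlonglongrightarrow> b \<Longrightarrow> (\<lambda>i. p (u i) (v i)) \<longlonglongrightarrow> p a b"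
  shows "strongly_measurable M (\<lambda>x. p (f x) (g x))"
proof -
  obtain s where s: "\<And>i. simple_function M (s i)" "\<And>y. y \<in> space M \<Longrightarrow> (\<lambda>i. s i y) \<longlonglongrightarrow> f y"
    using assms(1) by (auto simp: strongly_measurable_def)
  obtain t where t: "\<And>i. simple_function M (t i)" "\<And>y. y \<in> space M \<Longrightarrow> (\<lambda>i. t i y) \<longlonglongrightarrow> g y"
    using assms(2) by (auto simp: strongly_measurable_def)
  have "simple_function M (\<lambda>x. p (s i x) (t i x))" for i
    by (rule simple_function_compose2[OF s(1) t(1)])
  moreover have "(\<lambda>i. p (s i y) (t i y)) \<longlonglongrightarrow> p (f y) (g y)" if "y \<in> space M" for y
    by (rule p[OF s(2)[OF that] t(2)[OF that]])
  ultimately show ?thesis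
    unfolding strongly_measurable_def by (intro exI[of _ "\<lambda>i x. p (s i x) (t i x)"]) blast
qed

lemma strongly_measurable_diff:
  "strongly_measurable M f \<Longrightarrow> strongly_measurable M g \<Longrightarrow> strongly_measurable M (\<lambda>x. f x - g x)"
  by (rule strongly_measurable_compose2) (auto intro: tendsto_diff)

lemma strongly_measurable_add:
  "strongly_measurable M f \<Longrightarrow> strongly_measurable M g \<Longrightarrow> strongly_measurable M (\<lambda>x. f x + g x)"
  by (rule strongly_measurable_compose2) (auto intro: tendsto_add)

text \<open>For values in a nonseparable space, strong measurability is kept as the basic notion and
  Borel measurability is claimed only for the real function \<open>norm (f x)\<close>; this is what
  the nonnegative integrals below require.\<close>

lemma strongly_measurable_norm:
  assumes "strongly_measurable M f"
  shows "(\<lambda>x. norm (f x)) \<in> borel_measurable M"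
proof -
  obtain s where s: "\<And>i. simple_function M (s i)" "\<And>y. y \<in> space M \<Longrightarrow> (\<lambda>i. s i y) \<longlonglongrightarrow> f y"
    using assms by (auto simp: strongly_measurable_def)
  show ?thesis
    by (rule borel_measurable_LIMSEQ_real[where u="\<lambda>i x. norm (s i x)"])
      (use s in \<open>auto intro!: tendsto_norm borel_measurable_simple_function simple_function_compose1[OF s(1)]\<close>)
qed

lemma simple_bochner_integrable_strongly_measurable:
  "sb_integrable M s \<Longrightarrow> strongly_measurable M s"
  by (auto intro: strongly_measurable_simple elim: Bochner_Integration.simple_bochner_integrable.cases)

lemma nn_integral_norm_triangle:
  assumes "strongly_measurable M f" "strongly_measurable M g" "strongly_measurable M h"
  shows "(\<integral>\<^sup>+x. norm (f x - h x) \<partial>M) \<le> (\<integral>\<^sup>+x. norm (f x - g x) \<partial>M) + (\<integral>\<^sup>+x. norm (g x - h x) \<partial>M)"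
proof -
  note [measurable] = strongly_measurable_norm[OF strongly_measurable_diff[OF assms(1,2)]]
    strongly_measurable_norm[OF strongly_measurable_diff[OF assms(2,3)]]
  have "(\<integral>\<^sup>+x. norm (f x - h x) \<partial>M) \<le> (\<integral>\<^sup>+x. ennreal (norm (f x - g x)) + ennreal (norm (g x - h x)) \<partial>M)"
  proof (rule nn_integral_mono)
    fix x
    have "norm (f x - h x) \<le> norm (f x - g x) + norm (g x - h x)"
      using norm_triangle_ineq[of "f x - g x" "g x - h x"] by simp
    then show "ennreal (norm (f x - h x)) \<le> ennreal (norm (f x - g x)) + ennreal (norm (g x - h x))"
      by (simp flip: ennreal_plus)
  qed
  also have "\<dots> = (\<integral>\<^sup>+x. norm (f x - g x) \<partial>M) + (\<integral>\<^sup>+x. norm (g x - h x) \<partial>M)"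
    by (rule nn_integral_add) auto
  finally show ?thesis .
qed

lemma simple_bochner_integral_diff_le:
  assumes s: "sb_integrable M s"
    and t: "sb_integrable M t"
  shows "ennreal (norm (sb_integral M s - sb_integral M t))
    \<le> (\<integral>\<^sup>+x. norm (s x - t x) \<partial>M)"
proof -
  have "norm (sb_integral M s - sb_integral M t)
      = norm (sb_integral M (\<lambda>x. s x - t x))"
    using s t by (subst simple_bochner_integral_diff) auto
  also have "\<dots> \<le> sb_integral M (\<lambda>x. norm (s x - t x))"
    using simple_bochner_integrable_compose2[of "(-)" M "s" "t"] s t
    by (auto intro!: simple_bochner_integral_norm_bound)
  finally have "ennreal (norm (sb_integral M s - sb_integral M t)) \<le>
     ennreal (sb_integral M (\<lambda>x. norm (s x - t x)))"
    by (rule ennreal_leI)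
  also have "\<dots> = (\<integral>\<^sup>+x. norm (s x - t x) \<partial>M)"
    using simple_bochner_integrable_compose2[of "\<lambda>x y. norm (x - y)" M "s" "t"] s t
    by (auto intro!: simple_bochner_integral_eq_nn_integral)
  finally show ?thesis .
qed

text \<open>The triangle inequality is passed through the approximating simple functions and then to
  the limit. Uniqueness of the integral, the norm bound and the later L1 comparisons of kernels are
  all instances.\<close>

lemma has_bochner_int_diff_le:
  assumes f: "has_bochner_int M f x" and g: "has_bochner_int M g y"
  shows "ennreal (norm (x - y)) \<le> (\<integral>\<^sup>+t. norm (f t - g t) \<partial>M)"
proof -
  let ?I = "sb_integral M"
  obtain s where s: "\<And>i. sb_integrable M (s i)"
    "(\<lambda>i. \<integral>\<^sup>+y. ennreal (norm (f y - s i y)) \<partial>M) \<longlonglongrightarrow> 0" "(\<lambda>i. ?I (s i)) \<longlonglongrightarrow> x"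
    using f by (auto simp: has_bochner_int_alt)
  obtain t where t: "\<And>i. sb_integrable M (t i)"
    "(\<lambda>i. \<integral>\<^sup>+y. ennreal (norm (g y - t i y)) \<partial>M) \<longlonglongrightarrow> 0" "(\<lambda>i. ?I (t i)) \<longlonglongrightarrow> y"
    using g by (auto simp: has_bochner_int_alt)
  have fm: "strongly_measurable M f" and gm: "strongly_measurable M g"
    using f g by (auto simp: has_bochner_int_alt)
  note sm = simple_bochner_integrable_strongly_measurable[OF s(1)]
  note tm = simple_bochner_integrable_strongly_measurable[OF t(1)]
  have 1: "(\<lambda>i. ennreal (norm (?I (s i) - ?I (t i)))) \<longlonglongrightarrow> ennreal (norm (x - y))"
    by (intro tendsto_ennrealI tendsto_norm tendsto_diff s t)
  have 2: "(\<lambda>i. ((\<integral>\<^sup>+y. ennreal (norm (f y - s i y)) \<partial>M) + (\<integral>\<^sup>+t. norm (f t - g t) \<partial>M)) +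
      (\<integral>\<^sup>+y. ennreal (norm (g y - t i y)) \<partial>M)) \<longlonglongrightarrow> (0 + (\<integral>\<^sup>+t. norm (f t - g t) \<partial>M)) + 0"
    by (intro tendsto_add s t tendsto_const)
  have 3: "ennreal (norm (?I (s i) - ?I (t i))) \<le>
     ((\<integral>\<^sup>+y. ennreal (norm (f y - s i y)) \<partial>M) + (\<integral>\<^sup>+t. norm (f t - g t) \<partial>M)) +
      (\<integral>\<^sup>+y. ennreal (norm (g y - t i y)) \<partial>M)" for i
  proof -
    have "ennreal (norm (?I (s i) - ?I (t i))) \<le> (\<integral>\<^sup>+y. norm (s i y - t i y) \<partial>M)"
      by (rule simple_bochner_integral_diff_le[OF s(1) t(1)])
    also have "\<dots> \<le> (\<integral>\<^sup>+y. norm (s i y - g y) \<partial>M) + (\<integral>\<^sup>+y. norm (g y - t i y) \<partial>M)"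
      by (rule nn_integral_norm_triangle[OF sm gm tm])
    also have "(\<integral>\<^sup>+y. norm (s i y - g y) \<partial>M) \<le> (\<integral>\<^sup>+y. norm (s i y - f y) \<partial>M) + (\<integral>\<^sup>+y. norm (f y - g y) \<partial>M)"
      by (rule nn_integral_norm_triangle[OF sm fm gm])
    finally show ?thesis by (simp add: norm_minus_commute add_right_mono)
  qed
  show ?thesis
    using LIMSEQ_le[OF 1 2] 3 by auto
qed

lemma has_bochner_int_unique:
  "has_bochner_int M f x \<Longrightarrow> has_bochner_int M f y \<Longrightarrow> x = y"
  using has_bochner_int_diff_le[of M f x f y] by simp

lemma bochner_int_eqI: "has_bochner_int M f x \<Longrightarrow> bochner_int M f = x"
  unfolding bochner_int_def by (auto intro: has_bochner_int_unique)

lemma has_bochner_int_AE: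
  assumes f: "has_bochner_int M f x" and g: "strongly_measurable M g" and ae: "AE t in M. f t = g t"
  shows "has_bochner_int M g x"
proof -
  have "(\<integral>\<^sup>+y. ennreal (norm (g y - s i y)) \<partial>M) = (\<integral>\<^sup>+y. ennreal (norm (f y - s i y)) \<partial>M)" for s :: "nat \<Rightarrow> _" and i
    using ae by (intro nn_integral_cong_AE) auto
  note eq = this
  obtain s where "\<And>i. sb_integrable M (s i)"
    "(\<lambda>i. \<integral>\<^sup>+y. ennreal (norm (f y - s i y)) \<partial>M) \<longlonglongrightarrow> 0"
    "(\<lambda>i. sb_integral M (s i)) \<longlonglongrightarrow> x"
    using f by (auto simp: has_bochner_int_alt)
  then show ?thesis
    unfolding has_bochner_int_alt using g by (intro conjI exI[of _ s]) (auto simp: eq)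
qed

lemma has_bochner_int_zero: "has_bochner_int M (\<lambda>_. 0) 0"
  unfolding has_bochner_int_alt
proof (intro conjI exI[of _ "\<lambda>_ _. 0"] allI)
  show "strongly_measurable M (\<lambda>_. 0)" by (rule strongly_measurable_simple) auto
qed (auto simp: Bochner_Integration.simple_bochner_integrable.simps
   Bochner_Integration.simple_bochner_integral_def image_constant_conv)

lemma ennreal_tendsto_0_le:
  fixes a b :: "nat \<Rightarrow> ennreal"
  assumes "\<And>i. a i \<le> b i" "b \<longlonglongrightarrow> 0"
  shows "a \<longlonglongrightarrow> 0"
  by (rule tendsto_sandwich[OF _ _ tendsto_const assms(2)]) (use assms(1) in auto)

lemma has_bochner_int_add:
  assumes f: "has_bochner_int M f x" and g: "has_bochner_int M g y"
  shows "has_bochner_int M (\<lambda>t. f t + g t) (x + y)"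
proof -
  let ?I = "sb_integral M"
  obtain s where s: "\<And>i. sb_integrable M (s i)"
    "(\<lambda>i. \<integral>\<^sup>+y. ennreal (norm (f y - s i y)) \<partial>M) \<longlonglongrightarrow> 0" "(\<lambda>i. ?I (s i)) \<longlonglongrightarrow> x"
    using f by (auto simp: has_bochner_int_alt)
  obtain t where t: "\<And>i. sb_integrable M (t i)"
    "(\<lambda>i. \<integral>\<^sup>+y. ennreal (norm (g y - t i y)) \<partial>M) \<longlonglongrightarrow> 0" "(\<lambda>i. ?I (t i)) \<longlonglongrightarrow> y"
    using g by (auto simp: has_bochner_int_alt)
  have fm: "strongly_measurable M f" and gm: "strongly_measurable M g"
    using f g by (auto simp: has_bochner_int_alt)
  note sm = simple_bochner_integrable_strongly_measurable[OF s(1)]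
  note tm = simple_bochner_integrable_strongly_measurable[OF t(1)]
  have "(\<integral>\<^sup>+u. norm (f u + g u - (s i u + t i u)) \<partial>M) \<le>
     (\<integral>\<^sup>+u. norm (f u - s i u) \<partial>M) + (\<integral>\<^sup>+u. norm (g u - t i u) \<partial>M)" for i
  proof -
    have *: "(\<lambda>u. f u + g u - (s i u + g u)) = (\<lambda>u. f u - s i u)"
       "(\<lambda>u. s i u + g u - (s i u + t i u)) = (\<lambda>u. g u - t i u)" by auto
    show ?thesis
      using nn_integral_norm_triangle[OF strongly_measurable_add[OF fm gm]
          strongly_measurable_add[OF sm[of i] gm] strongly_measurable_add[OF sm[of i] tm[of i]]]
      by (simp add: algebra_simps)
  qed
  moreover have "(\<lambda>i. (\<integral>\<^sup>+u. norm (f u - s i u) \<partial>M) + (\<integral>\<^sup>+u. norm (g u - t i u) \<partial>M)) \<longlonglongrightarrow> 0"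
    using tendsto_add[OF s(2) t(2)] by simp
  ultimately have lim: "(\<lambda>i. \<integral>\<^sup>+u. norm (f u + g u - (s i u + t i u)) \<partial>M) \<longlonglongrightarrow> 0"
    by (rule ennreal_tendsto_0_le)
  have "(\<lambda>i. ?I (\<lambda>u. s i u + t i u)) \<longlonglongrightarrow> x + y"
    using s(1) t(1) by (simp add: simple_bochner_integral_add tendsto_add s t)
  with lim s(1) t(1) fm gm show ?thesis
    unfolding has_bochner_int_alt
    by (intro conjI exI[of _ "\<lambda>i u. s i u + t i u"])
      (auto intro: strongly_measurable_add simple_bochner_integrable_compose2)
qed

lemma has_bochner_int_sum:
  assumes "\<And>i. i \<in> I \<Longrightarrow> has_bochner_int M (f i) (x i)"
  shows "has_bochner_int M (\<lambda>t. \<Sum>i\<in>I. f i t) (\<Sum>i\<in>I. x i)"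
  using assms
  by (induction I rule: infinite_finite_induct) (auto intro: has_bochner_int_zero has_bochner_int_add)

lemma has_bochner_int_bounded_linear:
  assumes T: "bounded_linear T" and f: "has_bochner_int M f x"
  shows "has_bochner_int M (\<lambda>t. T (f t)) (T x)"
proof -
  interpret T: bounded_linear T by fact
  let ?I = "sb_integral M"
  obtain s where s: "\<And>i. sb_integrable M (s i)"
    "(\<lambda>i. \<integral>\<^sup>+y. ennreal (norm (f y - s i y)) \<partial>M) \<longlonglongrightarrow> 0" "(\<lambda>i. ?I (s i)) \<longlonglongrightarrow> x"
    using f by (auto simp: has_bochner_int_alt)
  have fm: "strongly_measurable M f"
    using f by (auto simp: has_bochner_int_alt)
  note sm = simple_bochner_integrable_strongly_measurable[OF s(1)]
  note [measurable] = strongly_measurable_norm[OF strongly_measurable_diff[OF fm sm]]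
  have Tf: "strongly_measurable M (\<lambda>t. T (f t))"
    by (rule strongly_measurable_compose2[OF fm fm, of "\<lambda>x y. T x"]) (auto intro: T.tendsto)
  obtain K where K: "K > 0" "\<And>x. norm (T x) \<le> norm x * K"
    using T.pos_bounded by auto
  have "(\<integral>\<^sup>+u. norm (T (f u) - T (s i u)) \<partial>M) \<le> K * (\<integral>\<^sup>+u. norm (f u - s i u) \<partial>M)" for i
  proof -
    have "(\<integral>\<^sup>+u. norm (T (f u) - T (s i u)) \<partial>M) \<le> (\<integral>\<^sup>+u. ennreal K * norm (f u - s i u) \<partial>M)"
      using K by (intro nn_integral_mono) (auto simp: T.diff[symmetric] ac_simps ennreal_mult[symmetric])
    also have "\<dots> = K * (\<integral>\<^sup>+u. norm (f u - s i u) \<partial>M)"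
      by (rule nn_integral_cmult) auto
    finally show ?thesis .
  qed
  moreover have "(\<lambda>i. K * (\<integral>\<^sup>+u. norm (f u - s i u) \<partial>M)) \<longlonglongrightarrow> 0"
    using ennreal_tendsto_cmult[OF _ s(2)] by simp
  ultimately have lim: "(\<lambda>i. \<integral>\<^sup>+u. norm (T (f u) - T (s i u)) \<partial>M) \<longlonglongrightarrow> 0"
    by (rule ennreal_tendsto_0_le)
  have "(\<lambda>i. ?I (\<lambda>u. T (s i u))) \<longlonglongrightarrow> T x"
    using s(1) by (simp add: simple_bochner_integral_linear T.linear_axioms T.tendsto s)
  moreover have "sb_integrable M (\<lambda>u. T (s i u))" for i
    using simple_bochner_integrable_compose2[of "\<lambda>x y. T x", OF T.zero s(1)[of i] s(1)[of i]] .
  ultimately show ?thesis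
    unfolding has_bochner_int_alt using Tf lim
    by (intro conjI exI[of _ "\<lambda>i u. T (s i u)"]) auto
qed

text \<open>A diagonal choice: for each n a simple function within \<open>1 / Suc n\<close> of
  \<open>g n\<close> in L1, whose integral is equally close to \<open>x n\<close>. These simple
  functions approximate \<open>f\<close> in L1, so their integrals are Cauchy, and completeness
  supplies the value. The existence of integrals of orbits rests on this.\<close>

lemma has_bochner_int_limit:
  fixes f :: "'a \<Rightarrow> 'b::banach"
  assumes f: "strongly_measurable M f"
    and g: "\<And>n. has_bochner_int M (g n) (x n)"
    and lim: "(\<lambda>n. \<integral>\<^sup>+t. norm (f t - g n t) \<partial>M) \<longlonglongrightarrow> 0"
  obtains l where "has_bochner_int M f l" "x \<longlonglongrightarrow> l"
proof -
  let ?I = "sb_integral M"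
  have gm: "strongly_measurable M (g n)" for n
    using g by (auto simp: has_bochner_int_alt)
  have "\<exists>s. sb_integrable M s \<and>
     (\<integral>\<^sup>+t. norm (g n t - s t) \<partial>M) < ennreal (1 / Suc n) \<and> norm (?I s - x n) < 1 / Suc n" for n
  proof -
    obtain s where s: "\<And>i. sb_integrable M (s i)"
      "(\<lambda>i. \<integral>\<^sup>+y. ennreal (norm (g n y - s i y)) \<partial>M) \<longlonglongrightarrow> 0" "(\<lambda>i. ?I (s i)) \<longlonglongrightarrow> x n"
      using g[of n] by (auto simp: has_bochner_int_alt)
    have "eventually (\<lambda>i. (\<integral>\<^sup>+y. ennreal (norm (g n y - s i y)) \<partial>M) < ennreal (1 / Suc n)) sequentially"
      by (rule order_tendstoD(2)[OF s(2)]) simp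
    moreover have "eventually (\<lambda>i. dist (?I (s i)) (x n) < 1 / Suc n) sequentially"
      by (rule tendstoD[OF s(3)]) simp
    ultimately have "eventually (\<lambda>i. (\<integral>\<^sup>+y. ennreal (norm (g n y - s i y)) \<partial>M) < ennreal (1 / Suc n) \<and> dist (?I (s i)) (x n) < 1 / Suc n) sequentially"
      by (rule eventually_conj)
    then obtain i where "(\<integral>\<^sup>+y. ennreal (norm (g n y - s i y)) \<partial>M) < ennreal (1 / Suc n)" "dist (?I (s i)) (x n) < 1 / Suc n"
      using eventually_happens by fastforce
    with s(1)[of i] show ?thesis by (auto simp: dist_norm)
  qed
  then obtain s where s: "\<And>n. sb_integrable M (s n)"
     "\<And>n. (\<integral>\<^sup>+t. norm (g n t - s n t) \<partial>M) < ennreal (1 / Suc n)" "\<And>n. norm (?I (s n) - x n) < 1 / Suc n"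
    by metis
  note sm = simple_bochner_integrable_strongly_measurable[OF s(1)]
  have inv: "(\<lambda>n. 1 / real (Suc n)) \<longlonglongrightarrow> 0"
    using LIMSEQ_inverse_real_of_nat by (simp add: inverse_eq_divide)
  define e where "e n = (\<integral>\<^sup>+t. norm (f t - s n t) \<partial>M)" for n
  have e: "e \<longlonglongrightarrow> 0"
  proof (rule tendsto_sandwich[OF _ _ tendsto_const])
    show "eventually (\<lambda>n. e n \<le> (\<integral>\<^sup>+t. norm (f t - g n t) \<partial>M) + ennreal (1 / Suc n)) sequentially"
      using nn_integral_norm_triangle[OF f gm sm] s(2) unfolding e_def
      by (intro always_eventually allI) (meson add_left_mono less_imp_le order_trans)
    show "(\<lambda>n. (\<integral>\<^sup>+t. norm (f t - g n t) \<partial>M) + ennreal (1 / Suc n)) \<longlonglongrightarrow> 0"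
      using tendsto_add[OF lim tendsto_ennrealI[OF inv]] by simp
  qed auto
  have "Cauchy (\<lambda>n. ?I (s n))"
  proof (rule metric_CauchyI)
    fix d :: real assume d: "0 < d"
    have "eventually (\<lambda>n. e n < ennreal (d/2)) sequentially"
      by (rule order_tendstoD(2)[OF e]) (use d in simp)
    then obtain N where N: "\<And>n. n \<ge> N \<Longrightarrow> e n < ennreal (d/2)"
      by (auto simp: eventually_sequentially)
    have "dist (?I (s m)) (?I (s n)) < d" if "m \<ge> N" "n \<ge> N" for m n
    proof -
      have "ennreal (norm (?I (s m) - ?I (s n))) \<le> (\<integral>\<^sup>+x. norm (s m x - s n x) \<partial>M)"
        by (rule simple_bochner_integral_diff_le[OF s(1) s(1)])
      also have "\<dots> \<le> e m + e n"
        using nn_integral_norm_triangle[OF sm f sm, of m n] by (simp add: e_def norm_minus_commute)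
      also have "\<dots> < ennreal (d/2) + ennreal (d/2)"
        using N that by (intro add_strict_mono) auto
      also have "\<dots> = ennreal d" using d by (simp flip: ennreal_plus)
      finally show ?thesis using d by (simp add: dist_norm ennreal_less_iff)
    qed
    then show "\<exists>M. \<forall>m\<ge>M. \<forall>n\<ge>M. dist (?I (s m)) (?I (s n)) < d" by blast
  qed
  then obtain l where l: "(\<lambda>n. ?I (s n)) \<longlonglongrightarrow> l"
    by (auto simp: Cauchy_convergent_iff convergent_def)
  have "has_bochner_int M f l"
    unfolding has_bochner_int_alt
    by (intro conjI exI[of _ s] allI f s(1) l) (rule e[unfolded e_def[abs_def]])
  moreover have "(\<lambda>n. ?I (s n) - x n) \<longlonglongrightarrow> 0"
    by (rule Lim_null_comparison[OF _ inv]) (intro always_eventually allI less_imp_le[OF s(3)])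
  from tendsto_diff[OF l this] have "x \<longlonglongrightarrow> l" by simp
  ultimately show ?thesis by (rule that)
qed

lemma has_bochner_int_norm_le:
  assumes "has_bochner_int M f x"
  shows "ennreal (norm x) \<le> (\<integral>\<^sup>+t. norm (f t) \<partial>M)"
  using has_bochner_int_diff_le[OF assms has_bochner_int_zero] by simp

text \<open>Translating the approximating simple functions translates their level sets. Lebesgue
  measure is invariant, so the simple integrals and the L1 errors do not change.\<close>

lemma has_bochner_int_shift:
  fixes f :: "real \<Rightarrow> 'b::real_normed_vector"
  assumes "has_bochner_int lborel f x"
  shows "has_bochner_int lborel (\<lambda>t. f (h + t)) x"
proof -
  let ?I = "sb_integral lborel"
  have T: "(+) h \<in> measurable lborel lborel" by simp
  obtain s where s: "\<And>i. sb_integrable lborel (s i)"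
    "(\<lambda>i. \<integral>\<^sup>+y. ennreal (norm (f y - s i y)) \<partial>lborel) \<longlonglongrightarrow> 0" "(\<lambda>i. ?I (s i)) \<longlonglongrightarrow> x"
    using assms by (auto simp: has_bochner_int_alt)
  have fm: "strongly_measurable lborel f"
    using assms by (auto simp: has_bochner_int_alt)
  have sf: "simple_function lborel (\<lambda>t. u (h + t))" if "simple_function lborel u" for u :: "real \<Rightarrow> 'b"
  proof -
    have "finite (u ` UNIV)" and m: "u -` {y} \<in> sets borel" if "y \<in> range u" for y
      using \<open>simple_function lborel u\<close> that by (auto simp: simple_function_def)
    have "finite ((\<lambda>t. u (h + t)) ` UNIV)"
      by (rule finite_subset[of _ "range u"]) (use \<open>simple_function lborel u\<close> in \<open>auto simp: simple_function_def\<close>)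
    moreover have "(\<lambda>t. u (h + t)) -` {u (h + y)} \<in> sets borel" for y
    proof -
      have "(+) h -` (u -` {u (h + y)}) \<inter> space borel \<in> sets borel"
        by (rule measurable_sets[OF _ m]) auto
      then show ?thesis by (simp add: vimage_def)
    qed
    ultimately show ?thesis by (auto simp: simple_function_def)
  qed
  have meas: "emeasure lborel {t. u (h + t)} = emeasure lborel {t. u t}" if "{t. u t} \<in> sets borel" for u
  proof -
    have "emeasure lborel {t. u t} = emeasure (distr lborel borel ((+) h)) {t. u t}"
      using lborel_distr_plus[of h] by simp
    also have "\<dots> = emeasure lborel ((+) h -` {t. u t} \<inter> space lborel)"
      by (rule emeasure_distr) (use that in auto)
    finally show ?thesis by (simp add: vimage_def)
  qed
  have lev: "{t. u t = y} \<in> sets borel" if "simple_function lborel u" for u :: "real \<Rightarrow> 'b" and y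
    using simple_functionD(2)[OF that, of "{y}"] by (simp add: vimage_def)
  have lev': "{t. u t \<noteq> 0} \<in> sets borel" if "simple_function lborel u" for u :: "real \<Rightarrow> 'b"
    using sets.compl_sets[of _ borel, OF lev[OF that, of 0]]
    by (simp add: Compl_eq_Diff_UNIV[symmetric] Collect_neg_eq[symmetric])
  have si: "sb_integrable lborel (\<lambda>t. s i (h + t))" for i
    using s(1)[of i] meas[of "\<lambda>y. s i y \<noteq> 0"] lev'[of "s i"] sf[of "s i"]
    by (simp add: Bochner_Integration.simple_bochner_integrable.simps)
  have I: "?I (\<lambda>t. s i (h + t)) = ?I (s i)" for i
  proof -
    have "simple_function lborel (s i)"
      using s(1)[of i] by (auto simp: Bochner_Integration.simple_bochner_integrable.simps)
    moreover have "(\<lambda>t. s i (h + t)) ` UNIV = s i ` UNIV"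
    proof -
      have "s i y \<in> (\<lambda>t. s i (h + t)) ` UNIV" for y
        by (rule image_eqI[of _ _ "y - h"]) auto
      then show ?thesis by auto
    qed
    moreover have "measure lborel {t. s i (h + t) = y} = measure lborel {t. s i t = y}" for y
      using meas[OF lev[OF \<open>simple_function lborel (s i)\<close>, of y]] by (simp add: measure_def)
    ultimately show ?thesis
      by (simp add: Bochner_Integration.simple_bochner_integral_def)
  qed
  have n: "(\<integral>\<^sup>+y. ennreal (norm (f (h + y) - s i (h + y))) \<partial>lborel) = (\<integral>\<^sup>+y. ennreal (norm (f y - s i y)) \<partial>lborel)" for i
  proof -
    note [measurable] = strongly_measurable_norm[OF strongly_measurable_diff[OF fm
          simple_bochner_integrable_strongly_measurable[OF s(1)[of i]]]]
    show ?thesis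
      using nn_integral_real_affine[of "\<lambda>y. ennreal (norm (f y - s i y))" 1 h] by simp
  qed
  have "strongly_measurable lborel (\<lambda>t. f (h + t))"
  proof -
    obtain u where "\<And>i. simple_function lborel (u i)" "\<And>y. (\<lambda>i. u i y) \<longlonglongrightarrow> f y"
      using fm by (auto simp: strongly_measurable_def)
    then show ?thesis
      unfolding strongly_measurable_def by (intro exI[of _ "\<lambda>i t. u i (h + t)"]) (auto intro: sf)
  qed
  with si I n s show ?thesis
    unfolding has_bochner_int_alt by (intro conjI exI[of _ "\<lambda>i t. s i (h + t)"]) auto
qed


section \<open>Riemann sums on refining meshes of the real line\<close>

definition cell :: "nat \<Rightarrow> int \<Rightarrow> real set" where
  "cell n i = {t. \<lfloor>t * real (Suc n)\<rfloor> = i}"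

definition node :: "nat \<Rightarrow> int \<Rightarrow> real" where
  "node n i = of_int i / real (Suc n)"

text \<open>With spacing \<open>1 / Suc n\<close>, indices up to the square of \<open>Suc n\<close>
  place the nodes in the interval from \<open>- Suc n\<close> to \<open>Suc n\<close>: a finite mesh
  that becomes finer and exhausts the line at the same time.\<close>

definition mesh :: "nat \<Rightarrow> int set" where
  "mesh n = {- (int (Suc n))\<^sup>2..(int (Suc n))\<^sup>2}"

definition step_approx :: "nat \<Rightarrow> (real \<Rightarrow> 'b::real_normed_vector) \<Rightarrow> real \<Rightarrow> 'b" where
  "step_approx n X t = (if \<lfloor>t * real (Suc n)\<rfloor> \<in> mesh n then X (node n \<lfloor>t * real (Suc n)\<rfloor>) else 0)"

lemma finite_mesh [simp]: "finite (mesh n)"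
  by (simp add: mesh_def)

lemma cell_sets [measurable]: "cell n i \<in> sets borel"
  unfolding cell_def by measurable

lemma dist_node: "\<bar>node n \<lfloor>t * real (Suc n)\<rfloor> - t\<bar> \<le> 1 / real (Suc n)"
proof -
  have "\<bar>of_int \<lfloor>t * real (Suc n)\<rfloor> - t * real (Suc n)\<bar> \<le> 1" by linarith
  then have "\<bar>of_int \<lfloor>t * real (Suc n)\<rfloor> - t * real (Suc n)\<bar> / real (Suc n) \<le> 1 / real (Suc n)"
    by (rule divide_right_mono) simp
  moreover have "node n \<lfloor>t * real (Suc n)\<rfloor> - t = (of_int \<lfloor>t * real (Suc n)\<rfloor> - t * real (Suc n)) / real (Suc n)"
    by (simp add: node_def field_simps)
  ultimately show ?thesis by (simp add: abs_divide)
qed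

lemma in_mesh:
  assumes "\<bar>t\<bar> \<le> real n"
  shows "\<lfloor>t * real (Suc n)\<rfloor> \<in> mesh n"
proof -
  have "\<bar>t * real (Suc n)\<bar> \<le> real n * real (Suc n)"
    using assms by (simp add: abs_mult mult_right_mono)
  also have "\<dots> \<le> (real (Suc n))\<^sup>2 - 1" by (simp add: power2_eq_square algebra_simps)
  finally have "- real_of_int ((int (Suc n))\<^sup>2) \<le> t * real (Suc n)" "t * real (Suc n) < real_of_int ((int (Suc n))\<^sup>2) + 1"
    by auto
  then show ?thesis
    unfolding mesh_def atLeastAtMost_iff by (intro conjI) (simp_all only: le_floor_iff floor_le_iff of_int_minus)
qed

lemma simple_function_step_approx:
  assumes "sets M = sets borel"
  shows "simple_function M (step_approx n X)"
proof -
  have sp: "space M = UNIV" using sets_eq_imp_space_eq[OF assms] by simp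
  define g where "g i = (if i \<in> mesh n then X (node n i) else 0)" for i
  have g: "step_approx n X = (\<lambda>t. g \<lfloor>t * real (Suc n)\<rfloor>)"
    by (auto simp: step_approx_def g_def)
  have "finite (range (step_approx n X))"
    by (rule finite_subset[of _ "insert 0 ((\<lambda>i. X (node n i)) ` mesh n)"]) (auto simp: step_approx_def)
  moreover have "step_approx n X -` {y} \<in> sets borel" for y
  proof -
    have "(\<lambda>t. \<lfloor>t * real (Suc n)\<rfloor>) -` (g -` {y}) \<inter> space borel \<in> sets borel"
      by (rule measurable_sets[of _ _ "count_space UNIV"]) measurable
    moreover have "(\<lambda>t. \<lfloor>t * real (Suc n)\<rfloor>) -` (g -` {y}) = step_approx n X -` {y}"
      unfolding g by auto
    ultimately show ?thesis by simp
  qed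
  ultimately show ?thesis unfolding simple_function_def sp assms by auto
qed

lemma step_approx_tendsto:
  assumes "continuous_on UNIV X"
  shows "(\<lambda>n. step_approx n X t) \<longlonglongrightarrow> X t"
proof -
  have "(\<lambda>n. node n \<lfloor>t * real (Suc n)\<rfloor> - t) \<longlonglongrightarrow> 0"
    by (rule Lim_null_comparison[of _ "\<lambda>n. 1 / real (Suc n)"])
      (use LIMSEQ_inverse_real_of_nat dist_node in \<open>auto simp: inverse_eq_divide\<close>)
  then have "(\<lambda>n. node n \<lfloor>t * real (Suc n)\<rfloor>) \<longlonglongrightarrow> t"
    using LIM_zero_iff by blast
  moreover have "isCont X t"
    using assms by (simp add: continuous_on_eq_continuous_at)
  ultimately have "(\<lambda>n. X (node n \<lfloor>t * real (Suc n)\<rfloor>)) \<longlonglongrightarrow> X t"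
    by (rule isCont_tendsto_compose[rotated])
  moreover have "eventually (\<lambda>n. X (node n \<lfloor>t * real (Suc n)\<rfloor>) = step_approx n X t) sequentially"
  proof (rule eventually_sequentiallyI[of "nat \<lceil>\<bar>t\<bar>\<rceil>"])
    fix n assume "nat \<lceil>\<bar>t\<bar>\<rceil> \<le> n"
    then have "\<bar>t\<bar> \<le> real n" by linarith
    then show "X (node n \<lfloor>t * real (Suc n)\<rfloor>) = step_approx n X t"
      by (simp add: step_approx_def in_mesh del: of_nat_Suc)
  qed
  ultimately show ?thesis by (rule Lim_transform_eventually)
qed

text \<open>A node is at distance at most \<open>1 / Suc n\<close>, hence at most 1, from the points
  of its cell; the factor \<open>exp b\<close> pays for this displacement, uniformly in
  \<open>n\<close>.\<close>

lemma norm_step_approx_le: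
  assumes "\<And>t. norm (X t) \<le> C * exp (b * \<bar>t\<bar>)" "b \<ge> 0" "C \<ge> 0"
  shows "norm (step_approx n X t) \<le> C * exp b * exp (b * \<bar>t\<bar>)"
proof -
  have "1 / real (Suc n) \<le> 1" by simp
  then have "\<bar>node n \<lfloor>t * real (Suc n)\<rfloor>\<bar> \<le> \<bar>t\<bar> + 1" using dist_node[of n t] by linarith
  then have "b * \<bar>node n \<lfloor>t * real (Suc n)\<rfloor>\<bar> \<le> b * (\<bar>t\<bar> + 1)"
    using assms(2) by (rule mult_left_mono)
  then have "exp (b * \<bar>node n \<lfloor>t * real (Suc n)\<rfloor>\<bar>) \<le> exp b * exp (b * \<bar>t\<bar>)"
    by (simp add: exp_add[symmetric] algebra_simps)
  then have "C * exp (b * \<bar>node n \<lfloor>t * real (Suc n)\<rfloor>\<bar>) \<le> C * (exp b * exp (b * \<bar>t\<bar>))"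
    using assms(3) by (rule mult_left_mono)
  with assms(1)[of "node n \<lfloor>t * real (Suc n)\<rfloor>"] show ?thesis
    using assms(3) by (auto simp: step_approx_def mult.assoc simp del: of_nat_Suc intro: order_trans)
qed

text \<open>A continuous curve is the pointwise limit of its own step functions, however large the
  target space is. This is how orbits of the group become strongly measurable.\<close>

lemma strongly_measurable_continuous:
  fixes X :: "real \<Rightarrow> 'b::real_normed_vector"
  assumes "sets M = sets borel" "continuous_on UNIV X"
  shows "strongly_measurable M X"
  unfolding strongly_measurable_def
  by (intro exI[of _ "\<lambda>n. step_approx n X"] conjI allI ballI simple_function_step_approx assms
      step_approx_tendsto)

text \<open>Only the curve \<open>X\<close> is discretized; the weight \<open>a\<close> is
  integrated exactly over each cell. Dominated convergence gives L1 convergence of the step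
  integrands. The Riemann sums are part of the conclusion because they later carry the interchange
  of two integrals.\<close>

lemma has_bochner_int_riemann:
  fixes X :: "real \<Rightarrow> 'b::banach" and a :: "real \<Rightarrow> real"
  assumes M: "sets M = sets borel" and a [measurable]: "a \<in> borel_measurable borel"
    and X: "continuous_on UNIV X" "\<And>t. norm (X t) \<le> C * exp (b * \<bar>t\<bar>)" and b: "b \<ge> 0"
    and fin: "(\<integral>\<^sup>+t. ennreal (\<bar>a t\<bar> * exp (b * \<bar>t\<bar>)) \<partial>M) < \<infinity>"
  obtains x where "has_bochner_int M (\<lambda>t. a t *\<^sub>R X t) x"
    "(\<lambda>n. \<Sum>i\<in>mesh n. (\<integral>t. indicator (cell n i) t * a t \<partial>M) *\<^sub>R X (node n i)) \<longlonglongrightarrow> x"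
proof -
  \<comment> \<open>The dominating function: \<open>C\<close> bounds the curve itself and
    \<open>C * exp b\<close> its step approximation.\<close>
  let ?w = "\<lambda>t. (C * exp b + C) * (\<bar>a t\<bar> * exp (b * \<bar>t\<bar>))"
  let ?S = "\<lambda>n. \<Sum>i\<in>mesh n. (\<integral>t. indicator (cell n i) t * a t \<partial>M) *\<^sub>R X (node n i)"
  have sp: "space M = UNIV" using sets_eq_imp_space_eq[OF M] by simp
  have aM [measurable]: "a \<in> borel_measurable M" using a measurable_cong_sets[OF M refl] by blast
  have [measurable]: "cell n i \<in> sets M" for n i unfolding M by measurable
  have [measurable]: "(\<lambda>t. \<bar>t\<bar>) \<in> borel_measurable M"
    by (rule borel_measurable_continuous_onI[THEN measurable_cong_sets[OF M refl, THEN equalityD2, THEN subsetD]])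
      (intro continuous_intros)
  have C: "C \<ge> 0" using order_trans[OF norm_ge_zero X(2)[of 0]] by simp
  have fX: "strongly_measurable M (\<lambda>t. a t *\<^sub>R X t)"
    by (rule strongly_measurable_compose2[OF strongly_measurable_borel[OF aM] strongly_measurable_continuous[OF M X(1)]])
      (rule tendsto_scaleR)
  have abs_a: "integrable M a"
  proof (rule integrableI_bounded)
    have "(\<integral>\<^sup>+t. ennreal (norm (a t)) \<partial>M) \<le> (\<integral>\<^sup>+t. ennreal (\<bar>a t\<bar> * exp (b * \<bar>t\<bar>)) \<partial>M)"
      by (intro nn_integral_mono ennreal_leI) (use b in \<open>auto simp: mult_le_cancel_left1\<close>)
    then show "(\<integral>\<^sup>+t. ennreal (norm (a t)) \<partial>M) < \<infinity>" using fin by auto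
  qed (rule aM)
  \<comment> \<open>Grouped by cells, the step integrand is a finite sum of scalar integrable
    functions times fixed vectors, so its integral reduces to integrals of real functions.\<close>
  define g where "g n t = (\<Sum>i\<in>mesh n. (indicator (cell n i) t * a t) *\<^sub>R X (node n i))" for n t
  let ?d = "\<lambda>n t. norm (a t *\<^sub>R X t - g n t)"
  have g: "g n t = a t *\<^sub>R step_approx n X t" for n t
  proof -
    have "g n t = (\<Sum>i\<in>mesh n. if i = \<lfloor>t * real (Suc n)\<rfloor> then a t *\<^sub>R X (node n i) else 0)"
      unfolding g_def by (intro sum.cong) (auto simp: cell_def)
    then show ?thesis by (simp add: step_approx_def)
  qed
  have gint: "has_bochner_int M (g n) (?S n)" for n
    unfolding g_def
  proof (rule has_bochner_int_sum)
    fix i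
    have "integrable M (\<lambda>t. indicator (cell n i) t * a t)"
      using integrable_mult_indicator[OF _ abs_a, of "cell n i"] by simp
    then have "has_bochner_int M (\<lambda>t. indicator (cell n i) t * a t) (\<integral>t. indicator (cell n i) t * a t \<partial>M)"
      by (simp add: has_bochner_int_iff_has_bochner_integral has_bochner_integral_integrable)
    from has_bochner_int_bounded_linear[OF bounded_linear_scaleR_left this]
    show "has_bochner_int M (\<lambda>t. (indicator (cell n i) t * a t) *\<^sub>R X (node n i))
        ((\<integral>t. indicator (cell n i) t * a t \<partial>M) *\<^sub>R X (node n i))" .
  qed
  have "(\<lambda>n. \<integral>\<^sup>+t. ?d n t \<partial>M) \<longlonglongrightarrow> (\<integral>\<^sup>+t. 0 \<partial>M)"
  proof (rule nn_integral_dominated_convergence[where w="\<lambda>t. ennreal (?w t)"])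
    have gm: "strongly_measurable M (g n)" for n
      using gint by (auto simp: has_bochner_int_alt)
    show "(\<lambda>t. ennreal (?d n t)) \<in> borel_measurable M" for n
      using strongly_measurable_norm[OF strongly_measurable_diff[OF fX gm]] by measurable
    show "(\<integral>\<^sup>+t. ennreal (?w t) \<partial>M) < \<infinity>"
    proof -
      have "(\<integral>\<^sup>+t. ennreal (?w t) \<partial>M) =
        (\<integral>\<^sup>+t. ennreal (C * exp b + C) * ennreal (\<bar>a t\<bar> * exp (b * \<bar>t\<bar>)) \<partial>M)"
        using C by (intro nn_integral_cong ennreal_mult) auto
      also have "\<dots> = ennreal (C * exp b + C) * (\<integral>\<^sup>+t. ennreal (\<bar>a t\<bar> * exp (b * \<bar>t\<bar>)) \<partial>M)"
        by (rule nn_integral_cmult) measurable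
      finally show ?thesis using fin by (simp add: ennreal_mult_less_top)
    qed
    show "AE t in M. ennreal (?d n t) \<le> ennreal (?w t)" for n
    proof (intro AE_I2 ennreal_leI)
      fix t
      have "norm (X t - step_approx n X t) \<le> C * exp (b * \<bar>t\<bar>) + C * exp b * exp (b * \<bar>t\<bar>)"
        by (rule order_trans[OF norm_triangle_ineq4 add_mono[OF X(2) norm_step_approx_le[OF X(2) b C]]])
      then have "\<bar>a t\<bar> * norm (X t - step_approx n X t) \<le> \<bar>a t\<bar> * (C * exp (b * \<bar>t\<bar>) + C * exp b * exp (b * \<bar>t\<bar>))"
        by (rule mult_left_mono) simp
      moreover have "?d n t = \<bar>a t\<bar> * norm (X t - step_approx n X t)"
        by (simp add: g scaleR_diff_right[symmetric])
      ultimately show "?d n t \<le> ?w t"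
        by (simp add: algebra_simps)
    qed
    show "AE t in M. (\<lambda>n. ennreal (?d n t)) \<longlonglongrightarrow> 0"
    proof (rule AE_I2)
      fix t
      have "(\<lambda>n. ?d n t) \<longlonglongrightarrow> norm (a t *\<^sub>R X t - a t *\<^sub>R X t)"
        unfolding g by (intro tendsto_intros step_approx_tendsto X)
      then show "(\<lambda>n. ennreal (?d n t)) \<longlonglongrightarrow> 0"
        using tendsto_ennrealI by fastforce
    qed
  qed simp_all
  then have "(\<lambda>n. \<integral>\<^sup>+t. ?d n t \<partial>M) \<longlonglongrightarrow> 0" by simp
  from has_bochner_int_limit[OF fX gint this] that show ?thesis by blast
qed

section \<open>Total variation and polar decomposition\<close>

lemma quaternionic_measure_sums:
  assumes "quaternionic_measure \<mu>" "range A \<subseteq> sets borel" "disjoint_family A"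
  shows "(\<lambda>i. \<mu> (A i)) sums \<mu> (\<Union>i. A i)"
  using assms unfolding quaternionic_measure_def by blast

lemma quaternionic_measure_empty:
  assumes "quaternionic_measure \<mu>"
  shows "\<mu> {} = 0"
proof -
  have "(\<lambda>i::nat. \<mu> {}) sums \<mu> {}"
    using quaternionic_measure_sums[OF assms, of "\<lambda>_. {}"] by (simp add: disjoint_family_on_def)
  then have "summable (\<lambda>i::nat. \<mu> {})" by (rule sums_summable)
  then show ?thesis by (simp add: summable_const_iff)
qed

lemma norm_sums_le:
  fixes f :: "nat \<Rightarrow> 'a::real_normed_vector"
  assumes "f sums s"
  shows "ennreal (norm s) \<le> (\<Sum>i. ennreal (norm (f i)))"
proof (rule LIMSEQ_le_const2)
  show "(\<lambda>n. ennreal (norm (\<Sum>i<n. f i))) \<longlonglongrightarrow> ennreal (norm s)"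
    using assms unfolding sums_def by (intro tendsto_ennrealI tendsto_norm)
  have "ennreal (norm (\<Sum>i<n. f i)) \<le> (\<Sum>i. ennreal (norm (f i)))" for n
  proof -
    have "ennreal (norm (\<Sum>i<n. f i)) \<le> ennreal (\<Sum>i<n. norm (f i))"
      by (intro ennreal_leI norm_sum)
    also have "\<dots> = (\<Sum>i<n. ennreal (norm (f i)))" by simp
    also have "\<dots> \<le> (\<Sum>i. ennreal (norm (f i)))" by (rule sum_le_suminf) auto
    finally show ?thesis .
  qed
  then show "\<exists>N. \<forall>n\<ge>N. ennreal (norm (\<Sum>i<n. f i)) \<le> (\<Sum>i. ennreal (norm (f i)))" by blast
qed

lemma suminf_ennreal_swap:
  fixes f :: "nat \<Rightarrow> nat \<Rightarrow> ennreal"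
  shows "(\<Sum>i. \<Sum>j. f i j) = (\<Sum>j. \<Sum>i. f i j)"
  using nn_integral_suminf[of f "count_space UNIV"] by (simp add: nn_integral_count_space_nat)

abbreviation partitions :: "real set \<Rightarrow> (nat \<Rightarrow> real set) set" where
  "partitions A \<equiv> {E :: nat \<Rightarrow> real set. range E \<subseteq> sets borel \<and> disjoint_family E \<and> (\<Union>i. E i) = A}"

lemma trivial_partition:
  assumes "A \<in> sets borel"
  shows "(\<lambda>i::nat. if i = 0 then A else {}) \<in> partitions A"
  using assms by (auto simp: disjoint_family_on_def split: if_splits)

lemma norm_le_variation_fun:
  assumes "quaternionic_measure \<mu>" "A \<in> sets borel"
  shows "ennreal (norm (\<mu> A)) \<le> variation_fun \<mu> A"
proof -
  let ?E = "\<lambda>i::nat. if i = 0 then A else {}"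
  have "ennreal (norm (\<mu> A)) = (\<Sum>i\<in>{0}. ennreal (norm (\<mu> (?E i))))" by simp
  also have "\<dots> \<le> (\<Sum>i. ennreal (norm (\<mu> (?E i))))" by (rule sum_le_suminf) auto
  also have "\<dots> \<le> variation_fun \<mu> A"
    unfolding variation_fun_def by (rule SUP_upper[OF trivial_partition[OF assms(2)]])
  finally show ?thesis .
qed

text \<open>A partition of the union is refined by the sets \<open>A i\<close>. Each value of \<mu>
  is a sum over the refinement, and exchanging the nonnegative double sum leaves, for every
  \<open>i\<close>, the sum over one partition of \<open>A i\<close>.\<close>

lemma variation_fun_subadditive:
  assumes \<mu>: "quaternionic_measure \<mu>" and A: "range A \<subseteq> sets borel" "disjoint_family A"
  shows "variation_fun \<mu> (\<Union>i. A i) \<le> (\<Sum>i. variation_fun \<mu> (A i))"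
  unfolding variation_fun_def[of \<mu> "\<Union>i. A i"]
proof (rule SUP_least)
  fix E assume E: "E \<in> partitions (\<Union>i. A i)"
  have "(\<Sum>j. ennreal (norm (\<mu> (E j)))) \<le> (\<Sum>j. \<Sum>i. ennreal (norm (\<mu> (E j \<inter> A i))))"
  proof (intro suminf_le summableI)
    fix j
    have "(\<lambda>i. \<mu> (E j \<inter> A i)) sums \<mu> (\<Union>i. E j \<inter> A i)"
      by (rule quaternionic_measure_sums[OF \<mu>]) (use E A in \<open>auto simp: disjoint_family_on_def\<close>)
    moreover have "(\<Union>i. E j \<inter> A i) = E j" using E by auto
    ultimately show "ennreal (norm (\<mu> (E j))) \<le> (\<Sum>i. ennreal (norm (\<mu> (E j \<inter> A i))))"
      by (auto intro: norm_sums_le)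
  qed
  also have "\<dots> = (\<Sum>i. \<Sum>j. ennreal (norm (\<mu> (E j \<inter> A i))))" by (rule suminf_ennreal_swap)
  also have "\<dots> \<le> (\<Sum>i. variation_fun \<mu> (A i))"
  proof (intro suminf_le summableI)
    fix i
    have "(\<lambda>j. E j \<inter> A i) \<in> partitions (A i)"
    proof (intro CollectI conjI)
      show "range (\<lambda>j. E j \<inter> A i) \<subseteq> sets borel" using E A by auto
      show "disjoint_family (\<lambda>j. E j \<inter> A i)"
        using E unfolding disjoint_family_on_def by blast
      show "(\<Union>j. E j \<inter> A i) = A i" using E by blast
    qed
    then show "(\<Sum>j. ennreal (norm (\<mu> (E j \<inter> A i)))) \<le> variation_fun \<mu> (A i)"
      unfolding variation_fun_def by (rule SUP_upper)
  qed
  finally show "(\<Sum>j. ennreal (norm (\<mu> (E j)))) \<le> (\<Sum>i. variation_fun \<mu> (A i))" .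
qed

text \<open>Interlacing a partition of \<open>A\<close> (even indices) with one of \<open>B\<close>
  (odd indices) gives a partition of the union. The finite inequality, together with monotonicity,
  yields the remaining half of countable additivity.\<close>

lemma variation_fun_superadditive:
  assumes A: "A \<in> sets borel" and B: "B \<in> sets borel" and AB: "A \<inter> B = {}"
  shows "variation_fun \<mu> A + variation_fun \<mu> B \<le> variation_fun \<mu> (A \<union> B)"
proof -
  let ?S = "\<lambda>E. \<Sum>i::nat. ennreal (norm (\<mu> (E i)))"
  have le: "?S E + ?S F \<le> variation_fun \<mu> (A \<union> B)" if E: "E \<in> partitions A" and F: "F \<in> partitions B" for E F
  proof -
    define G where "G j = (if even j then E (j div 2) else F (j div 2))" for j
    have G: "G \<in> partitions (A \<union> B)"
    proof (intro CollectI conjI)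
      show "range G \<subseteq> sets borel" using E F by (auto simp: G_def)
      have d: "E i \<inter> E j = {}" "F i \<inter> F j = {}" if "i \<noteq> j" for i j
        using E F that by (auto simp: disjoint_family_on_def)
      have d2: "E i \<inter> F j = {}" for i j using E F AB by auto
      show "disjoint_family G"
        unfolding disjoint_family_on_def
      proof (intro ballI impI)
        fix m n :: nat assume "m \<noteq> n"
        then have "m div 2 \<noteq> n div 2 \<or> even m \<noteq> even n"
          by (metis dvd_mult_div_cancel odd_two_times_div_two_succ)
        then show "G m \<inter> G n = {}"
          using d[of "m div 2" "n div 2"] d2[of "m div 2" "n div 2"] d2[of "n div 2" "m div 2"]
          by (auto simp: G_def)
      qed
      have "E i \<subseteq> (\<Union>j. G j)" for i using G_def[of "2 * i"] by auto
      moreover have "F i \<subseteq> (\<Union>j. G j)" for i using G_def[of "2 * i + 1"] by auto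
      moreover have "G j \<subseteq> A \<union> B" for j using E F by (auto simp: G_def)
      moreover have "(\<Union>i. E i) = A" "(\<Union>i. F i) = B" using E F by auto
      ultimately show "(\<Union>j. G j) = A \<union> B" by (intro antisym Un_least UN_least) (metis UN_least)+
    qed
    have fin: "(\<Sum>i<n. ennreal (norm (\<mu> (E i)))) + (\<Sum>i<n. ennreal (norm (\<mu> (F i)))) =
       (\<Sum>i<2*n. ennreal (norm (\<mu> (G i))))" for n
      by (induction n) (auto simp: G_def ac_simps)
    have "?S E + ?S F \<le> ?S G"
    proof (rule LIMSEQ_le_const2)
      show "(\<lambda>n. (\<Sum>i<n. ennreal (norm (\<mu> (E i)))) + (\<Sum>i<n. ennreal (norm (\<mu> (F i))))) \<longlonglongrightarrow> ?S E + ?S F"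
        by (intro tendsto_add summable_LIMSEQ summableI)
      show "\<exists>N. \<forall>n\<ge>N. (\<Sum>i<n. ennreal (norm (\<mu> (E i)))) + (\<Sum>i<n. ennreal (norm (\<mu> (F i)))) \<le> ?S G"
        unfolding fin by (intro exI allI impI sum_le_suminf) auto
    qed
    also have "?S G \<le> variation_fun \<mu> (A \<union> B)"
      unfolding variation_fun_def by (rule SUP_upper[OF G])
    finally show ?thesis .
  qed
  have ne: "partitions A \<noteq> {}" "partitions B \<noteq> {}"
    by (rule ex_in_conv[THEN iffD1, OF exI, OF trivial_partition[OF A]],
        rule ex_in_conv[THEN iffD1, OF exI, OF trivial_partition[OF B]])
  have "variation_fun \<mu> A + variation_fun \<mu> B = (SUP E\<in>partitions A. ?S E + variation_fun \<mu> B)"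
    unfolding variation_fun_def[of \<mu> A] by (rule ennreal_SUP_add_left[OF ne(1), symmetric])
  also have "\<dots> = (SUP E\<in>partitions A. SUP F\<in>partitions B. ?S E + ?S F)"
    unfolding variation_fun_def[of \<mu> B]
    by (intro SUP_cong refl ennreal_SUP_add_right[OF ne(2)])
  also have "\<dots> \<le> variation_fun \<mu> (A \<union> B)"
    by (intro SUP_least le)
  finally show ?thesis .
qed

lemma variation_fun_mono:
  assumes "A \<in> sets borel" "B \<in> sets borel" "A \<subseteq> B"
  shows "variation_fun \<mu> A \<le> variation_fun \<mu> B"
proof -
  have "variation_fun \<mu> A \<le> variation_fun \<mu> A + variation_fun \<mu> (B - A)" by simp
  also have "\<dots> \<le> variation_fun \<mu> (A \<union> (B - A))"
    by (rule variation_fun_superadditive) (use assms in auto)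
  also have "A \<union> (B - A) = B" using assms by auto
  finally show ?thesis .
qed

lemma variation_fun_empty:
  assumes "quaternionic_measure \<mu>"
  shows "variation_fun \<mu> {} = 0"
proof -
  have "(\<Sum>i::nat. ennreal (norm (\<mu> (E i)))) = 0" if "E \<in> partitions {}" for E
    using that by (simp add: quaternionic_measure_empty[OF assms])
  then have "variation_fun \<mu> {} \<le> 0"
    unfolding variation_fun_def by (intro SUP_least) (simp only: order_refl)
  then show ?thesis by simp
qed

lemma variation_fun_countably_additive:
  assumes \<mu>: "quaternionic_measure \<mu>"
  shows "countably_additive (sets borel) (variation_fun \<mu>)"
  unfolding countably_additive_def
proof (intro allI impI antisym)
  fix A :: "nat \<Rightarrow> real set" assume A: "range A \<subseteq> sets borel" "disjoint_family A"
  show "variation_fun \<mu> (\<Union>i. A i) \<le> (\<Sum>i. variation_fun \<mu> (A i))"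
    by (rule variation_fun_subadditive[OF \<mu> A])
  have fin: "(\<Sum>i<n. variation_fun \<mu> (A i)) \<le> variation_fun \<mu> (\<Union>i<n. A i)" for n
  proof (induction n)
    case (Suc n)
    have "(\<Sum>i<Suc n. variation_fun \<mu> (A i)) \<le> variation_fun \<mu> (\<Union>i<n. A i) + variation_fun \<mu> (A n)"
      using Suc by (simp add: add_right_mono)
    also have "\<dots> \<le> variation_fun \<mu> ((\<Union>i<n. A i) \<union> A n)"
    proof (rule variation_fun_superadditive)
      show "(\<Union>i<n. A i) \<in> sets borel" "A n \<in> sets borel" using A(1) by auto
      have "A i \<inter> A n = {}" if "i < n" for i
        using A(2) that by (auto simp: disjoint_family_on_def)
      then show "(\<Union>i<n. A i) \<inter> A n = {}" by auto
    qed
    also have "(\<Union>i<n. A i) \<union> A n = (\<Union>i<Suc n. A i)" by (auto simp: less_Suc_eq)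
    finally show ?case .
  qed simp
  have le: "(\<Sum>i<n. variation_fun \<mu> (A i)) \<le> variation_fun \<mu> (\<Union>i. A i)" for n
  proof -
    have "variation_fun \<mu> (\<Union>i<n. A i) \<le> variation_fun \<mu> (\<Union>i. A i)"
    proof (rule variation_fun_mono)
      show "(\<Union>i<n. A i) \<in> sets borel" "(\<Union>i. A i) \<in> sets borel" using A(1) by auto
    qed auto
    with fin show ?thesis by (rule order_trans)
  qed
  show "(\<Sum>i. variation_fun \<mu> (A i)) \<le> variation_fun \<mu> (\<Union>i. A i)"
    by (rule LIMSEQ_le_const2[OF summable_LIMSEQ[OF summableI]]) (use le in blast)
qed

lemma sets_variation [simp, measurable_cong]: "sets (variation \<mu>) = sets borel"
proof -
  have "sets (variation \<mu>) = sigma_sets UNIV (sets borel)"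
    unfolding variation_def by (rule sets_measure_of) auto
  then show ?thesis using sets.sigma_sets_eq[of "borel :: real measure"] by simp
qed

lemma space_variation [simp]: "space (variation \<mu>) = UNIV"
  unfolding variation_def by (rule space_measure_of) auto

lemma emeasure_variation:
  assumes "quaternionic_measure \<mu>" "A \<in> sets borel"
  shows "emeasure (variation \<mu>) A = variation_fun \<mu> A"
  unfolding variation_def
proof (rule emeasure_measure_of_sigma)
  show "sigma_algebra (UNIV :: real set) (sets borel)"
    using sets.sigma_algebra_axioms[of "borel :: real measure"] by simp
  show "positive (sets borel) (variation_fun \<mu>)"
    by (simp add: positive_def variation_fun_empty[OF assms(1)])
qed (use assms variation_fun_countably_additive in auto)

section \<open>Radon-Nikodym densities and the polar decomposition\<close>

text \<open>Adding the dominating measure turns \<open>m\<close> into a positive measure, to which the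
  Radon-Nikodym theorem applies.\<close>
lemma signed_density:
  fixes m :: "real set \<Rightarrow> real"
  assumes \<kappa>: "finite_measure \<kappa>" "sets \<kappa> = sets borel"
    and m: "\<And>A. range A \<subseteq> sets borel \<Longrightarrow> disjoint_family A \<Longrightarrow> (\<lambda>i::nat. m (A i)) sums m (\<Union>i. A i)"
    and le: "\<And>A. A \<in> sets borel \<Longrightarrow> \<bar>m A\<bar> \<le> measure \<kappa> A"
  obtains g where "g \<in> borel_measurable borel" "integrable \<kappa> g"
    "\<And>A. A \<in> sets borel \<Longrightarrow> m A = (\<integral>t. indicator A t * g t \<partial>\<kappa>)"
proof -
  interpret finite_measure \<kappa> by fact
  have sp: "space \<kappa> = UNIV" using sets_eq_imp_space_eq[OF \<kappa>(2)] by simp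
  define N where "N = measure_of UNIV (sets borel) (\<lambda>A. ennreal (m A + measure \<kappa> A))"
  have nn: "0 \<le> m A + measure \<kappa> A" if "A \<in> sets borel" for A using le[OF that] by linarith
  have sN: "sets N = sets borel"
  proof -
    have "sets N = sigma_sets UNIV (sets borel)" unfolding N_def by (rule sets_measure_of) auto
    then show ?thesis using sets.sigma_sets_eq[of "borel :: real measure"] by simp
  qed
  have eN: "emeasure N A = ennreal (m A + measure \<kappa> A)" if "A \<in> sets borel" for A
    unfolding N_def
  proof (rule emeasure_measure_of_sigma)
    show "sigma_algebra (UNIV :: real set) (sets borel)"
      using sets.sigma_algebra_axioms[of "borel :: real measure"] by simp
    show "positive (sets borel) (\<lambda>A. ennreal (m A + measure \<kappa> A))"
      using le[of "{}"] by (simp add: positive_def)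
    show "countably_additive (sets borel) (\<lambda>A. ennreal (m A + measure \<kappa> A))"
      unfolding countably_additive_def
    proof (intro allI impI)
      fix A :: "nat \<Rightarrow> real set" assume A: "range A \<subseteq> sets borel" "disjoint_family A"
      have "(\<lambda>i. m (A i) + measure \<kappa> (A i)) sums (m (\<Union>i. A i) + measure \<kappa> (\<Union>i. A i))"
        by (intro sums_add m A finite_measure_UNION) (use A \<kappa>(2) in auto)
      then show "(\<Sum>i. ennreal (m (A i) + measure \<kappa> (A i))) = ennreal (m (\<Union>i. A i) + measure \<kappa> (\<Union>i. A i))"
        by (intro suminf_ennreal_eq nn) (use A in auto)
    qed
  qed (use that in auto)
  have ac: "absolutely_continuous \<kappa> N"
    unfolding absolutely_continuous_def
  proof
    fix A assume "A \<in> null_sets \<kappa>"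
    then have A: "A \<in> sets borel" "measure \<kappa> A = 0" using \<kappa>(2) by (auto simp: null_sets_def measure_def)
    then have "m A = 0" using le[of A] by simp
    then show "A \<in> null_sets N" using A eN[of A] sN by (auto simp: null_sets_def)
  qed
  obtain f where f [measurable]: "f \<in> borel_measurable \<kappa>" and dens: "density \<kappa> f = N"
    using Radon_Nikodym[OF ac] sN \<kappa>(2) by auto
  have fA: "(\<integral>\<^sup>+t. f t * indicator A t \<partial>\<kappa>) = ennreal (m A + measure \<kappa> A)" if "A \<in> sets borel" for A
    using eN[OF that] emeasure_density[OF f, of A] dens \<kappa>(2) that by simp
  have fin: "(\<integral>\<^sup>+t. f t \<partial>\<kappa>) \<noteq> \<infinity>" using fA[of UNIV] by simp
  have AEf: "AE t in \<kappa>. f t \<noteq> \<infinity>" by (rule nn_integral_noteq_infinite[OF f fin])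
  \<comment> \<open>Subtracting 1 removes the copy of \<kappa> that was added. The density
    \<open>f\<close> may be infinite on a null set, where \<open>enn2real\<close> returns 0.\<close>
  define g where "g t = enn2real (f t) - 1" for t
  have gm: "g \<in> borel_measurable borel"
    using f unfolding g_def measurable_cong_sets[OF \<kappa>(2) refl] by measurable
  have eq: "has_bochner_integral \<kappa> (\<lambda>t. indicator A t * enn2real (f t)) (m A + measure \<kappa> A)" if A: "A \<in> sets borel" for A
  proof (rule has_bochner_integral_nn_integral)
    have [measurable]: "A \<in> sets \<kappa>" using A \<kappa>(2) by simp
    show "(\<lambda>t. indicator A t * enn2real (f t)) \<in> borel_measurable \<kappa>" by measurable
    have "(\<integral>\<^sup>+t. ennreal (indicator A t * enn2real (f t)) \<partial>\<kappa>) = (\<integral>\<^sup>+t. f t * indicator A t \<partial>\<kappa>)"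
      by (rule nn_integral_cong_AE) (use AEf in \<open>auto simp: indicator_def less_top\<close>)
    then show "(\<integral>\<^sup>+t. ennreal (indicator A t * enn2real (f t)) \<partial>\<kappa>) = ennreal (m A + measure \<kappa> A)"
      using fA[OF A] by simp
  qed (auto simp: nn[OF A])
  have ind: "has_bochner_integral \<kappa> (indicator A) (measure \<kappa> A)" if "A \<in> sets borel" for A
    by (rule has_bochner_integral_real_indicator) (use that \<kappa>(2) in \<open>auto simp: less_top[symmetric]\<close>)
  have hg: "has_bochner_integral \<kappa> (\<lambda>t. indicator A t * g t) (m A)" if "A \<in> sets borel" for A
    using has_bochner_integral_diff[OF eq[OF that] ind[OF that]] by (simp add: g_def algebra_simps)
  show ?thesis
  proof (rule that[of g])
    show "integrable \<kappa> g" using hg[of UNIV] by (auto simp: integrable.simps)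
    show "m A = (\<integral>t. indicator A t * g t \<partial>\<kappa>)" if "A \<in> sets borel" for A
      using has_bochner_integral_integral_eq[OF hg[OF that]] by simp
  qed (rule gm)
qed

text \<open>The test set is the set where \<open>u\<close> exceeds \<open>c\<close>: there
  \<open>u - c\<close> is positive while its integral is at most 0, so the set is null.\<close>

lemma AE_le_of_set_integral_le:
  fixes u :: "real \<Rightarrow> real"
  assumes \<kappa>: "finite_measure \<kappa>" "sets \<kappa> = sets borel" and u: "integrable \<kappa> u"
    and le: "\<And>A. A \<in> sets borel \<Longrightarrow> (\<integral>t. indicator A t * u t \<partial>\<kappa>) \<le> c * measure \<kappa> A"
  shows "AE t in \<kappa>. u t \<le> c"
proof -
  interpret finite_measure \<kappa> by fact
  have sp: "space \<kappa> = UNIV" using sets_eq_imp_space_eq[OF \<kappa>(2)] by simp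
  define A where "A = {t. c < u t}"
  have [measurable]: "u \<in> borel_measurable \<kappa>" using u by auto
  have "{t \<in> space \<kappa>. c < u t} \<in> sets \<kappa>" by measurable
  then have A: "A \<in> sets \<kappa>" by (simp add: A_def sp)
  have i: "integrable \<kappa> (\<lambda>t. indicator A t * u t)" "integrable \<kappa> (\<lambda>t. c * indicator A t)"
    using integrable_mult_indicator[OF A u] integrable_mult_indicator[OF A integrable_const[of c]]
    by (simp_all add: mult.commute)
  have "(\<integral>t. indicator A t * u t - c * indicator A t \<partial>\<kappa>) = (\<integral>t. indicator A t * u t \<partial>\<kappa>) - c * measure \<kappa> A"
    using A i by simp
  also have "\<dots> \<le> 0" using le[of A] A \<kappa>(2) by simp
  finally have "(\<integral>t. indicator A t * u t - c * indicator A t \<partial>\<kappa>) \<le> 0" .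
  moreover have "(\<integral>t. indicator A t * u t - c * indicator A t \<partial>\<kappa>) \<ge> 0"
    by (rule integral_nonneg_AE) (auto simp: A_def indicator_def)
  ultimately have "(\<integral>t. indicator A t * u t - c * indicator A t \<partial>\<kappa>) = 0" by simp
  then have "AE t in \<kappa>. indicator A t * u t - c * indicator A t = 0"
    by (subst (asm) integral_nonneg_eq_0_iff_AE) (use i in \<open>auto simp: A_def indicator_def\<close>)
  then show ?thesis by (rule AE_mp) (auto simp: A_def indicator_def)
qed

lemma norm_quaternion_ge: "\<bar>qRe q\<bar> \<le> norm q" "\<bar>qI q\<bar> \<le> norm q" "\<bar>qJ q\<bar> \<le> norm q" "\<bar>qK q\<bar> \<le> norm q"
  unfolding norm_quaternion_def by (rule real_le_rsqrt; simp)+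

lemma bounded_linear_quaternion_parts:
  "bounded_linear qRe" "bounded_linear qI" "bounded_linear qJ" "bounded_linear qK"
  by (rule bounded_linear_intro[of _ 1]; simp add: norm_quaternion_ge)+

text \<open>Radon-Nikodym applied to the four real components gives a density \<open>h\<close>.
  Testing against directions bounds its norm by 1; the minimality built into the total variation
  forces the norm to be at least 1; a change on a null set makes the norm 1 everywhere.\<close>

lemma polar_exists:
  assumes \<mu>: "quaternionic_measure \<mu>" and fin: "finite_measure (variation \<mu>)"
  shows "\<exists>h. h \<in> borel_measurable borel \<and> (\<forall>t. norm (h t) = 1) \<and>
     (\<forall>A\<in>sets borel. set_integrable (variation \<mu>) A h \<and>
        \<mu> A = set_lebesgue_integral (variation \<mu>) A h)"
proof -
  let ?\<kappa> = "variation \<mu>"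
  interpret finite_measure ?\<kappa> by fact
  have norm_le: "norm (\<mu> A) \<le> measure ?\<kappa> A" if "A \<in> sets borel" for A
    using norm_le_variation_fun[OF \<mu> that] emeasure_variation[OF \<mu> that] emeasure_eq_measure[of A]
    by (metis ennreal_le_iff measure_nonneg)
  have ex: "\<exists>g. g \<in> borel_measurable borel \<and> integrable ?\<kappa> g \<and>
      (\<forall>A\<in>sets borel. c (\<mu> A) = (\<integral>t. indicator A t * g t \<partial>?\<kappa>))"
    if c: "bounded_linear c" "\<And>q. \<bar>c q\<bar> \<le> norm q" for c :: "quaternion \<Rightarrow> real"
  proof (rule signed_density[OF fin sets_variation, of "\<lambda>A. c (\<mu> A)"])
    show "(\<lambda>i::nat. c (\<mu> (A i))) sums c (\<mu> (\<Union>i. A i))" if "range A \<subseteq> sets borel" "disjoint_family A" for A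
      by (rule bounded_linear.sums[OF c(1) quaternionic_measure_sums[OF \<mu> that]])
    show "\<bar>c (\<mu> A)\<bar> \<le> measure ?\<kappa> A" if "A \<in> sets borel" for A
      using c(2)[of "\<mu> A"] norm_le[OF that] by linarith
  qed blast
  obtain g0 where g0 [measurable]: "g0 \<in> borel_measurable borel" and g0': "integrable ?\<kappa> g0"
      "\<And>A. A\<in>sets borel \<Longrightarrow> qRe (\<mu> A) = (\<integral>t. indicator A t * g0 t \<partial>?\<kappa>)"
    using ex[OF bounded_linear_quaternion_parts(1) norm_quaternion_ge(1)] by blast
  obtain g1 where g1 [measurable]: "g1 \<in> borel_measurable borel" and g1': "integrable ?\<kappa> g1"
      "\<And>A. A\<in>sets borel \<Longrightarrow> qI (\<mu> A) = (\<integral>t. indicator A t * g1 t \<partial>?\<kappa>)"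
    using ex[OF bounded_linear_quaternion_parts(2) norm_quaternion_ge(2)] by blast
  obtain g2 where g2 [measurable]: "g2 \<in> borel_measurable borel" and g2': "integrable ?\<kappa> g2"
      "\<And>A. A\<in>sets borel \<Longrightarrow> qJ (\<mu> A) = (\<integral>t. indicator A t * g2 t \<partial>?\<kappa>)"
    using ex[OF bounded_linear_quaternion_parts(3) norm_quaternion_ge(3)] by blast
  obtain g3 where g3 [measurable]: "g3 \<in> borel_measurable borel" and g3': "integrable ?\<kappa> g3"
      "\<And>A. A\<in>sets borel \<Longrightarrow> qK (\<mu> A) = (\<integral>t. indicator A t * g3 t \<partial>?\<kappa>)"
    using ex[OF bounded_linear_quaternion_parts(4) norm_quaternion_ge(4)] by blast
  define h where "h t = g0 t *\<^sub>R 1 + g1 t *\<^sub>R Quaternion 0 1 0 0 + g2 t *\<^sub>R Quaternion 0 0 1 0 + g3 t *\<^sub>R Quaternion 0 0 0 1" for t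
  have hm [measurable]: "h \<in> borel_measurable borel"
    unfolding h_def by measurable
  have hi: "integrable ?\<kappa> h"
    unfolding h_def using g0' g1' g2' g3' by auto
  have \<mu>h: "\<mu> A = (\<integral>t. indicator A t *\<^sub>R h t \<partial>?\<kappa>)" if A: "A \<in> sets borel" for A
  proof -
    have iA: "integrable ?\<kappa> (\<lambda>t. indicator A t *\<^sub>R h t)"
      by (rule integrable_mult_indicator[OF _ hi]) (use A in simp)
    have "c (\<integral>t. indicator A t *\<^sub>R h t \<partial>?\<kappa>) = (\<integral>t. indicator A t * c (h t) \<partial>?\<kappa>)" if "bounded_linear c" for c :: "quaternion \<Rightarrow> real"
      using integral_bounded_linear[OF that iA] linear_simps(5)[OF that] by simp
    from this[OF bounded_linear_quaternion_parts(1)] this[OF bounded_linear_quaternion_parts(2)]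
      this[OF bounded_linear_quaternion_parts(3)] this[OF bounded_linear_quaternion_parts(4)]
    show ?thesis
      by (simp add: quaternion_eq_iff g0'(2)[OF A] g1'(2)[OF A] g2'(2)[OF A] g3'(2)[OF A] h_def)
  qed
  have iA: "integrable ?\<kappa> (\<lambda>t. indicator A t *\<^sub>R u t)" if "A \<in> sets borel" "integrable ?\<kappa> u" for A and u :: "real \<Rightarrow> 'c::{banach,second_countable_topology}"
    by (rule integrable_mult_indicator[OF _ that(2)]) (use that in simp)
  have half: "AE t in ?\<kappa>. inner (h t) q \<le> norm q" for q
  proof (rule AE_le_of_set_integral_le[OF fin])
    show "integrable ?\<kappa> (\<lambda>t. inner (h t) q)" using hi by auto
    show "(\<integral>t. indicator A t * inner (h t) q \<partial>?\<kappa>) \<le> norm q * measure ?\<kappa> A" if A: "A \<in> sets borel" for A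
    proof -
      have "(\<integral>t. indicator A t * inner (h t) q \<partial>?\<kappa>) = inner (\<mu> A) q"
        unfolding \<mu>h[OF A] using integral_inner_left[OF iA[OF A hi], of q] by simp
      also have "\<dots> \<le> norm (\<mu> A) * norm q" by (rule norm_cauchy_schwarz)
      also have "\<dots> \<le> measure ?\<kappa> A * norm q" by (intro mult_right_mono norm_le A) simp
      finally show ?thesis by (simp add: mult.commute)
    qed
  qed simp
  \<comment> \<open>The exceptional null set in \<open>half\<close> depends on \<open>q\<close>. A
    countable dense set of directions gives one common null set; the direction \<open>h t\<close> is
    then reached because the violated inequality is an open condition on \<open>q\<close>.\<close>
  obtain Dq :: "quaternion set" where Dq: "countable Dq" "\<And>X. open X \<Longrightarrow> X \<noteq> {} \<Longrightarrow> \<exists>d\<in>Dq. d \<in> X"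
    using countable_dense_exists by blast
  have "AE t in ?\<kappa>. \<forall>q\<in>Dq. inner (h t) q \<le> norm q"
    by (subst AE_ball_countable[OF Dq(1)]) (use half in blast)
  then have le1: "AE t in ?\<kappa>. norm (h t) \<le> 1"
  proof (rule AE_mp, intro AE_I2 impI)
    fix t assume *: "\<forall>q\<in>Dq. inner (h t) q \<le> norm q"
    have "inner (h t) (h t) \<le> norm (h t)"
    proof (rule ccontr)
      assume "\<not> ?thesis"
      then have "h t \<in> {q. norm q < inner (h t) q}" by simp
      moreover have "open {q. norm q < inner (h t) q}"
        by (intro open_Collect_less continuous_intros)
      ultimately obtain d where "d \<in> Dq" "norm d < inner (h t) d" using Dq(2) by blast
      with * show False by force
    qed
    then have "norm (h t) * norm (h t) \<le> norm (h t)" by (simp add: power2_norm_eq_inner[symmetric] power2_eq_square)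
    then have "0 \<le> norm (h t) * (1 - norm (h t))" by (simp add: algebra_simps)
    then show "norm (h t) \<le> 1" by (cases "h t = 0") (auto simp: zero_le_mult_iff)
  qed
  \<comment> \<open>This measure dominates the norm of \<mu> on every Borel set, hence every
    partition sum and so the total variation. Comparing integrals over arbitrary sets gives
    \<open>norm (h t)\<close> at least 1 almost everywhere.\<close>
  let ?\<nu> = "density ?\<kappa> (\<lambda>t. ennreal (norm (h t)))"
  have ge1: "AE t in ?\<kappa>. - norm (h t) \<le> - 1"
  proof (rule AE_le_of_set_integral_le[OF fin])
    show "integrable ?\<kappa> (\<lambda>t. - norm (h t))" using hi by auto
    show "(\<integral>t. indicator A t * - norm (h t) \<partial>?\<kappa>) \<le> - 1 * measure ?\<kappa> A" if A: "A \<in> sets borel" for A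
    proof -
      have nn: "(\<integral>\<^sup>+t. ennreal (norm (h t)) * indicator B t \<partial>?\<kappa>) = ennreal (\<integral>t. indicator B t * norm (h t) \<partial>?\<kappa>)"
        if B: "B \<in> sets borel" for B
      proof -
        have "(\<integral>\<^sup>+t. ennreal (norm (h t)) * indicator B t \<partial>?\<kappa>) = (\<integral>\<^sup>+t. ennreal (indicator B t * norm (h t)) \<partial>?\<kappa>)"
          by (intro nn_integral_cong) (auto simp: indicator_def)
        also have "\<dots> = ennreal (\<integral>t. indicator B t * norm (h t) \<partial>?\<kappa>)"
          by (rule nn_integral_eq_integral) (use iA[OF B integrable_norm[OF hi]] in auto)
        finally show ?thesis .
      qed
      have "variation_fun \<mu> A \<le> emeasure (?\<nu>) A"
        unfolding variation_fun_def
      proof (rule SUP_least)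
        fix E assume E: "E \<in> partitions A"
        have "ennreal (norm (\<mu> (E i))) \<le> emeasure (?\<nu>) (E i)" for i
        proof -
          have Ei: "E i \<in> sets borel" using E by auto
          have "norm (\<mu> (E i)) \<le> (\<integral>t. norm (indicator (E i) t *\<^sub>R h t) \<partial>?\<kappa>)"
            unfolding \<mu>h[OF Ei] by (rule integral_norm_bound)
          then have "ennreal (norm (\<mu> (E i))) \<le> ennreal (\<integral>t. indicator (E i) t * norm (h t) \<partial>?\<kappa>)"
            by (intro ennreal_leI) simp
          also have "\<dots> = emeasure (?\<nu>) (E i)"
            using nn[OF Ei] Ei by (simp add: emeasure_density)
          finally show ?thesis .
        qed
        then have "(\<Sum>i. ennreal (norm (\<mu> (E i)))) \<le> (\<Sum>i. emeasure (?\<nu>) (E i))"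
          by (intro suminf_le summableI)
        also have "\<dots> = emeasure (?\<nu>) (\<Union>i. E i)"
          by (rule suminf_emeasure) (use E in auto)
        finally show "(\<Sum>i. ennreal (norm (\<mu> (E i)))) \<le> emeasure (?\<nu>) A"
          using E by simp
      qed
      also have "\<dots> = ennreal (\<integral>t. indicator A t * norm (h t) \<partial>?\<kappa>)"
        using nn[OF A] A by (simp add: emeasure_density)
      finally have "ennreal (measure ?\<kappa> A) \<le> ennreal (\<integral>t. indicator A t * norm (h t) \<partial>?\<kappa>)"
        using emeasure_variation[OF \<mu> A] emeasure_eq_measure[of A] by simp
      then have "measure ?\<kappa> A \<le> (\<integral>t. indicator A t * norm (h t) \<partial>?\<kappa>)"
        by (subst (asm) ennreal_le_iff) (auto intro!: integral_nonneg_AE)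
      then show ?thesis by simp
    qed
  qed simp
  have ae: "AE t in ?\<kappa>. norm (h t) = 1" using le1 ge1 by eventually_elim simp
  \<comment> \<open>\<open>polar\<close> asks for norm 1 at every point; the value 1 is inserted on
    the exceptional null set.\<close>
  define h' where "h' t = (if norm (h t) = 1 then h t else 1)" for t
  have h'm [measurable]: "h' \<in> borel_measurable borel" unfolding h'_def by measurable
  have hh': "AE t in ?\<kappa>. h' t = h t" using ae by eventually_elim (simp add: h'_def)
  show ?thesis
  proof (intro exI[of _ h'] conjI ballI allI)
    show "h' \<in> borel_measurable borel" by (rule h'm)
    show "norm (h' t) = 1" for t by (simp add: h'_def)
    fix A :: "real set" assume A: "A \<in> sets borel"
    have [measurable]: "A \<in> sets ?\<kappa>" using A by simp
    have "integrable ?\<kappa> (\<lambda>t. indicator A t *\<^sub>R h' t) \<longleftrightarrow> integrable ?\<kappa> (\<lambda>t. indicator A t *\<^sub>R h t)"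
      by (rule integrable_cong_AE) (use hh' in \<open>auto\<close>)
    then show "set_integrable ?\<kappa> A h'" using iA[OF A hi] by (simp add: set_integrable_def)
    have "(\<integral>t. indicator A t *\<^sub>R h' t \<partial>?\<kappa>) = (\<integral>t. indicator A t *\<^sub>R h t \<partial>?\<kappa>)"
      by (rule integral_cong_AE) (use hh' in \<open>auto\<close>)
    then show "\<mu> A = set_lebesgue_integral ?\<kappa> A h'"
      using \<mu>h[OF A] by (simp add: set_lebesgue_integral_def)
  qed
qed

lemma polar:
  assumes "quaternionic_measure \<mu>" "finite_measure (variation \<mu>)"
  shows borel_measurable_polar: "polar \<mu> \<in> borel_measurable borel"
    and norm_polar: "norm (polar \<mu> t) = 1"
  using someI_ex[OF polar_exists[OF assms]] unfolding polar_def by blast+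

section \<open>Complex slices and real measures\<close>

text \<open>When \<open>u * u = - 1\<close>, this embeds the complex numbers as the subalgebra
  spanned by 1 and \<open>u\<close>. Complex identities and estimates are transported to
  quaternionic transforms along it.\<close>

definition slice :: "quaternion \<Rightarrow> complex \<Rightarrow> quaternion" where
  "slice u z = of_real (Re z) + Im z *\<^sub>R u"

lemma bounded_linear_slice: "bounded_linear (slice u)"
proof -
  have "slice u = (\<lambda>z. Re z *\<^sub>R 1 + Im z *\<^sub>R u)"
    by (auto simp: slice_def of_real_def)
  moreover have "bounded_linear (\<lambda>z. Re z *\<^sub>R (1::quaternion) + Im z *\<^sub>R u)"
    by (intro bounded_linear_add bounded_linear_scaleR_const bounded_linear_Re bounded_linear_Im)
  ultimately show ?thesis by simp
qed

lemma slice_mult: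
  assumes "u * u = - 1"
  shows "slice u (w * z) = slice u w * slice u z"
  using assms by (simp add: slice_def of_real_def algebra_simps scaleR_diff_left)

lemma slice_of_real [simp]: "slice u (of_real r) = of_real r"
  by (simp add: slice_def)

lemma slice_one [simp]: "slice u 1 = 1"
  using slice_of_real[of u 1] by simp

lemma slice_power:
  assumes "u * u = - 1"
  shows "slice u (z ^ n) = slice u z ^ n"
  by (induction n) (simp_all add: slice_mult[OF assms])

lemma slice_exp:
  assumes "u * u = - 1"
  shows "slice u (exp z) = exp (slice u z)"
proof -
  interpret bounded_linear "slice u" by (rule bounded_linear_slice)
  have "(\<lambda>n. slice u (z ^ n /\<^sub>R fact n)) sums slice u (exp z)"
    by (rule sums[OF exp_converges])
  then have "(\<lambda>n. slice u z ^ n /\<^sub>R fact n) sums slice u (exp z)"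
    by (simp add: scaleR slice_power[OF assms])
  then show ?thesis using exp_converges[of "slice u z"] sums_unique2 by blast
qed

text \<open>The three standard units suffice: the slice of each one detects one imaginary component
  of a quaternionic density.\<close>

abbreviation imaginary_units :: "quaternion set" where
  "imaginary_units \<equiv> {Quaternion 0 1 0 0, Quaternion 0 0 1 0, Quaternion 0 0 0 1}"

lemma imaginary_unit:
  assumes "u \<in> imaginary_units"
  shows "u * u = - 1" "qcnj u = - u" "qRe u = 0"
  using assms by (auto simp: quaternion_eq_iff)

lemma norm_slice:
  assumes "u \<in> imaginary_units"
  shows "norm (slice u z) = cmod z"
  using assms by (auto simp: slice_def norm_quaternion_def cmod_def of_real_def)

lemma slice_inject:
  assumes "u \<in> imaginary_units"
  shows "slice u w = slice u z \<longleftrightarrow> w = z"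
proof -
  interpret bounded_linear "slice u" by (rule bounded_linear_slice)
  have "slice u w = slice u z \<longleftrightarrow> norm (slice u (w - z)) = 0" by (simp add: diff)
  then show ?thesis by (simp add: norm_slice[OF assms])
qed

lemma qRe_slice:
  assumes "u \<in> imaginary_units"
  shows "qRe (slice u z) = Re z"
  using assms by (auto simp: slice_def of_real_def)

lemma slice_cnj:
  assumes "u \<in> imaginary_units"
  shows "slice u (cnj z) = qcnj (slice u z)"
  using assms by (auto simp: slice_def of_real_def quaternion_eq_iff)

abbreviation cpoly :: "real poly \<Rightarrow> complex \<Rightarrow> complex" where
  "cpoly p \<equiv> poly (map_poly complex_of_real p)"

lemma qpoly_slice:
  assumes "u * u = - 1"
  shows "qpoly P (slice u z) = slice u (cpoly P z)"
proof -
  interpret bounded_linear "slice u" by (rule bounded_linear_slice)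
  have "cpoly P z = (\<Sum>k\<le>degree P. coeff P k *\<^sub>R z ^ k)"
    by (simp add: poly_altdef coeff_map_poly degree_map_poly scaleR_conv_of_real)
  then show ?thesis
    by (simp add: qpoly_def sum scaleR slice_power[OF assms])
qed

section \<open>Measures with symmetric transforms are real\<close>

text \<open>By uniqueness of characteristic functions, applied to the normalized positive and
  negative parts.\<close>
lemma AE_zero_of_trig_integrals:
  fixes a :: "real \<Rightarrow> real"
  assumes \<kappa>: "finite_measure \<kappa>" "sets \<kappa> = sets borel" and a: "integrable \<kappa> a"
    and c: "\<And>y. (\<integral>t. a t * cos (y * t) \<partial>\<kappa>) = 0" and s: "\<And>y. (\<integral>t. a t * sin (y * t) \<partial>\<kappa>) = 0"
  shows "AE t in \<kappa>. a t = 0"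
proof -
  interpret finite_measure \<kappa> by fact
  have sp: "space \<kappa> = UNIV" using sets_eq_imp_space_eq[OF \<kappa>(2)] by simp
  note [measurable_cong] = \<kappa>(2)
  have [measurable]: "a \<in> borel_measurable \<kappa>" using a by auto
  define p where "p t = max 0 (a t)" for t
  define n where "n t = max 0 (- a t)" for t
  have pn: "p t - n t = a t" for t by (simp add: p_def n_def)
  have ip: "integrable \<kappa> p" and i_n: "integrable \<kappa> n"
    unfolding p_def n_def using a by auto
  have [measurable]: "p \<in> borel_measurable \<kappa>" "n \<in> borel_measurable \<kappa>" using ip i_n by auto
  have nn: "0 \<le> p t" "0 \<le> n t" for t by (auto simp: p_def n_def)
  define m where "m = (\<integral>t. p t \<partial>\<kappa>)"
  \<comment> \<open>The cosine condition at \<open>y = 0\<close> says that the positive and negative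
    parts have the same mass \<open>m\<close>, so one factor normalizes both. For
    \<open>m = 0\<close> both parts vanish almost everywhere.\<close>
  have "(\<integral>t. a t \<partial>\<kappa>) = 0" using c[of 0] by simp
  then have m': "m = (\<integral>t. n t \<partial>\<kappa>)"
    using Bochner_Integration.integral_diff[OF ip i_n] by (simp add: pn m_def)
  show ?thesis
  proof (cases "m = 0")
    case True
    then have "AE t in \<kappa>. p t = 0" "AE t in \<kappa>. n t = 0"
      using integral_nonneg_eq_0_iff_AE[OF ip] integral_nonneg_eq_0_iff_AE[OF i_n] nn m'
      by (auto simp: m_def)
    then show ?thesis by eventually_elim (simp flip: pn)
  next
    case False
    have "m \<ge> 0" unfolding m_def by (rule integral_nonneg_AE) (simp add: nn)
    with False have m: "m > 0" by simp
    let ?e = "\<lambda>q y t. (q t / m) *\<^sub>R iexp (y * t) :: complex"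
    define N where "N q = density \<kappa> (\<lambda>t. ennreal (q t / m))" for q :: "real \<Rightarrow> real"
    have rd: "real_distribution (N q)" if q: "integrable \<kappa> q" "\<And>t. 0 \<le> q t" "(\<integral>t. q t \<partial>\<kappa>) = m" for q
    proof -
      have [measurable]: "q \<in> borel_measurable \<kappa>" using q by auto
      have "emeasure (N q) (space (N q)) = (\<integral>\<^sup>+t. ennreal (q t / m) \<partial>\<kappa>)"
        by (simp add: N_def emeasure_density sp)
      also have "\<dots> = ennreal (\<integral>t. q t / m \<partial>\<kappa>)"
        by (rule nn_integral_eq_integral) (use q m in auto)
      also have "\<dots> = 1" using q m by simp
      finally have "prob_space (N q)" by (rule prob_spaceI)
      moreover have "sets (N q) = sets borel" by (simp add: N_def \<kappa>)
      ultimately show ?thesis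
        by (simp add: real_distribution_def real_distribution_axioms_def)
    qed
    have ch: "char (N q) y = (\<integral>t. ?e q y t \<partial>\<kappa>)" if "integrable \<kappa> q" "\<And>t. 0 \<le> q t" for q y
      unfolding char_def N_def
      by (rule integral_density) (use that m in \<open>auto\<close>)
    have iq: "integrable \<kappa> (\<lambda>t. ?e q y t)" if q: "integrable \<kappa> q" for q y
    proof (rule Bochner_Integration.integrable_bound[of _ "\<lambda>t. q t / m"])
      have [measurable]: "q \<in> borel_measurable \<kappa>" using q by auto
      show "(\<lambda>t. ?e q y t) \<in> borel_measurable \<kappa>" by measurable
    qed (use q in auto)
    have "char (N p) y = char (N n) y" for y
    proof -
      have "char (N p) y - char (N n) y = (\<integral>t. ?e a y t \<partial>\<kappa>)"
        unfolding ch[OF ip nn(1)] ch[OF i_n nn(2)]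
        using Bochner_Integration.integral_diff[OF iq[OF ip] iq[OF i_n], of y y]
        by (simp add: pn[symmetric] diff_divide_distrib scaleR_left_diff_distrib)
      also have "\<dots> = 0"
      proof (rule complex_eqI)
        have "Re (\<integral>t. ?e a y t \<partial>\<kappa>) = (\<integral>t. a t * cos (y * t) / m \<partial>\<kappa>)"
          using integral_bounded_linear[OF bounded_linear_Re iq[OF a, of y]]
          by (simp add: Re_exp)
        then show "Re (\<integral>t. ?e a y t \<partial>\<kappa>) = Re 0" using c[of y] by simp
        have "Im (\<integral>t. ?e a y t \<partial>\<kappa>) = (\<integral>t. a t * sin (y * t) / m \<partial>\<kappa>)"
          using integral_bounded_linear[OF bounded_linear_Im iq[OF a, of y]]
          by (simp add: Im_exp)
        then show "Im (\<integral>t. ?e a y t \<partial>\<kappa>) = Im 0" using s[of y] by simp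
      qed
      finally show ?thesis by simp
    qed
    then have "N p = N n"
      by (intro Levy_uniqueness rd ip i_n nn) (auto simp: m_def m'[unfolded m_def])
    then have "AE t in \<kappa>. ennreal (p t / m) = ennreal (n t / m)"
      unfolding N_def by (subst (asm) density_unique_iff) auto
    then show ?thesis
      by eventually_elim (use m nn in \<open>simp add: ennreal_inj flip: pn\<close>)
  qed
qed

definition lap :: "real measure \<Rightarrow> (real \<Rightarrow> real) \<Rightarrow> complex \<Rightarrow> complex" where
  "lap \<kappa> a z = (\<integral>t. a t *\<^sub>R exp (- (of_real t * z)) \<partial>\<kappa>)"

lemma slice_scaleR: "slice u (r *\<^sub>R z) = r *\<^sub>R slice u z"
  by (simp add: slice_def scaleR_add_right of_real_def)

lemma slice_minus: "slice u (- z) = - slice u z"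
  using slice_scaleR[of u "- 1" z] by simp

lemma exp_slice: "u * u = - 1 \<Longrightarrow> exp (- (t *\<^sub>R slice u z)) = slice u (exp (- (of_real t * z)))"
  by (simp only: slice_exp slice_minus slice_scaleR flip: scaleR_conv_of_real)

text \<open>A real density commutes with the slice embedding, so the quaternionic transform on a
  slice is the embedded complex transform.\<close>

lemma laplace_slice:
  assumes u: "u \<in> imaginary_units" and p: "polar \<mu> \<in> borel_measurable borel"
    and a: "AE t in variation \<mu>. polar \<mu> t = of_real (a t)"
    and i: "integrable (variation \<mu>) (\<lambda>t. a t *\<^sub>R exp (- (of_real t * z)))"
    and s: "sets (variation \<mu>) = sets borel"
  shows "laplace \<mu> (slice u z) = slice u (lap (variation \<mu>) a z)"
proof -
  note [measurable_cong] = s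
  note [measurable] = p
  have [measurable]: "(\<lambda>t. a t *\<^sub>R exp (- (of_real t * z))) \<in> borel_measurable (variation \<mu>)"
    using i by auto
  have [measurable]: "slice u \<in> borel_measurable borel"
    by (intro borel_measurable_continuous_onI bounded_linear.continuous_on[OF bounded_linear_slice] continuous_on_id)
  have "laplace \<mu> (slice u z) = (\<integral>t. polar \<mu> t * slice u (exp (- (of_real t * z))) \<partial>variation \<mu>)"
    by (simp add: laplace_def exp_slice[OF imaginary_unit(1)[OF u]])
  also have "\<dots> = (\<integral>t. slice u (a t *\<^sub>R exp (- (of_real t * z))) \<partial>variation \<mu>)"
  proof (rule integral_cong_AE)
    show "AE t in variation \<mu>. polar \<mu> t * slice u (exp (- (of_real t * z))) = slice u (a t *\<^sub>R exp (- (of_real t * z)))"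
      using a
    proof eventually_elim
      case (elim t)
      have "polar \<mu> t * slice u (exp (- (of_real t * z))) = a t *\<^sub>R slice u (exp (- (of_real t * z)))"
        unfolding elim by (simp add: of_real_def[where 'a=quaternion])
      then show ?case by (simp only: slice_scaleR)
    qed
  qed measurable
  also have "\<dots> = slice u (lap (variation \<mu>) a z)"
    unfolding lap_def by (rule integral_bounded_linear[OF bounded_linear_slice i])
  finally show ?thesis .
qed

text \<open>Here \<open>c\<close> is the component along \<open>u\<close>. At the points y and -y of
  the axis, the \<open>c\<close> part of the symmetry cancels the sine integral of the real part and
  leaves a vanishing cosine integral of \<open>c\<close>; the real part of the symmetry makes the
  sine integral of \<open>c\<close> vanish. All trigonometric integrals of the \<open>c\<close>
  component are therefore zero.\<close>

lemma AE_component_zero: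
  fixes c :: "quaternion \<Rightarrow> real"
  assumes u: "u \<in> imaginary_units" and p: "polar \<mu> \<in> borel_measurable borel" "\<And>t. norm (polar \<mu> t) = 1"
    and \<kappa>: "finite_measure (variation \<mu>)" "sets (variation \<mu>) = sets borel"
    and c: "bounded_linear c" "\<And>q z. c (q * slice u z) = qRe q * Im z + c q * Re z"
      "\<And>q z. qRe (q * slice u z) = qRe q * Re z - c q * Im z" "\<And>q. c (qcnj q) = - c q"
    and sym: "\<And>y. laplace \<mu> (slice u (cnj (\<i> * of_real y))) = qcnj (laplace \<mu> (slice u (\<i> * of_real y)))"
  shows "AE t in variation \<mu>. c (polar \<mu> t) = 0"
proof -
  interpret finite_measure "variation \<mu>" by fact
  let ?\<kappa> = "variation \<mu>"
  note [measurable_cong] = \<kappa>(2)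
  note [measurable] = p(1)
  have [measurable]: "slice u \<in> borel_measurable borel" "c \<in> borel_measurable borel" "qRe \<in> borel_measurable borel"
    by (intro borel_measurable_continuous_onI bounded_linear.continuous_on[OF bounded_linear_slice]
        bounded_linear.continuous_on[OF c(1)] bounded_linear.continuous_on[OF bounded_linear_quaternion_parts(1)] continuous_on_id)+
  have ip: "integrable ?\<kappa> (polar \<mu>)"
    by (rule integrable_const_bound[of _ 1]) (use p in auto)
  have ic: "integrable ?\<kappa> (\<lambda>t. c (polar \<mu> t))" and iR: "integrable ?\<kappa> (\<lambda>t. qRe (polar \<mu> t))"
    using integrable_bounded_linear[OF c(1) ip] integrable_bounded_linear[OF bounded_linear_quaternion_parts(1) ip] by auto
  have trig: "integrable ?\<kappa> (\<lambda>t. q t * cos (y * t))" "integrable ?\<kappa> (\<lambda>t. q t * sin (y * t))"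
    if "integrable ?\<kappa> q" for q :: "real \<Rightarrow> real" and y
  proof -
    have [measurable]: "q \<in> borel_measurable ?\<kappa>" using that by auto
    show "integrable ?\<kappa> (\<lambda>t. q t * cos (y * t))"
      by (rule Bochner_Integration.integrable_bound[OF that]) (auto simp: abs_mult mult_left_le)
    show "integrable ?\<kappa> (\<lambda>t. q t * sin (y * t))"
      by (rule Bochner_Integration.integrable_bound[OF that]) (auto simp: abs_mult mult_left_le)
  qed
  have L: "laplace \<mu> (slice u (\<i> * of_real y)) = (\<integral>t. polar \<mu> t * slice u (cis (- (y * t))) \<partial>?\<kappa>)" for y
    unfolding laplace_def exp_slice[OF imaginary_unit(1)[OF u]]
    by (simp add: cis_conv_exp mult_ac)
  have iL: "integrable ?\<kappa> (\<lambda>t. polar \<mu> t * slice u (cis (- (y * t))))" for y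
  proof (rule integrable_const_bound[of _ 1])
    show "(\<lambda>t. polar \<mu> t * slice u (cis (- (y * t)))) \<in> borel_measurable ?\<kappa>"
      unfolding cis_conv_exp by measurable
  qed (use p u in \<open>auto simp: norm_mult norm_slice[OF u]\<close>)
  have R: "qRe (laplace \<mu> (slice u (\<i> * of_real y))) =
      (\<integral>t. qRe (polar \<mu> t) * cos (y * t) \<partial>?\<kappa>) + (\<integral>t. c (polar \<mu> t) * sin (y * t) \<partial>?\<kappa>)" for y
    unfolding L integral_bounded_linear[OF bounded_linear_quaternion_parts(1) iL, symmetric] c(3)
    using trig[OF ic, of y] trig[OF iR, of y] by simp
  have C: "c (laplace \<mu> (slice u (\<i> * of_real y))) =
      - (\<integral>t. qRe (polar \<mu> t) * sin (y * t) \<partial>?\<kappa>) + (\<integral>t. c (polar \<mu> t) * cos (y * t) \<partial>?\<kappa>)" for y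
    unfolding L integral_bounded_linear[OF c(1) iL, symmetric] c(2)
    using trig[OF ic, of y] trig[OF iR, of y] by simp
  have sym': "laplace \<mu> (slice u (\<i> * of_real (- y))) = qcnj (laplace \<mu> (slice u (\<i> * of_real y)))" for y
    using sym[of y] by simp
  show ?thesis
  proof (rule AE_zero_of_trig_integrals[OF \<kappa> ic])
    fix y
    show "(\<integral>t. c (polar \<mu> t) * cos (y * t) \<partial>?\<kappa>) = 0"
      using arg_cong[OF sym'[of y], of c] C[of y] C[of "- y"] by (simp add: c(4) del: of_real_minus)
    show "(\<integral>t. c (polar \<mu> t) * sin (y * t) \<partial>?\<kappa>) = 0"
      using arg_cong[OF sym'[of y], of qRe] R[of y] R[of "- y"] by (simp del: of_real_minus)
  qed
qed

lemma polar_real: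
  assumes p: "polar \<mu> \<in> borel_measurable borel" "\<And>t. norm (polar \<mu> t) = 1"
    and \<kappa>: "finite_measure (variation \<mu>)" "sets (variation \<mu>) = sets borel"
    and sym: "\<And>u y. u \<in> imaginary_units \<Longrightarrow>
      laplace \<mu> (slice u (cnj (\<i> * of_real y))) = qcnj (laplace \<mu> (slice u (\<i> * of_real y)))"
  shows "AE t in variation \<mu>. polar \<mu> t = of_real (qRe (polar \<mu> t))"
proof -
  note rule = AE_component_zero[OF _ p \<kappa> _ _ _ _ sym]
  have "AE t in variation \<mu>. qI (polar \<mu> t) = 0"
    by (rule rule[of "Quaternion 0 1 0 0"]) (auto simp: bounded_linear_quaternion_parts slice_def of_real_def)
  moreover have "AE t in variation \<mu>. qJ (polar \<mu> t) = 0"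
    by (rule rule[of "Quaternion 0 0 1 0"]) (auto simp: bounded_linear_quaternion_parts slice_def of_real_def)
  moreover have "AE t in variation \<mu>. qK (polar \<mu> t) = 0"
    by (rule rule[of "Quaternion 0 0 0 1"]) (auto simp: bounded_linear_quaternion_parts slice_def of_real_def)
  ultimately show ?thesis
    by eventually_elim (simp add: quaternion_eq_iff of_real_def)
qed

section \<open>Gaussians as Fourier integrals over vertical lines\<close>

text \<open>Hermite polynomials up to sign and scaling. The recursion is the product rule, so that
  \<open>herm \<delta> k\<close> times the centred normal density of width \<delta> > 0 is the k-th
  derivative of that density.\<close>

fun herm :: "real \<Rightarrow> nat \<Rightarrow> real poly" where
  "herm \<delta> 0 = 1"
| "herm \<delta> (Suc k) = pderiv (herm \<delta> k) - smult (1 / \<delta>\<^sup>2) (pCons 0 (herm \<delta> k))"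

definition gauss :: "real \<Rightarrow> nat \<Rightarrow> real \<Rightarrow> real" where
  "gauss \<delta> k x = poly (herm \<delta> k) x * normal_density 0 \<delta> x"

lemma gauss_0: "gauss \<delta> 0 = normal_density 0 \<delta>"
  by (auto simp: gauss_def)

lemma gauss_measurable [measurable]: "gauss \<delta> k \<in> borel_measurable borel"
  unfolding gauss_def poly_altdef by measurable

lemma DERIV_normal_density:
  assumes "\<delta> > 0"
  shows "(normal_density 0 \<delta> has_real_derivative - (x / \<delta>\<^sup>2) * normal_density 0 \<delta> x) (at x)"
  unfolding normal_density_def
  by (rule derivative_eq_intros refl | use assms in \<open>simp add: field_simps power2_eq_square\<close>)+

lemma DERIV_gauss:
  assumes "\<delta> > 0"
  shows "(gauss \<delta> k has_real_derivative gauss \<delta> (Suc k) x) (at x)"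
  unfolding gauss_def
  by (rule derivative_eq_intros DERIV_normal_density[OF assms] poly_DERIV refl | simp add: field_simps)+

lemma continuous_gauss: "\<delta> > 0 \<Longrightarrow> continuous_on S (gauss \<delta> k)"
  by (meson DERIV_gauss DERIV_isCont continuous_at_imp_continuous_on)

lemma power_le_fact_exp:
  fixes x :: real
  assumes "x \<ge> 0"
  shows "x ^ k \<le> fact k * exp x"
proof -
  have "(\<Sum>n\<in>{k}. x ^ n /\<^sub>R fact n) \<le> (\<Sum>n. x ^ n /\<^sub>R fact n)"
    by (rule sum_le_suminf[OF summable_exp_generic]) (use assms in auto)
  then have "x ^ k / fact k \<le> exp x" by (simp add: exp_def divide_inverse mult.commute)
  then show ?thesis by (simp add: field_simps)
qed

lemma poly_le_exp: "\<exists>C\<ge>0. \<forall>x. \<bar>poly p x\<bar> \<le> C * exp \<bar>x::real\<bar>"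
proof (intro exI conjI allI)
  let ?C = "\<Sum>i\<le>degree p. \<bar>coeff p i\<bar> * fact i"
  show "0 \<le> ?C" by (intro sum_nonneg) auto
  fix x :: real
  have "\<bar>poly p x\<bar> \<le> (\<Sum>i\<le>degree p. \<bar>coeff p i * x ^ i\<bar>)"
    unfolding poly_altdef by (rule sum_abs)
  also have "\<dots> \<le> (\<Sum>i\<le>degree p. \<bar>coeff p i\<bar> * fact i * exp \<bar>x\<bar>)"
  proof (rule sum_mono)
    fix i
    show "\<bar>coeff p i * x ^ i\<bar> \<le> \<bar>coeff p i\<bar> * fact i * exp \<bar>x\<bar>"
      using mult_left_mono[OF power_le_fact_exp[of "\<bar>x\<bar>" i], of "\<bar>coeff p i\<bar>"]
      by (simp add: abs_mult power_abs mult.assoc)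
  qed
  also have "\<dots> = ?C * exp \<bar>x\<bar>" by (simp add: sum_distrib_right)
  finally show "\<bar>poly p x\<bar> \<le> ?C * exp \<bar>x\<bar>" .
qed

text \<open>The polynomial factor costs \<open>exp \<bar>x\<bar>\<close>, whence
  \<open>b + 1\<close> in the completed square. Since \<open>b\<close> is arbitrary, every
  derivative of the Gaussian beats the growth of the group.\<close>

lemma gauss_bound:
  assumes "\<delta> > 0"
  shows "\<exists>C\<ge>0. \<forall>x. \<bar>gauss \<delta> k x\<bar> \<le> C * exp (- (b * \<bar>x\<bar>))"
proof -
  obtain C where C: "C \<ge> 0" "\<And>x. \<bar>poly (herm \<delta> k) x\<bar> \<le> C * exp \<bar>x\<bar>"
    using poly_le_exp[of "herm \<delta> k"] by blast
  let ?N = "1 / sqrt (2 * pi * \<delta>\<^sup>2)" and ?e = "(b + 1)\<^sup>2 * \<delta>\<^sup>2 / 2"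
  show ?thesis
  proof (intro exI[of _ "C * (?N * exp ?e)"] conjI allI)
    show "0 \<le> C * (?N * exp ?e)" using C by simp
    fix x
    have "0 \<le> (\<bar>x\<bar> / \<delta> - (b + 1) * \<delta>)\<^sup>2" by simp
    also have "\<dots> = x\<^sup>2 / \<delta>\<^sup>2 - 2 * ((b + 1) * \<bar>x\<bar>) + (b + 1)\<^sup>2 * \<delta>\<^sup>2"
      using assms by (simp add: power2_diff power_divide power_mult_distrib)
    finally have "\<bar>x\<bar> - x\<^sup>2 / \<delta>\<^sup>2 / 2 \<le> ?e - b * \<bar>x\<bar>"
      by (simp add: distrib_right)
    then have "\<bar>x\<bar> - x\<^sup>2 / (2 * \<delta>\<^sup>2) \<le> ?e - b * \<bar>x\<bar>" by simp
    then have "exp \<bar>x\<bar> * exp (- (x\<^sup>2 / (2 * \<delta>\<^sup>2))) \<le> exp ?e * exp (- (b * \<bar>x\<bar>))"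
      by (simp flip: exp_add)
    then have *: "exp \<bar>x\<bar> * normal_density 0 \<delta> x \<le> ?N * (exp ?e * exp (- (b * \<bar>x\<bar>)))"
      using mult_left_mono[of "exp \<bar>x\<bar> * exp (- (x\<^sup>2 / (2 * \<delta>\<^sup>2)))" "exp ?e * exp (- (b * \<bar>x\<bar>))" ?N]
      by (simp add: normal_density_def mult_ac)
    have "\<bar>gauss \<delta> k x\<bar> \<le> C * exp \<bar>x\<bar> * normal_density 0 \<delta> x"
      unfolding gauss_def abs_mult by (simp add: C mult_right_mono)
    also have "\<dots> \<le> C * (?N * (exp ?e * exp (- (b * \<bar>x\<bar>))))"
      using mult_left_mono[OF * C(1)] by (simp add: mult.assoc)
    finally show "\<bar>gauss \<delta> k x\<bar> \<le> C * (?N * exp ?e) * exp (- (b * \<bar>x\<bar>))" by (simp add: mult_ac)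
  qed
qed

lemma integrable_exp_neg_square:
  assumes "c > 0"
  shows "integrable lborel (\<lambda>y::real. exp (- (c * y\<^sup>2)))"
proof -
  let ?s = "sqrt (1 / (2 * c))"
  have "integrable lborel (\<lambda>y. sqrt (2 * pi * ?s\<^sup>2) * normal_density 0 ?s y)"
    using assms by (intro integrable_mult_right integrable_normal_density) simp
  moreover have "sqrt (2 * pi * ?s\<^sup>2) * normal_density 0 ?s y = exp (- (c * y\<^sup>2))" for y
    using assms by (simp add: normal_density_def field_simps)
  ultimately show ?thesis by simp
qed

text \<open>The power is bounded by \<open>fact k\<close> times the exponential of the modulus, and
  the resulting \<bar>y\<bar> is absorbed by giving up half of the Gaussian decay: a completed
  square bounds it by \<delta>^2 y^2 / 4 + 1 / \<delta>^2.\<close>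

lemma gauss_kernel_bound:
  assumes "\<delta> > 0"
  shows "\<exists>K\<ge>0. \<forall>y. cmod (Complex c y ^ k * exp (of_real (\<delta>\<^sup>2 / 2) * (Complex c y)\<^sup>2)) \<le> K * exp (- (\<delta>\<^sup>2 / 4 * y\<^sup>2))"
proof -
  let ?K = "fact k * exp (\<bar>c\<bar> + \<delta>\<^sup>2 * c\<^sup>2 / 2 + 1 / \<delta>\<^sup>2)"
  show ?thesis
  proof (intro exI[of _ ?K] conjI allI)
    fix y
    let ?z = "Complex c y"
    have 1: "cmod ?z ^ k \<le> fact k * exp (cmod ?z)" by (rule power_le_fact_exp) simp
    have "cmod ?z \<le> \<bar>c\<bar> + \<bar>y\<bar>" using cmod_le[of ?z] by simp
    moreover have "\<bar>y\<bar> \<le> \<delta>\<^sup>2 * y\<^sup>2 / 4 + 1 / \<delta>\<^sup>2"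
    proof -
      have "0 \<le> (\<delta> * \<bar>y\<bar> / 2 - 1 / \<delta>)\<^sup>2" by simp
      also have "\<dots> = \<delta>\<^sup>2 * y\<^sup>2 / 4 - \<bar>y\<bar> + 1 / \<delta>\<^sup>2"
        using assms by (simp add: power2_diff power_divide power_mult_distrib)
      finally show ?thesis by simp
    qed
    ultimately have "cmod ?z + \<delta>\<^sup>2 / 2 * (c\<^sup>2 - y\<^sup>2) \<le> (\<bar>c\<bar> + \<delta>\<^sup>2 * c\<^sup>2 / 2 + 1 / \<delta>\<^sup>2) - \<delta>\<^sup>2 / 4 * y\<^sup>2"
      by (simp add: algebra_simps)
    then have 2: "exp (cmod ?z) * exp (\<delta>\<^sup>2 / 2 * (c\<^sup>2 - y\<^sup>2)) \<le> exp (\<bar>c\<bar> + \<delta>\<^sup>2 * c\<^sup>2 / 2 + 1 / \<delta>\<^sup>2) * exp (- (\<delta>\<^sup>2 / 4 * y\<^sup>2))"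
      by (simp flip: exp_add)
    have "cmod (?z ^ k * exp (of_real (\<delta>\<^sup>2 / 2) * ?z\<^sup>2)) = cmod ?z ^ k * exp (\<delta>\<^sup>2 / 2 * (c\<^sup>2 - y\<^sup>2))"
      by (simp add: norm_mult norm_power norm_exp_eq_Re power2_eq_square)
    also have "\<dots> \<le> fact k * exp (cmod ?z) * exp (\<delta>\<^sup>2 / 2 * (c\<^sup>2 - y\<^sup>2))"
      by (rule mult_right_mono[OF 1]) simp
    also have "\<dots> \<le> ?K * exp (- (\<delta>\<^sup>2 / 4 * y\<^sup>2))"
      using mult_left_mono[OF 2, of "fact k"] by (simp add: mult.assoc)
    finally show "cmod (?z ^ k * exp (of_real (\<delta>\<^sup>2 / 2) * ?z\<^sup>2)) \<le> ?K * exp (- (\<delta>\<^sup>2 / 4 * y\<^sup>2))" .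
  qed simp
qed

text \<open>The integrand of the inverse Laplace transform at z = c + iy: \<open>exp\<close> of
  \<delta>^2 z^2 / 2 is the transform of the Gaussian, and z^k is the symbol of its k-th
  derivative.\<close>

definition line_kernel :: "real \<Rightarrow> real \<Rightarrow> nat \<Rightarrow> real \<Rightarrow> real \<Rightarrow> complex" where
  "line_kernel \<delta> c k x y = exp (of_real x * Complex c y) * (Complex c y ^ k * exp (of_real (\<delta>\<^sup>2 / 2) * (Complex c y)\<^sup>2))"

lemma Complex_measurable [measurable]:
  assumes [measurable]: "f \<in> borel_measurable M"
  shows "(\<lambda>y. Complex c (f y)) \<in> borel_measurable M"
  unfolding Complex_eq by measurable

lemma line_kernel_measurable [measurable]: "line_kernel \<delta> c k x \<in> borel_measurable borel"
  unfolding line_kernel_def by measurable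

lemma line_kernel_bound:
  assumes "\<delta> > 0"
  shows "\<exists>K\<ge>0. \<forall>x y. cmod (line_kernel \<delta> c k x y) \<le> exp (c * x) * (K * exp (- (\<delta>\<^sup>2 / 4 * y\<^sup>2)))"
proof -
  obtain K where K: "K \<ge> 0" "\<And>y. cmod (Complex c y ^ k * exp (of_real (\<delta>\<^sup>2 / 2) * (Complex c y)\<^sup>2)) \<le> K * exp (- (\<delta>\<^sup>2 / 4 * y\<^sup>2))"
    using gauss_kernel_bound[OF assms, of c k] by blast
  have "cmod (line_kernel \<delta> c k x y) \<le> exp (c * x) * (K * exp (- (\<delta>\<^sup>2 / 4 * y\<^sup>2)))" for x y
    unfolding line_kernel_def norm_mult[of "exp (of_real x * Complex c y)"]
    by (rule mult_mono[OF _ K(2)]) (auto simp: norm_exp_eq_Re mult.commute)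
  then show ?thesis using K(1) by blast
qed

lemma integrable_line_kernel:
  assumes "\<delta> > 0"
  shows "integrable lborel (line_kernel \<delta> c k x)"
proof -
  obtain K where "K \<ge> 0" "\<And>x y. cmod (line_kernel \<delta> c k x y) \<le> exp (c * x) * (K * exp (- (\<delta>\<^sup>2 / 4 * y\<^sup>2)))"
    using line_kernel_bound[OF assms, of c k] by blast
  note K = this
  show ?thesis
  proof (rule Bochner_Integration.integrable_bound)
    show "integrable lborel (\<lambda>y. exp (c * x) * (K * exp (- (\<delta>\<^sup>2 / 4 * y\<^sup>2))))"
      by (intro integrable_mult_right integrable_exp_neg_square) (use assms in simp)
    show "AE y in lborel. norm (line_kernel \<delta> c k x y) \<le> norm (exp (c * x) * (K * exp (- (\<delta>\<^sup>2 / 4 * y\<^sup>2))))"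
      using K by (intro AE_I2) simp
  qed simp
qed

text \<open>Every line Re z = c is treated directly instead of by moving a contour. The substitution
  y = u / \<delta> turns the integrand into a multiple of the standard normal density times
  \<open>iexp (s * u)\<close>; the real frequency \<open>s\<close> absorbs \<open>c\<close>, and
  \<open>c\<close> cancels from the result.\<close>

lemma gauss_fourier_0:
  assumes "\<delta> > 0"
  shows "of_real (gauss \<delta> 0 x) = (1 / (2 * pi)) *\<^sub>R (\<integral>y. line_kernel \<delta> c 0 x y \<partial>lborel)"
proof -
  define s where "s = (x + \<delta>\<^sup>2 * c) / \<delta>"
  have ch: "(\<integral>u. std_normal_density u *\<^sub>R iexp (s * u) \<partial>lborel) = of_real (exp (- (s\<^sup>2) / 2))"
    using fun_cong[OF char_std_normal_distribution, of s] unfolding char_def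
    by (subst (asm) integral_density) auto
  have "(\<integral>y. line_kernel \<delta> c 0 x y \<partial>lborel) = (1 / \<delta>) *\<^sub>R (\<integral>u. line_kernel \<delta> c 0 x (0 + (1 / \<delta>) * u) \<partial>lborel)"
    using lborel_integral_real_affine[of "1 / \<delta>" "line_kernel \<delta> c 0 x" 0] assms by simp
  also have "(\<lambda>u. line_kernel \<delta> c 0 x (0 + (1 / \<delta>) * u)) =
     (\<lambda>u. (sqrt (2 * pi) * exp (c * x + \<delta>\<^sup>2 * c\<^sup>2 / 2)) *\<^sub>R (std_normal_density u *\<^sub>R iexp (s * u)))"
  proof
    fix u
    have "line_kernel \<delta> c 0 x (0 + (1 / \<delta>) * u) =
       exp (of_real x * Complex c (u / \<delta>) + of_real (\<delta>\<^sup>2 / 2) * (Complex c (u / \<delta>))\<^sup>2)"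
      by (simp add: line_kernel_def exp_add)
    also have "of_real x * Complex c (u / \<delta>) + of_real (\<delta>\<^sup>2 / 2) * (Complex c (u / \<delta>))\<^sup>2 =
       of_real (c * x + \<delta>\<^sup>2 * c\<^sup>2 / 2 - u\<^sup>2 / 2) + \<i> * of_real (s * u)"
      using assms by (simp add: complex_eq_iff s_def power2_eq_square field_simps)
    also have "exp \<dots> = of_real (exp (c * x + \<delta>\<^sup>2 * c\<^sup>2 / 2) * exp (- u\<^sup>2 / 2)) * iexp (s * u)"
    proof -
      have "c * x + \<delta>\<^sup>2 * c\<^sup>2 / 2 - u\<^sup>2 / 2 = (c * x + \<delta>\<^sup>2 * c\<^sup>2 / 2) + - u\<^sup>2 / 2" by simp
      then show ?thesis by (simp only: exp_add exp_of_real)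
    qed
    finally show "line_kernel \<delta> c 0 x (0 + (1 / \<delta>) * u) =
       (sqrt (2 * pi) * exp (c * x + \<delta>\<^sup>2 * c\<^sup>2 / 2)) *\<^sub>R (std_normal_density u *\<^sub>R iexp (s * u))"
      by (simp add: std_normal_density_def scaleR_conv_of_real)
  qed
  finally have "(1 / (2 * pi)) *\<^sub>R (\<integral>y. line_kernel \<delta> c 0 x y \<partial>lborel) =
     of_real (1 / (2 * pi) * (1 / \<delta>) * sqrt (2 * pi) * exp (c * x + \<delta>\<^sup>2 * c\<^sup>2 / 2) * exp (- (s\<^sup>2) / 2))"
    unfolding integral_scaleR_right ch by (simp add: scaleR_conv_of_real)
  also have "1 / (2 * pi) * (1 / \<delta>) * sqrt (2 * pi) * exp (c * x + \<delta>\<^sup>2 * c\<^sup>2 / 2) * exp (- (s\<^sup>2) / 2) =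
     (sqrt (2 * pi) / (2 * pi * \<delta>)) * exp (c * x + \<delta>\<^sup>2 * c\<^sup>2 / 2 + - (s\<^sup>2) / 2)"
    by (simp add: mult.assoc flip: exp_add)
  also have "c * x + \<delta>\<^sup>2 * c\<^sup>2 / 2 + - (s\<^sup>2) / 2 = - x\<^sup>2 / (2 * \<delta>\<^sup>2)"
    using assms by (simp add: s_def power2_eq_square field_simps)
  also have "sqrt (2 * pi) / (2 * pi * \<delta>) = 1 / sqrt (2 * pi * \<delta>\<^sup>2)"
  proof -
    have "sqrt (2 * pi) * sqrt (2 * pi) = 2 * pi" by simp
    then show ?thesis using assms by (simp add: real_sqrt_mult field_simps del: real_sqrt_mult_self)
  qed
  finally show ?thesis by (simp add: gauss_0 normal_density_def)
qed

text \<open>Differentiation under the integral sign, with the second-order Taylor remainder of the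
  exponential as dominating function.\<close>
lemma line_kernel_derivative:
  assumes "\<delta> > 0"
  shows "((\<lambda>x. \<integral>y. line_kernel \<delta> c k x y \<partial>lborel) has_vector_derivative
     (\<integral>y. line_kernel \<delta> c (Suc k) x y \<partial>lborel)) (at x)"
proof -
  let ?G = "\<lambda>k x. \<integral>y. line_kernel \<delta> c k x y \<partial>lborel"
  let ?d = "\<lambda>h y. line_kernel \<delta> c k (x + h) y - line_kernel \<delta> c k x y - h *\<^sub>R line_kernel \<delta> c (Suc k) x y"
  let ?D = "\<lambda>h. ?G k (x + h) - ?G k x - h *\<^sub>R ?G (Suc k) x"
  \<comment> \<open>The Taylor remainder of \<open>exp (h z)\<close> carries the square of h z, so
    the dominating kernel has its power raised by two.\<close>
  obtain K where K: "K \<ge> 0" "\<And>x y. cmod (line_kernel \<delta> c (Suc (Suc k)) x y) \<le> exp (c * x) * (K * exp (- (\<delta>\<^sup>2 / 4 * y\<^sup>2)))"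
    using line_kernel_bound[OF assms, of c "Suc (Suc k)"] by blast
  let ?w = "\<lambda>y. exp (c * x) * (K * exp (- (\<delta>\<^sup>2 / 4 * y\<^sup>2)))"
  define B where "B = exp \<bar>c\<bar> * (exp (c * x) * (K * (\<integral>y. exp (- (\<delta>\<^sup>2 / 4 * y\<^sup>2)) \<partial>lborel)))"
  have est: "norm (?D h) \<le> h\<^sup>2 * B" if h: "\<bar>h\<bar> \<le> 1" for h
  proof -
    note i = integrable_line_kernel[OF assms]
    have "?D h =
       (\<integral>y. ?d h y \<partial>lborel)"
      using i by simp
    then have "norm (?D h) =
       norm (\<integral>y. ?d h y \<partial>lborel)"
      by (rule arg_cong)
    also have "\<dots> \<le> (\<integral>y. h\<^sup>2 * (exp \<bar>c\<bar> * (?w y)) \<partial>lborel)"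
    proof (rule norm_integral_le)
      fix y
      let ?z = "Complex c y"
      have eq: "?d h y =
        (exp (of_real h * ?z) - (\<Sum>j\<le>1. (of_real h * ?z) ^ j / fact j)) * line_kernel \<delta> c k x y"
        by (simp add: line_kernel_def exp_add scaleR_conv_of_real algebra_simps)
      have "cmod (exp (of_real h * ?z) - (\<Sum>j\<le>1. (of_real h * ?z) ^ j / fact j)) \<le> exp \<bar>Re (of_real h * ?z)\<bar> * cmod (of_real h * ?z) ^ Suc 1 / fact 1"
        by (rule Taylor_exp)
      also have "\<dots> \<le> exp \<bar>c\<bar> * (h\<^sup>2 * cmod ?z ^ 2)"
      proof -
        have "\<bar>h * c\<bar> \<le> \<bar>c\<bar>" using h by (simp add: abs_mult mult_left_le_one_le)
        then show ?thesis
          by (simp add: norm_mult power_mult_distrib mult_right_mono power2_eq_square[symmetric] numeral_2_eq_2[symmetric])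
      qed
      finally have "norm (?d h y)
         \<le> exp \<bar>c\<bar> * (h\<^sup>2 * cmod ?z ^ 2) * cmod (line_kernel \<delta> c k x y)"
        unfolding eq norm_mult by (rule mult_right_mono) simp
      also have "\<dots> = h\<^sup>2 * (exp \<bar>c\<bar> * cmod (line_kernel \<delta> c (Suc (Suc k)) x y))"
        by (simp add: line_kernel_def norm_mult power2_eq_square mult_ac)
      also have "\<dots> \<le> h\<^sup>2 * (exp \<bar>c\<bar> * (?w y))"
        by (intro mult_left_mono K) auto
      finally show "norm (?d h y)
         \<le> h\<^sup>2 * (exp \<bar>c\<bar> * (?w y))" .
    next
      show "integrable lborel (\<lambda>y. ?d h y)"
        by (intro Bochner_Integration.integrable_diff integrable_scaleR_right i)
      show "integrable lborel (\<lambda>y. h\<^sup>2 * (exp \<bar>c\<bar> * (?w y)))"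
        by (intro integrable_mult_right integrable_exp_neg_square) (use assms in simp)
    qed
    also have "\<dots> = h\<^sup>2 * B" by (simp only: B_def integral_mult_right_zero)
    finally show ?thesis .
  qed
  have "((\<lambda>h. norm (?D h) / norm h) \<longlongrightarrow> 0) (at 0)"
  proof (rule Lim_null_comparison)
    show "((\<lambda>h. \<bar>h\<bar> * B) \<longlongrightarrow> 0) (at 0)"
      by (rule tendsto_mult_left_zero, rule tendsto_rabs_zero) (rule tendsto_ident_at)
    have "eventually (\<lambda>h::real. \<bar>h\<bar> \<le> 1) (at 0)"
      unfolding eventually_at by (intro exI[of _ 1]) (auto simp: dist_norm)
    then show "\<forall>\<^sub>F h in at 0. norm (norm (?D h) / norm h) \<le> \<bar>h\<bar> * B"
    proof eventually_elim
      case (elim h)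
      show ?case
      proof (cases "h = 0")
        case False
        have "norm (norm (?D h) / norm h) = norm (?D h) / \<bar>h\<bar>" by simp
        also have "\<dots> \<le> h\<^sup>2 * B / \<bar>h\<bar>"
          by (rule divide_right_mono[OF est[OF elim]]) simp
        also have "h\<^sup>2 * B / \<bar>h\<bar> = \<bar>h\<bar> * B"
          using False by (simp add: power2_eq_square field_simps abs_if)
        finally show ?thesis .
      qed simp
    qed
  qed
  then show ?thesis
    unfolding has_vector_derivative_def has_derivative_at
    by (intro conjI bounded_linear_scaleR_left)
qed

lemma gauss_fourier:
  assumes "\<delta> > 0"
  shows "of_real (gauss \<delta> k x) = (1 / (2 * pi)) *\<^sub>R (\<integral>y. line_kernel \<delta> c k x y \<partial>lborel)"
proof (induction k arbitrary: x)
  case 0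
  show ?case by (rule gauss_fourier_0[OF assms])
next
  case (Suc k)
  have "((\<lambda>x. complex_of_real (gauss \<delta> k x)) has_vector_derivative of_real (gauss \<delta> (Suc k) x)) (at x)"
    by (rule has_vector_derivative_of_real) (use DERIV_gauss[OF assms, of k x] has_real_derivative_iff_has_vector_derivative in blast)
  moreover have "((\<lambda>x. complex_of_real (gauss \<delta> k x)) has_vector_derivative
      (1 / (2 * pi)) *\<^sub>R (\<integral>y. line_kernel \<delta> c (Suc k) x y \<partial>lborel)) (at x)"
    unfolding Suc
    by (rule bounded_linear.has_vector_derivative[OF bounded_linear_scaleR_right line_kernel_derivative[OF assms]])
  ultimately show ?case by (rule vector_derivative_unique_at)
qed

lemma line_kernel_mult_power: "line_kernel \<delta> c k x y = line_kernel \<delta> c 0 x y * Complex c y ^ k"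
  by (simp add: line_kernel_def)

lemma line_kernel_shift:
  "line_kernel \<delta> c k (r - t) y = line_kernel \<delta> c k r y * exp (- (of_real t * Complex c y))"
proof -
  have "of_real (r - t) * Complex c y = of_real r * Complex c y + - (of_real t * Complex c y)"
    by (simp add: left_diff_distrib)
  then show ?thesis unfolding line_kernel_def by (simp only: exp_add mult_ac)
qed

text \<open>The position enters the modulus only through \<open>exp (c * r)\<close>. This is what
  converts the choice of a line into exponential decay in \<open>r\<close>.\<close>

lemma cmod_line_kernel: "cmod (line_kernel \<delta> c k r y) = exp (c * r) * cmod (line_kernel \<delta> c k 0 y)"
  by (simp add: line_kernel_def norm_mult norm_exp_eq_Re mult.commute)

section \<open>Convolution of real measures with Gaussians\<close>

definition conv :: "real measure \<Rightarrow> (real \<Rightarrow> real) \<Rightarrow> (real \<Rightarrow> real) \<Rightarrow> real \<Rightarrow> real" where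
  "conv \<kappa> a \<phi> r = (\<integral>t. a t * \<phi> (r - t) \<partial>\<kappa>)"

text \<open>The real measure with density \<open>a\<close> against \<kappa>. The exponential moment
  of order \<open>b\<close> makes its transform exist and stay bounded on the closed strip \<bar>Re
  z\<bar> \<le> b. In the application \<kappa> is a total variation and \<open>a\<close> the real
  part of the polar density.\<close>

locale exp_weighted =
  fixes \<kappa> :: "real measure" and a :: "real \<Rightarrow> real" and b :: real
  assumes sets_kappa [measurable_cong]: "sets \<kappa> = sets borel"
    and weight_measurable [measurable]: "a \<in> borel_measurable borel"
    and weight_le: "\<And>t. \<bar>a t\<bar> \<le> 1"
    and b_nonneg: "b \<ge> 0"
    and exp_moment: "(\<integral>\<^sup>+t. ennreal (exp (b * \<bar>t\<bar>)) \<partial>\<kappa>) < \<infinity>"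
begin

sublocale finite_measure \<kappa>
proof
  have "emeasure \<kappa> (space \<kappa>) = (\<integral>\<^sup>+t. 1 \<partial>\<kappa>)" by simp
  also have "\<dots> \<le> (\<integral>\<^sup>+t. ennreal (exp (b * \<bar>t\<bar>)) \<partial>\<kappa>)"
    by (intro nn_integral_mono) (use b_nonneg in simp)
  finally show "emeasure \<kappa> (space \<kappa>) \<noteq> \<infinity>" using exp_moment by auto
qed

lemma integrable_exp: "integrable \<kappa> (\<lambda>t. exp (b * \<bar>t\<bar>))"
  by (rule integrableI_bounded) (use exp_moment in auto)

lemma exp_le: "\<bar>c\<bar> \<le> b \<Longrightarrow> exp (c * t) \<le> exp (b * \<bar>t\<bar>)"
proof -
  assume c: "\<bar>c\<bar> \<le> b"
  have "c * t \<le> \<bar>c\<bar> * \<bar>t\<bar>" by (simp flip: abs_mult)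
  also have "\<dots> \<le> b * \<bar>t\<bar>" using c by (rule mult_right_mono) simp
  finally show ?thesis by simp
qed

lemma integrable_weight_exp:
  assumes "\<bar>Re z\<bar> \<le> b"
  shows "integrable \<kappa> (\<lambda>t. a t *\<^sub>R exp (- (of_real t * z)))"
proof (rule Bochner_Integration.integrable_bound[OF integrable_exp])
  show "AE t in \<kappa>. norm (a t *\<^sub>R exp (- (of_real t * z))) \<le> norm (exp (b * \<bar>t\<bar>))"
  proof (rule AE_I2)
    fix t
    have "norm (a t *\<^sub>R exp (- (of_real t * z))) = \<bar>a t\<bar> * exp (- Re z * t)"
      by (simp add: norm_mult norm_exp_eq_Re mult.commute)
    also have "\<dots> \<le> 1 * exp (b * \<bar>t\<bar>)"
      by (rule mult_mono[OF weight_le exp_le]) (use assms in auto)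
    finally show "norm (a t *\<^sub>R exp (- (of_real t * z))) \<le> norm (exp (b * \<bar>t\<bar>))" by simp
  qed
qed measurable

lemma lap_bound:
  assumes "\<bar>Re z\<bar> \<le> b"
  shows "cmod (lap \<kappa> a z) \<le> (\<integral>t. exp (b * \<bar>t\<bar>) \<partial>\<kappa>)"
  unfolding lap_def
proof (rule norm_integral_le[OF _ integrable_weight_exp[OF assms] integrable_exp])
  fix t
  have "norm (a t *\<^sub>R exp (- (of_real t * z))) = \<bar>a t\<bar> * exp (- Re z * t)"
    by (simp add: norm_mult norm_exp_eq_Re mult.commute)
  also have "\<dots> \<le> 1 * exp (b * \<bar>t\<bar>)"
    by (rule mult_mono[OF weight_le exp_le]) (use assms in auto)
  finally show "norm (a t *\<^sub>R exp (- (of_real t * z))) \<le> exp (b * \<bar>t\<bar>)" by simp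
qed

lemma lap_measurable [measurable]: "(\<lambda>y. lap \<kappa> a (Complex c y)) \<in> borel_measurable borel"
  unfolding lap_def by measurable

lemma lap_cnj: "lap \<kappa> a (cnj z) = cnj (lap \<kappa> a z)"
  unfolding lap_def Bochner_Integration.integral_cnj[symmetric] by (rule Bochner_Integration.integral_cong) (simp_all add: exp_cnj)

text \<open>Inserting the Fourier integral of the Gaussian and exchanging the integrals leaves the
  transform of the measure, by \<open>line_kernel_shift\<close>. The exponential moment justifies
  the exchange on every line with \<bar>c\<bar> \<le> b.\<close>

lemma conv_gauss_fourier:
  assumes \<delta>: "\<delta> > 0" and c: "\<bar>c\<bar> \<le> b"
  shows "of_real (conv \<kappa> a (gauss \<delta> k) r) =
    (1 / (2 * pi)) *\<^sub>R (\<integral>y. line_kernel \<delta> c k r y * lap \<kappa> a (Complex c y) \<partial>lborel)"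
proof -
  let ?m = "\<lambda>t. \<bar>a t\<bar> * exp (- c * t)"
  let ?l = "\<lambda>y. line_kernel \<delta> c k r y"
  interpret pair_sigma_finite \<kappa> "lborel :: real measure" ..
  note i = integrable_line_kernel[OF \<delta>, of c k]
  let ?f = "\<lambda>t y. a t *\<^sub>R (?l y * exp (- (of_real t * Complex c y)))"
  have nf: "norm (?f t y) = ?m t * norm (?l y)" for t y
    by (simp add: norm_mult norm_exp_eq_Re mult_ac)
  have integ: "integrable (\<kappa> \<Otimes>\<^sub>M lborel) (\<lambda>(t, y). ?f t y)"
  proof (rule Fubini_integrable)
    show "(\<lambda>(t, y). ?f t y) \<in> borel_measurable (\<kappa> \<Otimes>\<^sub>M lborel)"
      by measurable
    have eq: "(\<lambda>t. \<integral>y. norm (case (t, y) of (t, y) \<Rightarrow> ?f t y) \<partial>lborel) =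
        (\<lambda>t. ?m t * (\<integral>y. norm (?l y) \<partial>lborel))"
      by (simp only: prod.case nf integral_mult_right_zero)
    have "integrable \<kappa> (\<lambda>t. ?m t * (\<integral>y. norm (?l y) \<partial>lborel))"
    proof (rule integrable_mult_left, rule Bochner_Integration.integrable_bound[OF integrable_exp])
      show "AE t in \<kappa>. norm (?m t) \<le> norm (exp (b * \<bar>t\<bar>))"
      proof (rule AE_I2)
        fix t
        have "?m t \<le> 1 * exp (b * \<bar>t\<bar>)"
          by (rule mult_mono[OF weight_le exp_le]) (use c in auto)
        then show "norm (?m t) \<le> norm (exp (b * \<bar>t\<bar>))" by (simp add: abs_mult)
      qed
    qed measurable
    then show "integrable \<kappa> (\<lambda>t. \<integral>y. norm (case (t, y) of (t, y) \<Rightarrow> ?f t y) \<partial>lborel)"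
      unfolding eq .
    have "integrable lborel (?f t)" for t
    proof (rule Bochner_Integration.integrable_bound)
      show "integrable lborel (\<lambda>y. ?m t * norm (?l y))"
        by (intro integrable_mult_right integrable_norm i)
    qed (auto simp: nf simp del: norm_scaleR)
    then show "AE t in \<kappa>. integrable lborel (\<lambda>y. case (t, y) of (t, y) \<Rightarrow> ?f t y)"
      by simp
  qed
  have "of_real (conv \<kappa> a (gauss \<delta> k) r) = (\<integral>t. of_real (a t * gauss \<delta> k (r - t)) \<partial>\<kappa> :: complex)"
    unfolding conv_def by (rule integral_complex_of_real[symmetric])
  also have "\<dots> = (\<integral>t. (1 / (2 * pi)) *\<^sub>R (\<integral>y. ?f t y \<partial>lborel) \<partial>\<kappa>)"
  proof (rule Bochner_Integration.integral_cong[OF refl])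
    fix t
    have "complex_of_real (a t * gauss \<delta> k (r - t)) = a t *\<^sub>R of_real (gauss \<delta> k (r - t))"
      by (simp add: scaleR_conv_of_real)
    also have "\<dots> = (1 / (2 * pi)) *\<^sub>R (a t *\<^sub>R (\<integral>y. line_kernel \<delta> c k (r - t) y \<partial>lborel))"
      by (simp only: gauss_fourier[OF \<delta>, of _ _ c] scaleR_scaleR mult.commute)
    also have "a t *\<^sub>R (\<integral>y. line_kernel \<delta> c k (r - t) y \<partial>lborel) = (\<integral>y. ?f t y \<partial>lborel)"
      by (simp only: line_kernel_shift integral_scaleR_right)
    finally show "complex_of_real (a t * gauss \<delta> k (r - t)) = (1 / (2 * pi)) *\<^sub>R (\<integral>y. ?f t y \<partial>lborel)" .
  qed
  also have "\<dots> = (1 / (2 * pi)) *\<^sub>R (\<integral>t. (\<integral>y. ?f t y \<partial>lborel) \<partial>\<kappa>)"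
    by (rule integral_scaleR_right)
  also have "(\<integral>t. (\<integral>y. ?f t y \<partial>lborel) \<partial>\<kappa>) = (\<integral>y. (\<integral>t. ?f t y \<partial>\<kappa>) \<partial>lborel)"
    by (rule Fubini_integral[OF integ, symmetric])
  also have "(\<lambda>y. \<integral>t. ?f t y \<partial>\<kappa>) = (\<lambda>y. ?l y * lap \<kappa> a (Complex c y))"
    unfolding lap_def integral_mult_right_zero[symmetric] by (simp only: mult_scaleR_right)
  finally show ?thesis .
qed

lemma integrable_line_kernel_lap:
  assumes \<delta>: "\<delta> > 0" and c: "\<bar>c\<bar> \<le> b"
  shows "integrable lborel (\<lambda>y. line_kernel \<delta> c k r y * lap \<kappa> a (Complex c y))"
proof (rule Bochner_Integration.integrable_bound)
  let ?K = "\<integral>t. exp (b * \<bar>t\<bar>) \<partial>\<kappa>" and ?l = "\<lambda>y. line_kernel \<delta> c k r y"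
  let ?f = "\<lambda>y. ?l y * lap \<kappa> a (Complex c y)"
  show "integrable lborel (\<lambda>y. ?K *\<^sub>R ?l y)"
    by (intro integrable_scaleR_right integrable_line_kernel \<delta>)
  show "AE y in lborel. norm (?f y) \<le> norm (?K *\<^sub>R ?l y)"
  proof (rule AE_I2)
    fix y
    have "norm (lap \<kappa> a (Complex c y)) \<le> ?K"
      by (rule lap_bound) (use c in simp)
    then have "norm (?l y) * norm (lap \<kappa> a (Complex c y)) \<le> norm (?l y) * ?K"
      by (rule mult_left_mono) simp
    then show "norm (?f y) \<le> norm (?K *\<^sub>R ?l y)"
      by (simp add: norm_mult mult.commute)
  qed
qed measurable

text \<open>The measure convolved with p(d/dr) applied to the Gaussian of width \<delta> > 0; under
  the transform this multiplies \<open>lap \<kappa> a\<close> by the polynomial.\<close>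

definition poly_conv :: "real \<Rightarrow> real poly \<Rightarrow> real \<Rightarrow> real" where
  "poly_conv \<delta> p r = (\<Sum>k\<le>degree p. coeff p k * conv \<kappa> a (gauss \<delta> k) r)"

lemma poly_line_kernel:
  "(\<Sum>k\<le>degree p. coeff p k *\<^sub>R (line_kernel \<delta> c k r y * w)) =
     line_kernel \<delta> c 0 r y * (cpoly p (Complex c y) * w)"
  by (subst line_kernel_mult_power)
    (simp add: poly_altdef coeff_map_poly degree_map_poly sum_distrib_left sum_distrib_right scaleR_conv_of_real mult_ac)

lemma poly_conv_fourier:
  assumes \<delta>: "\<delta> > 0" and c: "\<bar>c\<bar> \<le> b"
  shows "of_real (poly_conv \<delta> p r) = (1 / (2 * pi)) *\<^sub>R
    (\<integral>y. line_kernel \<delta> c 0 r y * (cpoly p (Complex c y) * lap \<kappa> a (Complex c y)) \<partial>lborel)"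
    and integrable_poly_line_kernel_lap:
    "integrable lborel (\<lambda>y. line_kernel \<delta> c 0 r y * (cpoly p (Complex c y) * lap \<kappa> a (Complex c y)))"
proof -
  note i = integrable_line_kernel_lap[OF \<delta> c]
  have "complex_of_real (poly_conv \<delta> p r) = (\<Sum>k\<le>degree p. coeff p k *\<^sub>R of_real (conv \<kappa> a (gauss \<delta> k) r))"
    by (simp add: poly_conv_def scaleR_conv_of_real)
  also have "\<dots> = (1 / (2 * pi)) *\<^sub>R (\<Sum>k\<le>degree p. coeff p k *\<^sub>R (\<integral>y. line_kernel \<delta> c k r y * lap \<kappa> a (Complex c y) \<partial>lborel))"
    by (simp only: conv_gauss_fourier[OF \<delta> c] scaleR_sum_right scaleR_scaleR mult.commute)
  also have "(\<Sum>k\<le>degree p. coeff p k *\<^sub>R (\<integral>y. line_kernel \<delta> c k r y * lap \<kappa> a (Complex c y) \<partial>lborel)) =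
     (\<integral>y. (\<Sum>k\<le>degree p. coeff p k *\<^sub>R (line_kernel \<delta> c k r y * lap \<kappa> a (Complex c y))) \<partial>lborel)"
    by (subst Bochner_Integration.integral_sum) (auto intro!: integrable_scaleR_right i simp del: scaleR_conv_of_real)
  finally show "of_real (poly_conv \<delta> p r) = (1 / (2 * pi)) *\<^sub>R
    (\<integral>y. line_kernel \<delta> c 0 r y * (cpoly p (Complex c y) * lap \<kappa> a (Complex c y)) \<partial>lborel)"
    by (simp only: poly_line_kernel)
  have "integrable lborel (\<lambda>y. \<Sum>k\<le>degree p. coeff p k *\<^sub>R (line_kernel \<delta> c k r y * lap \<kappa> a (Complex c y)))"
    by (intro Bochner_Integration.integrable_sum integrable_scaleR_right i)
  then show "integrable lborel (\<lambda>y. line_kernel \<delta> c 0 r y * (cpoly p (Complex c y) * lap \<kappa> a (Complex c y)))"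
    by (simp only: poly_line_kernel)
qed

text \<open>The Gaussian is the same integral with symbol 1, so the difference carries the factor
  \<open>W n z - 1\<close>. Its L1 norm along a fixed line tends to 0 by domination with the
  Gaussian kernel, and the line Re z = c contributes the factor \<open>exp (c * r)\<close>.\<close>

lemma poly_conv_tendsto_gauss:
  assumes \<delta>: "\<delta> > 0"
    and bd: "\<And>n z. \<bar>Re z\<bar> \<le> b \<Longrightarrow> cmod (cpoly (P n) z * lap \<kappa> a z) \<le> K"
    and lim: "\<And>z. \<bar>Re z\<bar> \<le> b \<Longrightarrow> (\<lambda>n. cpoly (P n) z * lap \<kappa> a z) \<longlonglongrightarrow> 1"
  obtains e where "e \<longlonglongrightarrow> 0" "\<And>n r. \<bar>poly_conv \<delta> (P n) r - gauss \<delta> 0 r\<bar> \<le> e n * exp (- (b * \<bar>r\<bar>))"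
proof -
  let ?d = "\<lambda>n r. poly_conv \<delta> (P n) r - gauss \<delta> 0 r"
  define W where "W n z = cpoly (P n) z * lap \<kappa> a z" for n z
  let ?q = "\<lambda>c r n y. line_kernel \<delta> c 0 r y * (W n (Complex c y) - 1)"
  define E where "E c n = (1 / (2 * pi)) * (\<integral>y. cmod (?q c 0 n y) \<partial>lborel)" for c n
  have iK: "integrable lborel (\<lambda>y. ?q c r n y)" if c: "\<bar>c\<bar> \<le> b" for c n r
    using Bochner_Integration.integrable_diff[OF integrable_poly_line_kernel_lap[OF \<delta> c, of r "P n"] integrable_line_kernel[OF \<delta>, of c 0 r]]
    by (simp add: W_def right_diff_distrib)
  have est: "\<bar>?d n r\<bar> \<le> E c n * exp (c * r)" if c: "\<bar>c\<bar> \<le> b" for c n r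
  proof -
    have "complex_of_real (?d n r) =
      (1 / (2 * pi)) *\<^sub>R (\<integral>y. ?q c r n y \<partial>lborel)"
      using Bochner_Integration.integral_diff[OF integrable_poly_line_kernel_lap[OF \<delta> c, of r "P n"] integrable_line_kernel[OF \<delta>, of c 0 r]]
      unfolding of_real_diff poly_conv_fourier[OF \<delta> c] gauss_fourier[OF \<delta>, of 0 r c] W_def
      by (simp only: right_diff_distrib scaleR_diff_right mult_1_right)
    then have "\<bar>?d n r\<bar> =
      norm ((1 / (2 * pi)) *\<^sub>R (\<integral>y. ?q c r n y \<partial>lborel))"
      by (metis norm_of_real)
    also have "\<dots> = (1 / (2 * pi)) * norm (\<integral>y. ?q c r n y \<partial>lborel)"
      by (simp only: norm_scaleR) simp
    also have "\<dots> \<le> (1 / (2 * pi)) * (\<integral>y. norm (?q c r n y) \<partial>lborel)"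
      by (intro mult_left_mono integral_norm_bound) simp
    also have "(\<lambda>y. norm (?q c r n y)) =
       (\<lambda>y. exp (c * r) * norm (?q c 0 n y))"
      by (simp add: norm_mult cmod_line_kernel[of \<delta> c 0 r] mult.assoc)
    finally show ?thesis by (simp only: E_def integral_mult_right_zero) (simp add: mult_ac)
  qed
  have E0: "E c \<longlonglongrightarrow> 0" if c: "\<bar>c\<bar> \<le> b" for c
  proof -
    have "(\<lambda>n. \<integral>y. cmod (?q c 0 n y) \<partial>lborel) \<longlonglongrightarrow> (\<integral>y. 0 \<partial>(lborel :: real measure))"
    proof (rule integral_dominated_convergence[where w="\<lambda>y. (K + 1) * cmod (line_kernel \<delta> c 0 0 y)"])
      show "integrable lborel (\<lambda>y. (K + 1) * cmod (line_kernel \<delta> c 0 0 y))"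
        by (intro integrable_mult_right integrable_norm integrable_line_kernel \<delta>)
      show "(\<lambda>y. cmod (?q c 0 n y)) \<in> borel_measurable lborel" for n
        using iK[OF c, of 0 n] by auto
      show "AE y in lborel. (\<lambda>n. cmod (?q c 0 n y)) \<longlonglongrightarrow> 0"
      proof (rule AE_I2)
        fix y
        have "(\<lambda>n. W n (Complex c y)) \<longlonglongrightarrow> 1" unfolding W_def by (rule lim) (use c in simp)
        then have "(\<lambda>n. cmod (?q c 0 n y)) \<longlonglongrightarrow> cmod (line_kernel \<delta> c 0 0 y * (1 - 1))"
          by (intro tendsto_intros)
        then show "(\<lambda>n. cmod (?q c 0 n y)) \<longlonglongrightarrow> 0" by simp
      qed
      show "AE y in lborel. norm (cmod (?q c 0 n y)) \<le> (K + 1) * cmod (line_kernel \<delta> c 0 0 y)" for n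
      proof (rule AE_I2)
        fix y
        have "cmod (W n (Complex c y)) \<le> K" unfolding W_def by (rule bd) (use c in simp)
        then have "cmod (W n (Complex c y) - 1) \<le> K + 1"
          using norm_triangle_ineq4[of "W n (Complex c y)" 1] by simp
        then have "cmod (line_kernel \<delta> c 0 0 y) * cmod (W n (Complex c y) - 1) \<le> cmod (line_kernel \<delta> c 0 0 y) * (K + 1)"
          by (rule mult_left_mono) simp
        then show "norm (cmod (?q c 0 n y)) \<le> (K + 1) * cmod (line_kernel \<delta> c 0 0 y)"
          by (simp add: norm_mult mult.commute)
      qed
    qed simp
    then show ?thesis
      unfolding E_def by (intro tendsto_mult_right_zero) simp
  qed
  have Enn: "0 \<le> E c n" for c n unfolding E_def by (intro mult_nonneg_nonneg integral_nonneg_AE) auto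
  show ?thesis
  \<comment> \<open>The line Re z = - b gives decay for r \<ge> 0 and the line Re z = b for r < 0;
    the sum is one error sequence that serves both signs.\<close>
  proof (rule that[of "\<lambda>n. E b n + E (- b) n"])
    show "(\<lambda>n. E b n + E (- b) n) \<longlonglongrightarrow> 0"
      using tendsto_add[OF E0[of b] E0[of "- b"]] b_nonneg by simp
    show "\<bar>?d n r\<bar> \<le> (E b n + E (- b) n) * exp (- (b * \<bar>r\<bar>))" for n r
    proof (cases "r \<ge> 0")
      case True
      then have "\<bar>?d n r\<bar> \<le> E (- b) n * exp (- (b * \<bar>r\<bar>))"
        using est[of "- b" n r] b_nonneg by simp
      also have "\<dots> \<le> (E b n + E (- b) n) * exp (- (b * \<bar>r\<bar>))"
        by (rule mult_right_mono) (use Enn in auto)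
      finally show ?thesis .
    next
      case False
      then have "\<bar>?d n r\<bar> \<le> E b n * exp (- (b * \<bar>r\<bar>))"
        using est[of b n r] b_nonneg by simp
      also have "\<dots> \<le> (E b n + E (- b) n) * exp (- (b * \<bar>r\<bar>))"
        by (rule mult_right_mono) (use Enn in auto)
      finally show ?thesis .
    qed
  qed
qed

end

text \<open>Both sides are the same Fourier integral over the imaginary axis. Agreement of the
  transforms there is enough, so \<open>b\<close> and \<open>b'\<close> need not be related.\<close>

lemma conv_eq_poly_conv:
  assumes "exp_weighted \<kappa> a b" "exp_weighted \<kappa>' a' b'" and \<delta>: "\<delta> > 0"
    and eq: "\<And>y. lap \<kappa>' a' (Complex 0 y) = cpoly p (Complex 0 y) * lap \<kappa> a (Complex 0 y)"
  shows "conv \<kappa>' a' (gauss \<delta> 0) r = exp_weighted.poly_conv \<kappa> a \<delta> p r"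
proof -
  interpret A: exp_weighted \<kappa> a b by fact
  interpret B: exp_weighted \<kappa>' a' b' by fact
  have "complex_of_real (conv \<kappa>' a' (gauss \<delta> 0) r) = of_real (A.poly_conv \<delta> p r)"
    by (subst B.conv_gauss_fourier[OF \<delta>, of 0], use B.b_nonneg in simp,
        subst A.poly_conv_fourier[OF \<delta>, of 0], use A.b_nonneg in simp, simp only: eq)
  then show ?thesis by (simp only: of_real_eq_iff)
qed

section \<open>Operators generated by weighted orbits\<close>

lemma nn_integral_exp_neg_abs_finite:
  assumes c: "c > 0"
  shows "(\<integral>\<^sup>+t. ennreal (exp (- (c * \<bar>t\<bar>))) \<partial>lborel) < \<infinity>"
proof -
  have half: "(\<integral>\<^sup>+u. ennreal (exp (- u)) * indicator {0 ..} u \<partial>lborel) = 1"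
    using nn_intergal_power_times_exp_Ici[of 0] by simp
  have half': "(\<integral>\<^sup>+u. ennreal (exp u) * indicator {..0} u \<partial>lborel) = 1"
  proof -
    have "(\<integral>\<^sup>+u. ennreal (exp u) * indicator {..0} u \<partial>lborel) =
       (\<integral>\<^sup>+u. ennreal (exp (- u)) * indicator {0..} u \<partial>lborel)"
      by (subst nn_integral_real_affine[of _ "- 1" 0]) (auto simp: indicator_def intro!: nn_integral_cong)
    then show ?thesis using half by simp
  qed
  have "(\<integral>\<^sup>+t. ennreal (exp (- \<bar>t\<bar>)) \<partial>lborel) \<le>
     (\<integral>\<^sup>+u. ennreal (exp (- u)) * indicator {0 ..} u + ennreal (exp u) * indicator {..0} u \<partial>lborel)"
    by (intro nn_integral_mono) (auto simp: indicator_def)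
  also have "\<dots> = 1 + 1"
    by (subst nn_integral_add) (auto simp: half half')
  finally have fin: "(\<integral>\<^sup>+t. ennreal (exp (- \<bar>t\<bar>)) \<partial>lborel) < \<infinity>"
    by (rule le_less_trans) simp
  have "(\<integral>\<^sup>+t. ennreal (exp (- \<bar>t\<bar>)) \<partial>lborel) = ennreal \<bar>c\<bar> * (\<integral>\<^sup>+t. ennreal (exp (- \<bar>0 + c * t\<bar>)) \<partial>lborel)"
    by (rule nn_integral_real_affine) (use c in auto)
  also have "(\<integral>\<^sup>+t. ennreal (exp (- \<bar>0 + c * t\<bar>)) \<partial>lborel) = (\<integral>\<^sup>+t. ennreal (exp (- (c * \<bar>t\<bar>))) \<partial>lborel)"
    using c by (simp add: abs_mult)
  finally show ?thesis using fin c by (auto simp: ennreal_mult_less_top)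
qed

lemma integrable_exp_neg_abs: "c > 0 \<Longrightarrow> integrable lborel (\<lambda>t::real. exp (- (c * \<bar>t\<bar>)))"
  by (rule integrableI_bounded) (use nn_integral_exp_neg_abs_finite in auto)

section \<open>Kernels of exponential decay\<close>

definition exp_decay :: "real \<Rightarrow> (real \<Rightarrow> real) \<Rightarrow> bool" where
  "exp_decay b \<phi> \<longleftrightarrow> \<phi> \<in> borel_measurable borel \<and> (\<exists>C\<ge>0. \<forall>t. \<bar>\<phi> t\<bar> \<le> C * exp (- (b * \<bar>t\<bar>)))"

lemma exp_decay_gauss: "\<delta> > 0 \<Longrightarrow> exp_decay b (gauss \<delta> k)"
  using gauss_bound by (auto simp: exp_decay_def)

lemma exp_decay_cmult: "exp_decay b \<phi> \<Longrightarrow> exp_decay b (\<lambda>t. c * \<phi> t)"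
proof -
  assume "exp_decay b \<phi>"
  then obtain C where m: "\<phi> \<in> borel_measurable borel" and C: "C \<ge> 0" "\<And>t. \<bar>\<phi> t\<bar> \<le> C * exp (- (b * \<bar>t\<bar>))"
    by (auto simp: exp_decay_def)
  have "\<bar>c * \<phi> t\<bar> \<le> \<bar>c\<bar> * C * exp (- (b * \<bar>t\<bar>))" for t
    using mult_left_mono[OF C(2)[of t], of "\<bar>c\<bar>"] by (simp add: abs_mult mult.assoc)
  with m C(1) show ?thesis
    unfolding exp_decay_def by (intro conjI exI[of _ "\<bar>c\<bar> * C"]) auto
qed

lemma exp_decay_sum: "(\<And>i. i \<in> I \<Longrightarrow> exp_decay b (\<phi> i)) \<Longrightarrow> exp_decay b (\<lambda>t. \<Sum>i\<in>I. \<phi> i t)"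
proof (induction I rule: infinite_finite_induct)
  case (insert i I)
  have "exp_decay b (\<phi> i)" "exp_decay b (\<lambda>t. \<Sum>i\<in>I. \<phi> i t)" using insert by simp_all
  then obtain C C' where *: "\<phi> i \<in> borel_measurable borel" "(\<lambda>t. \<Sum>i\<in>I. \<phi> i t) \<in> borel_measurable borel"
    "C \<ge> 0" "\<And>t. \<bar>\<phi> i t\<bar> \<le> C * exp (- (b * \<bar>t\<bar>))" "C' \<ge> 0" "\<And>t. \<bar>\<Sum>i\<in>I. \<phi> i t\<bar> \<le> C' * exp (- (b * \<bar>t\<bar>))"
    by (auto simp: exp_decay_def)
  have "\<bar>\<phi> i t + (\<Sum>i\<in>I. \<phi> i t)\<bar> \<le> (C + C') * exp (- (b * \<bar>t\<bar>))" for t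
    using abs_triangle_ineq[of "\<phi> i t" "\<Sum>i\<in>I. \<phi> i t"] *(4)[of t] *(6)[of t] by (simp add: distrib_right)
  then show ?case
    using insert(1,2) * unfolding exp_decay_def
    by (intro conjI exI[of _ "C + C'"]) (auto intro: borel_measurable_add)
qed (auto simp: exp_decay_def intro!: exI[of _ 0])

lemma exp_shift_le:
  fixes b t s :: real
  assumes "b \<ge> 0"
  shows "exp (- (b * \<bar>t - s\<bar>)) \<le> exp (- (b * \<bar>t\<bar>)) * exp (b * \<bar>s\<bar>)"
proof -
  have "b * \<bar>t\<bar> \<le> b * (\<bar>t - s\<bar> + \<bar>s\<bar>)" by (rule mult_left_mono[OF _ assms]) linarith
  then show ?thesis by (simp add: distrib_left flip: exp_add)
qed

lemma exp_decay_shift: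
  assumes "b \<ge> 0" "exp_decay b \<phi>"
  shows "exp_decay b (\<lambda>t. \<phi> (t + h))"
proof -
  obtain C where m [measurable]: "\<phi> \<in> borel_measurable borel" and C: "C \<ge> 0" "\<And>t. \<bar>\<phi> t\<bar> \<le> C * exp (- (b * \<bar>t\<bar>))"
    using assms(2) by (auto simp: exp_decay_def)
  have "\<bar>\<phi> (t + h)\<bar> \<le> C * exp (b * \<bar>h\<bar>) * exp (- (b * \<bar>t\<bar>))" for t
  proof -
    have "C * exp (- (b * \<bar>t - - h\<bar>)) \<le> C * (exp (- (b * \<bar>t\<bar>)) * exp (b * \<bar>- h\<bar>))"
      by (intro mult_left_mono exp_shift_le assms C)
    with C(2)[of "t + h"] show ?thesis by (simp add: mult_ac)
  qed
  then show ?thesis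
    unfolding exp_decay_def using C(1) by (intro conjI exI[of _ "C * exp (b * \<bar>h\<bar>)"]) auto
qed

section \<open>Integrals along orbits of the group\<close>

locale bounded_group =
  fixes Z :: "real \<Rightarrow> 'v::quaternionic_banach \<Rightarrow> 'v" and M \<omega> :: real
  assumes group: "strongly_continuous_group Z"
    and M_pos: "M > 0" and omega_nonneg: "\<omega> \<ge> 0"
    and onorm_Z: "\<And>t. onorm (Z t) \<le> M * exp (\<omega> * \<bar>t\<bar>)"
begin

lemma bounded_linear_Z: "bounded_linear (Z t)"
proof -
  have lin: "Z t (qright u a + v) = qright (Z t u) a + Z t v" for u v a
    using group unfolding strongly_continuous_group_def bounded_right_linear_def by blast
  \<comment> \<open>Right multiplication by a real quaternion is real scaling, so right linearity
    contains both additivity and real homogeneity.\<close>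
  have r1: "qright v 1 = v" for v :: 'v using qright_of_real[of v 1] by simp
  have add: "Z t (u + v) = Z t u + Z t v" for u v using lin[of u 1 v] by (simp add: r1)
  have "Z t 0 = 0" using add[of 0 0] by simp
  then have sc: "Z t (r *\<^sub>R u) = r *\<^sub>R Z t u" for r u
    using lin[of u "of_real r" 0] by (simp add: qright_of_real)
  obtain K where "\<And>v. norm (Z t v) \<le> K * norm v"
    using group unfolding strongly_continuous_group_def bounded_right_linear_def by blast
  then show ?thesis
    by (intro bounded_linear_intro[of _ K]) (auto simp: add sc mult.commute)
qed

lemma Z_0: "Z 0 v = v" and Z_add: "Z (s + t) v = Z s (Z t v)" and continuous_Z: "continuous_on UNIV (\<lambda>t. Z t v)"
  using group unfolding strongly_continuous_group_def by simp_all

lemma norm_Z: "norm (Z t v) \<le> M * exp (\<omega> * \<bar>t\<bar>) * norm v"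
  by (rule order_trans[OF onorm[OF bounded_linear_Z] mult_right_mono[OF onorm_Z]]) simp

lemma continuous_orbit: "continuous_on UNIV (\<lambda>t. Z (- t) v)"
  by (rule continuous_on_compose2[OF continuous_Z[of v], of UNIV uminus]) (auto intro: continuous_intros)

lemma norm_orbit: "norm (Z (- t) v) \<le> M * norm v * exp (\<omega> * \<bar>t\<bar>)"
  using norm_Z[of "- t" v] by (simp add: mult_ac)

lemmas Z_linear = bounded_linear_Z[THEN bounded_linear.linear]

lemma Z_scaleR: "Z t (r *\<^sub>R v) = r *\<^sub>R Z t v"
  by (rule linear_scale[OF Z_linear])

text \<open>One notion covers two uses: a total variation with its real density, and Lebesgue
  measure with a decaying kernel.\<close>

definition orbit_weight :: "real measure \<Rightarrow> (real \<Rightarrow> real) \<Rightarrow> bool" where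
  "orbit_weight N \<phi> \<longleftrightarrow> sets N = sets borel \<and> \<phi> \<in> borel_measurable borel \<and>
     (\<integral>\<^sup>+t. ennreal (\<bar>\<phi> t\<bar> * exp (\<omega> * \<bar>t\<bar>)) \<partial>N) < \<infinity>"

definition orbit_int :: "real measure \<Rightarrow> (real \<Rightarrow> real) \<Rightarrow> 'v \<Rightarrow> 'v" where
  "orbit_int N \<phi> w = bochner_int N (\<lambda>t. \<phi> t *\<^sub>R Z (- t) w)"

lemma orbit_int:
  assumes "orbit_weight N \<phi>"
  shows has_bochner_int_orbit_int: "has_bochner_int N (\<lambda>t. \<phi> t *\<^sub>R Z (- t) w) (orbit_int N \<phi> w)"
    and orbit_int_riemann: "(\<lambda>n. \<Sum>i\<in>mesh n. (\<integral>t. indicator (cell n i) t * \<phi> t \<partial>N) *\<^sub>R Z (- node n i) w)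
      \<longlonglongrightarrow> orbit_int N \<phi> w"
proof -
  have N: "sets N = sets borel" and m: "\<phi> \<in> borel_measurable borel"
    and fin: "(\<integral>\<^sup>+t. ennreal (\<bar>\<phi> t\<bar> * exp (\<omega> * \<bar>t\<bar>)) \<partial>N) < \<infinity>"
    using assms by (auto simp: orbit_weight_def)
  obtain x where x: "has_bochner_int N (\<lambda>t. \<phi> t *\<^sub>R Z (- t) w) x"
    "(\<lambda>n. \<Sum>i\<in>mesh n. (\<integral>t. indicator (cell n i) t * \<phi> t \<partial>N) *\<^sub>R Z (- node n i) w) \<longlonglongrightarrow> x"
    by (rule has_bochner_int_riemann[OF N m continuous_orbit norm_orbit omega_nonneg fin])
  moreover have "orbit_int N \<phi> w = x" unfolding orbit_int_def by (rule bochner_int_eqI) (rule x)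
  ultimately show "has_bochner_int N (\<lambda>t. \<phi> t *\<^sub>R Z (- t) w) (orbit_int N \<phi> w)"
    "(\<lambda>n. \<Sum>i\<in>mesh n. (\<integral>t. indicator (cell n i) t * \<phi> t \<partial>N) *\<^sub>R Z (- node n i) w) \<longlonglongrightarrow> orbit_int N \<phi> w"
    by simp_all
qed

lemma bounded_linear_orbit_int:
  assumes \<phi>: "orbit_weight N \<phi>"
  shows "bounded_linear (orbit_int N \<phi>)"
proof (rule bounded_linear_intro)
  note h = has_bochner_int_orbit_int[OF \<phi>]
  fix u v :: 'v and r :: real
  have "has_bochner_int N (\<lambda>t. \<phi> t *\<^sub>R Z (- t) u + \<phi> t *\<^sub>R Z (- t) v) (orbit_int N \<phi> u + orbit_int N \<phi> v)"
    by (intro has_bochner_int_add h)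
  then show "orbit_int N \<phi> (u + v) = orbit_int N \<phi> u + orbit_int N \<phi> v"
    unfolding orbit_int_def[of N \<phi> "u + v"]
    by (intro bochner_int_eqI) (simp add: linear_add[OF Z_linear] scaleR_add_right)
  have "has_bochner_int N (\<lambda>t. r *\<^sub>R (\<phi> t *\<^sub>R Z (- t) u)) (r *\<^sub>R orbit_int N \<phi> u)"
    by (rule has_bochner_int_bounded_linear[OF bounded_linear_scaleR_right h])
  then show "orbit_int N \<phi> (r *\<^sub>R u) = r *\<^sub>R orbit_int N \<phi> u"
    unfolding orbit_int_def[of N \<phi> "r *\<^sub>R u"]
    by (intro bochner_int_eqI) (simp add: Z_scaleR mult.commute)
  have sN: "sets N = sets borel" and m: "\<phi> \<in> borel_measurable borel"
    and fin: "(\<integral>\<^sup>+t. ennreal (\<bar>\<phi> t\<bar> * exp (\<omega> * \<bar>t\<bar>)) \<partial>N) < \<infinity>"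
    using \<phi> by (auto simp: orbit_weight_def)
  note [measurable_cong] = sN and [measurable] = m
  have i: "integrable N (\<lambda>t. \<bar>\<phi> t\<bar> * exp (\<omega> * \<bar>t\<bar>))"
    by (rule integrableI_bounded) (use fin in auto)
  have "ennreal (norm (orbit_int N \<phi> u)) \<le> (\<integral>\<^sup>+t. norm (\<phi> t *\<^sub>R Z (- t) u) \<partial>N)"
    by (rule has_bochner_int_norm_le[OF h])
  also have "\<dots> \<le> (\<integral>\<^sup>+t. ennreal (norm u * (M * (\<bar>\<phi> t\<bar> * exp (\<omega> * \<bar>t\<bar>)))) \<partial>N)"
  proof (intro nn_integral_mono ennreal_leI)
    show "norm (\<phi> t *\<^sub>R Z (- t) u) \<le> norm u * (M * (\<bar>\<phi> t\<bar> * exp (\<omega> * \<bar>t\<bar>)))" for t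
      using mult_left_mono[OF norm_orbit[of t u], of "\<bar>\<phi> t\<bar>"] by (simp add: mult_ac)
  qed
  also have "\<dots> = ennreal (\<integral>t. norm u * (M * (\<bar>\<phi> t\<bar> * exp (\<omega> * \<bar>t\<bar>))) \<partial>N)"
    by (rule nn_integral_eq_integral) (use i M_pos in auto)
  also have "(\<integral>t. norm u * (M * (\<bar>\<phi> t\<bar> * exp (\<omega> * \<bar>t\<bar>))) \<partial>N) = norm u * (M * (\<integral>t. \<bar>\<phi> t\<bar> * exp (\<omega> * \<bar>t\<bar>) \<partial>N))"
    by (simp only: integral_mult_right_zero)
  finally show "norm (orbit_int N \<phi> u) \<le> norm u * (M * (\<integral>t. \<bar>\<phi> t\<bar> * exp (\<omega> * \<bar>t\<bar>) \<partial>N))"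
    by (subst (asm) ennreal_le_iff) (use M_pos in \<open>auto intro!: mult_nonneg_nonneg integral_nonneg_AE\<close>)
qed

lemma orbit_int_commute:
  assumes "orbit_weight N \<phi>"
  shows "orbit_int N \<phi> (Z h w) = Z h (orbit_int N \<phi> w)"
proof -
  have "has_bochner_int N (\<lambda>t. Z h (\<phi> t *\<^sub>R Z (- t) w)) (Z h (orbit_int N \<phi> w))"
    by (rule has_bochner_int_bounded_linear[OF bounded_linear_Z has_bochner_int_orbit_int[OF assms]])
  moreover have "Z h (\<phi> t *\<^sub>R Z (- t) w) = \<phi> t *\<^sub>R Z (- t) (Z h w)" for t
    by (simp add: Z_scaleR add.commute flip: Z_add)
  ultimately show ?thesis unfolding orbit_int_def[of N \<phi> "Z h w"] by (intro bochner_int_eqI) simp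
qed

abbreviation gint :: "(real \<Rightarrow> real) \<Rightarrow> 'v \<Rightarrow> 'v" where
  "gint \<equiv> orbit_int lborel"

lemma orbit_weight_exp_decay:
  assumes "exp_decay b \<phi>" "b > \<omega>"
  shows "orbit_weight lborel \<phi>"
proof -
  obtain C where m [measurable]: "\<phi> \<in> borel_measurable borel" and C: "C \<ge> 0" "\<And>t. \<bar>\<phi> t\<bar> \<le> C * exp (- (b * \<bar>t\<bar>))"
    using assms(1) by (auto simp: exp_decay_def)
  have "integrable lborel (\<lambda>t. \<bar>\<phi> t\<bar> * exp (\<omega> * \<bar>t\<bar>))"
  proof (rule Bochner_Integration.integrable_bound)
    show "integrable lborel (\<lambda>t. C * exp (- ((b - \<omega>) * \<bar>t\<bar>)))"
      by (intro integrable_mult_right integrable_exp_neg_abs) (use assms(2) in simp)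
    show "AE t in lborel. norm (\<bar>\<phi> t\<bar> * exp (\<omega> * \<bar>t\<bar>)) \<le> norm (C * exp (- ((b - \<omega>) * \<bar>t\<bar>)))"
    proof (rule AE_I2)
      fix t
      have "\<bar>\<phi> t\<bar> * exp (\<omega> * \<bar>t\<bar>) \<le> C * exp (- (b * \<bar>t\<bar>)) * exp (\<omega> * \<bar>t\<bar>)"
        by (rule mult_right_mono[OF C(2)]) simp
      also have "\<dots> = C * exp (- ((b - \<omega>) * \<bar>t\<bar>))"
        by (simp add: mult.assoc left_diff_distrib flip: exp_add)
      finally show "norm (\<bar>\<phi> t\<bar> * exp (\<omega> * \<bar>t\<bar>)) \<le> norm (C * exp (- ((b - \<omega>) * \<bar>t\<bar>)))"
        using C(1) by (simp add: abs_mult)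
    qed
  qed measurable
  then show ?thesis
    using m by (simp add: orbit_weight_def integrable_iff_bounded)
qed

lemmas has_bochner_int_gint = has_bochner_int_orbit_int[OF orbit_weight_exp_decay]
lemmas bounded_linear_gint = bounded_linear_orbit_int[OF orbit_weight_exp_decay]
lemmas gint_commute = orbit_int_commute[OF orbit_weight_exp_decay]

text \<open>A pointwise estimate of scalar kernels becomes an estimate in V, with \<open>e\<close>
  as a linear factor; \<open>c > \<omega>\<close> makes the decay outweigh the growth of the
  group.\<close>

lemma gint_diff_le:
  assumes \<phi>: "exp_decay b \<phi>" and \<psi>: "exp_decay b' \<psi>" and b: "b > \<omega>" "b' > \<omega>" "c > \<omega>"
    and le: "\<And>t. \<bar>\<phi> t - \<psi> t\<bar> \<le> e * exp (- (c * \<bar>t\<bar>))"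
  shows "norm (gint \<phi> w - gint \<psi> w) \<le> e * (M * norm w * (\<integral>t. exp (- ((c - \<omega>) * \<bar>t\<bar>)) \<partial>lborel))"
proof -
  let ?d = "\<lambda>t. norm (\<phi> t *\<^sub>R Z (- t) w - \<psi> t *\<^sub>R Z (- t) w)"
  let ?u = "\<lambda>t. e * (M * norm w * exp (- ((c - \<omega>) * \<bar>t\<bar>)))"
  have e: "e \<ge> 0"
    using order_trans[OF abs_ge_zero le[of 0]] by simp
  have "ennreal (norm (gint \<phi> w - gint \<psi> w)) \<le> (\<integral>\<^sup>+t. ?d t \<partial>lborel)"
    by (rule has_bochner_int_diff_le[OF has_bochner_int_gint[OF \<phi> b(1)] has_bochner_int_gint[OF \<psi> b(2)]])
  also have "\<dots> \<le> (\<integral>\<^sup>+t. ennreal (?u t) \<partial>lborel)"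
  proof (intro nn_integral_mono ennreal_leI)
    fix t
    have "?d t = \<bar>\<phi> t - \<psi> t\<bar> * norm (Z (- t) w)"
      by (simp flip: scaleR_left_diff_distrib)
    also have "\<dots> \<le> (e * exp (- (c * \<bar>t\<bar>))) * (M * norm w * exp (\<omega> * \<bar>t\<bar>))"
      by (rule mult_mono[OF le norm_orbit]) (use e in auto)
    also have "\<dots> = e * (M * norm w * (exp (- (c * \<bar>t\<bar>)) * exp (\<omega> * \<bar>t\<bar>)))" by simp
    also have "exp (- (c * \<bar>t\<bar>)) * exp (\<omega> * \<bar>t\<bar>) = exp (- ((c - \<omega>) * \<bar>t\<bar>))"
      by (simp add: left_diff_distrib flip: exp_add)
    finally show "?d t \<le> ?u t" .
  qed
  also have "\<dots> = ennreal (\<integral>t. ?u t \<partial>lborel)"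
  proof (rule nn_integral_eq_integral)
    show "integrable lborel (\<lambda>t. ?u t)"
      by (intro integrable_mult_right integrable_exp_neg_abs) (use b in simp)
  qed (use e M_pos in auto)
  also have "(\<integral>t. ?u t \<partial>lborel) =
     e * (M * norm w * (\<integral>t. exp (- ((c - \<omega>) * \<bar>t\<bar>)) \<partial>lborel))"
    by (simp only: integral_mult_right_zero)
  finally show ?thesis
    by (subst (asm) ennreal_le_iff) (use e M_pos in \<open>auto intro!: mult_nonneg_nonneg integral_nonneg_AE\<close>)
qed

text \<open>The group acts on such an integral by translating its kernel, by invariance of Lebesgue
  measure. Differentiating along the orbit therefore amounts to differentiating the kernel.\<close>

lemma gint_translate:
  assumes "exp_decay b \<phi>" "b > \<omega>"
  shows "Z h (gint \<phi> w) = gint (\<lambda>t. \<phi> (t + h)) w"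
proof -
  have "has_bochner_int lborel (\<lambda>t. Z h (\<phi> t *\<^sub>R Z (- t) w)) (Z h (gint \<phi> w))"
    by (rule has_bochner_int_bounded_linear[OF bounded_linear_Z has_bochner_int_gint[OF assms]])
  then have "has_bochner_int lborel (\<lambda>t. Z h (\<phi> (h + t) *\<^sub>R Z (- (h + t)) w)) (Z h (gint \<phi> w))"
    by (rule has_bochner_int_shift)
  moreover have "Z h (\<phi> (h + t) *\<^sub>R Z (- (h + t)) w) = \<phi> (t + h) *\<^sub>R Z (- t) w" for t
    by (simp add: Z_scaleR add.commute flip: Z_add)
  ultimately show ?thesis unfolding orbit_int_def[of lborel "\<lambda>t. \<phi> (t + h)" w] by (intro bochner_int_eqI[symmetric]) simp
qed

lemma gint_sum:
  assumes "\<And>i. i \<in> I \<Longrightarrow> exp_decay b (\<phi> i)" "b > \<omega>"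
  shows "gint (\<lambda>t. \<Sum>i\<in>I. c i * \<phi> i t) w = (\<Sum>i\<in>I. c i *\<^sub>R gint (\<phi> i) w)"
proof -
  have "has_bochner_int lborel (\<lambda>t. \<Sum>i\<in>I. c i *\<^sub>R (\<phi> i t *\<^sub>R Z (- t) w)) (\<Sum>i\<in>I. c i *\<^sub>R gint (\<phi> i) w)"
    by (rule has_bochner_int_sum, rule has_bochner_int_bounded_linear[OF bounded_linear_scaleR_right],
        rule has_bochner_int_gint[OF assms(1) assms(2)])
  then show ?thesis unfolding orbit_int_def[of lborel "\<lambda>t. \<Sum>i\<in>I. c i * \<phi> i t" w]
    by (intro bochner_int_eqI) (simp add: scaleR_sum_left)
qed

text \<open>The difference quotient in V is the integral of the difference quotient of the kernel.
  Two applications of the mean value theorem bound its distance to the derivative by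
  \<open>h\<close> times the second derivative at a point within distance 1 of \<open>t\<close>,
  which explains the factor \<open>exp b\<close>.\<close>

lemma gint_gauss_quotient:
  assumes \<delta>: "\<delta> > 0"
  shows "((\<lambda>h. (1 / h) *\<^sub>R (Z h (gint (gauss \<delta> k) w) - gint (gauss \<delta> k) w)) \<longlongrightarrow> gint (gauss \<delta> (Suc k)) w) (at_right 0)"
proof -
  define b where "b = \<omega> + 1"
  have b: "b > \<omega>" "b \<ge> 0" using omega_nonneg by (auto simp: b_def)
  note dec = exp_decay_gauss[OF \<delta>, of b]
  obtain C where C: "C \<ge> 0" "\<And>t. \<bar>gauss \<delta> (Suc (Suc k)) t\<bar> \<le> C * exp (- (b * \<bar>t\<bar>))"
    using gauss_bound[OF \<delta>] by blast
  let ?q = "\<lambda>h t. (1 / h) * gauss \<delta> k (t + h) + (- (1 / h)) * gauss \<delta> k t"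
  have est: "\<bar>?q h t - gauss \<delta> (Suc k) t\<bar> \<le> h * C * exp b * exp (- (b * \<bar>t\<bar>))" if h: "0 < h" "h \<le> 1" for h t
  proof -
    obtain \<xi> where \<xi>: "t < \<xi>" "\<xi> < t + h" "gauss \<delta> k (t + h) - gauss \<delta> k t = h * gauss \<delta> (Suc k) \<xi>"
      using MVT2[of t "t + h" "gauss \<delta> k" "gauss \<delta> (Suc k)"] DERIV_gauss[OF \<delta>] h by auto
    obtain \<eta> where \<eta>: "t < \<eta>" "\<eta> < \<xi>" "gauss \<delta> (Suc k) \<xi> - gauss \<delta> (Suc k) t = (\<xi> - t) * gauss \<delta> (Suc (Suc k)) \<eta>"
      using MVT2[of t \<xi> "gauss \<delta> (Suc k)" "gauss \<delta> (Suc (Suc k))"] DERIV_gauss[OF \<delta>] \<xi> by auto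
    have "?q h t = (1 / h) * (gauss \<delta> k (t + h) - gauss \<delta> k t)" by (simp add: right_diff_distrib)
    also have "\<dots> = gauss \<delta> (Suc k) \<xi>" using h by (simp add: \<xi>)
    finally have "\<bar>?q h t - gauss \<delta> (Suc k) t\<bar> = \<bar>\<xi> - t\<bar> * \<bar>gauss \<delta> (Suc (Suc k)) \<eta>\<bar>"
      by (simp add: \<eta> abs_mult)
    also have "\<dots> \<le> h * (C * exp (- (b * \<bar>\<eta>\<bar>)))"
      by (rule mult_mono[OF _ C(2)]) (use \<xi> h in auto)
    also have "\<dots> \<le> h * (C * (exp (- (b * \<bar>t\<bar>)) * exp b))"
    proof -
      have "b * \<bar>t\<bar> \<le> b * (\<bar>\<eta>\<bar> + 1)" by (rule mult_left_mono) (use \<xi> \<eta> h b in auto)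
      then have "exp (- (b * \<bar>\<eta>\<bar>)) \<le> exp (- (b * \<bar>t\<bar>)) * exp b" by (simp add: distrib_left flip: exp_add)
      then show ?thesis by (intro mult_left_mono C) (use h in auto)
    qed
    finally show ?thesis by (simp add: mult_ac)
  qed
  have shifted: "exp_decay b (\<lambda>t. gauss \<delta> k (t + h))" for h
    by (rule exp_decay_shift[OF b(2) dec])
  have lin: "(1 / h) *\<^sub>R (Z h (gint (gauss \<delta> k) w) - gint (gauss \<delta> k) w) = gint (?q h) w" for h
  proof -
    \<comment> \<open>The two terms are indexed by truth values so that the rule for finite sums of
      kernels applies.\<close>
    define \<phi> where "\<phi> i t = (if i then gauss \<delta> k (t + h) else gauss \<delta> k t)" for i t
    have "gint (\<lambda>t. \<Sum>i\<in>{True, False}. (if i then 1 / h else - (1 / h)) * \<phi> i t) w =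
      (\<Sum>i\<in>{True, False}. (if i then 1 / h else - (1 / h)) *\<^sub>R gint (\<phi> i) w)"
    proof (rule gint_sum[OF _ b(1)])
      show "exp_decay b (\<phi> i)" for i
        using shifted dec by (cases i) (simp_all add: \<phi>_def[abs_def])
    qed
    moreover have "\<phi> True = (\<lambda>t. gauss \<delta> k (t + h))" "\<phi> False = gauss \<delta> k" by (auto simp: \<phi>_def)
    ultimately show ?thesis
      by (simp add: gint_translate[OF dec b(1)] scaleR_diff_right)
  qed
  have qdec: "exp_decay b (?q h)" for h
  proof -
    define \<phi> where "\<phi> i t = (if i then (1 / h) * gauss \<delta> k (t + h) else (- (1 / h)) * gauss \<delta> k t)" for i t
    have "exp_decay b (\<phi> i)" for i
      using exp_decay_cmult[OF shifted, of "1 / h" h] exp_decay_cmult[OF dec, of "- (1 / h)"]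
      by (cases i) (simp_all add: \<phi>_def[abs_def])
    then have "exp_decay b (\<lambda>t. \<Sum>i\<in>{True, False}. \<phi> i t)" by (intro exp_decay_sum)
    then show ?thesis by (simp add: \<phi>_def)
  qed
  let ?K = "C * exp b * (M * norm w * (\<integral>t. exp (- ((b - \<omega>) * \<bar>t\<bar>)) \<partial>lborel))"
  have "((\<lambda>h. gint (?q h) w - gint (gauss \<delta> (Suc k)) w) \<longlongrightarrow> 0) (at_right 0)"
  proof (rule Lim_null_comparison)
    show "((\<lambda>h. h * ?K) \<longlongrightarrow> 0) (at_right 0)"
      by (rule tendsto_mult_left_zero) (rule tendsto_ident_at)
    have "eventually (\<lambda>h::real. 0 < h \<and> h \<le> 1) (at_right 0)"
      using eventually_at_right_real[of 0 1] by (rule eventually_mono) auto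
    then show "\<forall>\<^sub>F h in at_right 0. norm (gint (?q h) w - gint (gauss \<delta> (Suc k)) w) \<le> h * ?K"
    proof eventually_elim
      case (elim h)
      then show ?case
        using gint_diff_le[OF qdec dec b(1) b(1) b(1) est, of h w] by (simp add: mult_ac)
    qed
  qed
  then show ?thesis unfolding lin by (simp add: LIM_zero_cancel)
qed

text \<open>Approximate identity: the substitution t = d n * u fixes the density and moves the width
  into the orbit, where strong continuity at 0 applies. Since \<open>d n\<close> is at most 1, the
  growth of the orbit is dominated independently of \<open>n\<close>.\<close>

lemma gint_gauss_tendsto:
  "(\<lambda>n. gint (gauss (1 / real (Suc n)) 0) w) \<longlonglongrightarrow> w"
proof -
  define d where "d n = 1 / real (Suc n)" for n
  have d: "d n > 0" "d n \<le> 1" for n by (auto simp: d_def)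
  have dlim: "d \<longlonglongrightarrow> 0"
    unfolding d_def using LIMSEQ_inverse_real_of_nat by (simp add: inverse_eq_divide)
  let ?N = "std_normal_density"
  let ?z = "\<lambda>n u. norm (Z (- (d n * u)) w - w)"
  let ?q = "\<lambda>n u. ?N u * ?z n u"
  let ?w = "\<lambda>u. (M + 1) * norm w * (?N u * exp (\<omega> * \<bar>u\<bar>))"
  have Zc: "continuous_on UNIV (\<lambda>u. Z (- (d n * u)) w - w)" for n
    by (intro continuous_intros continuous_on_compose2[OF continuous_Z[of w], of UNIV]) auto
  have meas: "(\<lambda>u. ?z n u) \<in> borel_measurable borel" for n
    by (intro borel_measurable_continuous_onI continuous_on_norm Zc)
  have Zc': "(\<lambda>t. norm (Z (- t) w - w)) \<in> borel_measurable borel"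
    by (intro borel_measurable_continuous_onI continuous_on_norm continuous_on_diff continuous_orbit continuous_on_const)
  have le: "ennreal (norm (gint (gauss (d n) 0) w - w)) \<le> (\<integral>\<^sup>+u. ennreal (?q n u) \<partial>lborel)" for n
  proof -
    have "has_bochner_int lborel (normal_density 0 (d n)) (1::real)"
      using has_bochner_integral_integrable[OF integrable_normal_density[OF d(1)[of n], of 0]] d(1)[of n]
      by (simp add: has_bochner_int_iff_has_bochner_integral)
    from has_bochner_int_bounded_linear[OF bounded_linear_scaleR_left this, of w]
    have 1: "has_bochner_int lborel (\<lambda>t. gauss (d n) 0 t *\<^sub>R w) w" by (simp add: gauss_0)
    have "ennreal (norm (gint (gauss (d n) 0) w - w)) \<le>
       (\<integral>\<^sup>+t. norm (gauss (d n) 0 t *\<^sub>R Z (- t) w - gauss (d n) 0 t *\<^sub>R w) \<partial>lborel)"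
      by (rule has_bochner_int_diff_le[OF has_bochner_int_gint[OF exp_decay_gauss[OF d(1)], of "\<omega> + 1"] 1]) simp
    also have "\<dots> = (\<integral>\<^sup>+t. ennreal (normal_density 0 (d n) t * norm (Z (- t) w - w)) \<partial>lborel)"
      by (simp add: gauss_0 flip: scaleR_diff_right)
    also have "\<dots> = ennreal \<bar>d n\<bar> * (\<integral>\<^sup>+u. ennreal (normal_density 0 (d n) (0 + d n * u) * norm (Z (- (0 + d n * u)) w - w)) \<partial>lborel)"
      by (rule nn_integral_real_affine) (use Zc' d(1)[of n] in \<open>measurable, auto\<close>)
    also have "\<dots> = (\<integral>\<^sup>+u. ennreal \<bar>d n\<bar> * ennreal (normal_density 0 (d n) (0 + d n * u) * norm (Z (- (0 + d n * u)) w - w)) \<partial>lborel)"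
      by (rule nn_integral_cmult[symmetric]) (use meas[of n] in \<open>simp only: add_0, measurable\<close>)
    also have "\<dots> = (\<integral>\<^sup>+u. ennreal (?q n u) \<partial>lborel)"
    proof (rule nn_integral_cong)
      fix u
      have "d n * normal_density 0 (d n) (0 + d n * u) = ?N u"
        using d(1)[of n] by (simp add: normal_density_def real_sqrt_mult power_mult_distrib)
      then show "ennreal \<bar>d n\<bar> * ennreal (normal_density 0 (d n) (0 + d n * u) * norm (Z (- (0 + d n * u)) w - w)) =
         ennreal (?q n u)"
        using d(1)[of n] by (simp add: ennreal_mult[symmetric] mult.assoc[symmetric] del: normal_density_pos)
    qed
    finally show ?thesis .
  qed
  have "(\<lambda>n. \<integral>\<^sup>+u. ennreal (?q n u) \<partial>lborel) \<longlonglongrightarrow> (\<integral>\<^sup>+u. 0 \<partial>(lborel :: real measure))"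
  proof (rule nn_integral_dominated_convergence[where w="\<lambda>u. ennreal (?w u)"])
    show "(\<lambda>u. ennreal (?q n u)) \<in> borel_measurable lborel" for n
      using meas by measurable
    obtain C where C: "C \<ge> 0" "\<And>t. \<bar>gauss 1 0 t\<bar> \<le> C * exp (- ((\<omega> + 1) * \<bar>t\<bar>))"
      using gauss_bound[of 1 0 "\<omega> + 1"] by auto
    show "(\<integral>\<^sup>+u. ennreal (?w u) \<partial>lborel) < \<infinity>"
    proof -
      have i: "integrable lborel (\<lambda>u. C * exp (- (1 * \<bar>u\<bar>)))"
        by (intro integrable_mult_right integrable_exp_neg_abs) simp
      have "integrable lborel (\<lambda>u. ?N u * exp (\<omega> * \<bar>u\<bar>))"
      proof (rule Bochner_Integration.integrable_bound[OF i])
        show "AE u in lborel. norm (?N u * exp (\<omega> * \<bar>u\<bar>)) \<le> norm (C * exp (- (1 * \<bar>u\<bar>)))"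
        proof (rule AE_I2)
          fix u
          have "?N u * exp (\<omega> * \<bar>u\<bar>) \<le> C * exp (- ((\<omega> + 1) * \<bar>u\<bar>)) * exp (\<omega> * \<bar>u\<bar>)"
            using C(2)[of u] by (intro mult_right_mono) (auto simp: gauss_0)
          also have "\<dots> = C * exp (- (1 * \<bar>u\<bar>))" by (simp add: mult.assoc distrib_right flip: exp_add)
          finally show "norm (?N u * exp (\<omega> * \<bar>u\<bar>)) \<le> norm (C * exp (- (1 * \<bar>u\<bar>)))" using C(1) by simp
        qed
      qed measurable
      then have "integrable lborel (\<lambda>u. ?w u)" by simp
      then show ?thesis
        using M_pos by (subst nn_integral_eq_integral) auto
    qed
    show "AE u in lborel. ennreal (?q n u) \<le> ennreal (?w u)" for n
    proof (intro AE_I2 ennreal_leI)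
      fix u
      have "\<bar>d n * u\<bar> \<le> \<bar>u\<bar>" using d[of n] by (simp add: abs_mult mult_left_le_one_le)
      then have "\<omega> * \<bar>d n * u\<bar> \<le> \<omega> * \<bar>u\<bar>" using omega_nonneg by (rule mult_left_mono)
      then have "exp (\<omega> * \<bar>d n * u\<bar>) \<le> exp (\<omega> * \<bar>u\<bar>)" by simp
      then have "M * norm w * exp (\<omega> * \<bar>d n * u\<bar>) \<le> M * norm w * exp (\<omega> * \<bar>u\<bar>)"
        by (rule mult_left_mono) (use M_pos in auto)
      moreover have "norm w * 1 \<le> norm w * exp (\<omega> * \<bar>u\<bar>)"
        by (rule mult_left_mono) (use omega_nonneg in auto)
      moreover have "?z n u \<le> M * norm w * exp (\<omega> * \<bar>d n * u\<bar>) + norm w"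
        using norm_triangle_ineq4[of "Z (- (d n * u)) w" w] norm_orbit[of "d n * u" w] by linarith
      ultimately have "?z n u \<le> (M + 1) * norm w * exp (\<omega> * \<bar>u\<bar>)"
        by (simp add: distrib_right)
      then have "?q n u \<le> ?N u * ((M + 1) * norm w * exp (\<omega> * \<bar>u\<bar>))"
        by (rule mult_left_mono) simp
      then show "?q n u \<le> ?w u"
        by (simp add: mult_ac)
    qed
    show "AE u in lborel. (\<lambda>n. ennreal (?q n u)) \<longlonglongrightarrow> 0"
    proof (rule AE_I2)
      fix u
      have "(\<lambda>n. - (d n * u)) \<longlonglongrightarrow> - (0 * u)" by (intro tendsto_intros dlim)
      then have "(\<lambda>n. Z (- (d n * u)) w) \<longlonglongrightarrow> Z (- (0 * u)) w"
        by (intro isCont_tendsto_compose[of _ "\<lambda>t. Z t w"])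
          (use continuous_Z[of w] in \<open>auto simp: continuous_on_eq_continuous_at\<close>)
      then have "(\<lambda>n. ?q n u) \<longlonglongrightarrow> ?N u * norm (Z (- (0 * u)) w - w)"
        by (intro tendsto_intros)
      then have "(\<lambda>n. ?q n u) \<longlonglongrightarrow> 0" by (simp add: Z_0)
      then show "(\<lambda>n. ennreal (?q n u)) \<longlonglongrightarrow> 0"
        using tendsto_ennrealI by fastforce
    qed
  qed simp_all
  then have "(\<lambda>n. \<integral>\<^sup>+u. ennreal (?q n u) \<partial>lborel) \<longlonglongrightarrow> 0" by simp
  from ennreal_tendsto_0_le[OF le this]
  have "(\<lambda>n. ennreal (norm (gint (gauss (d n) 0) w - w))) \<longlonglongrightarrow> ennreal 0" by simp
  then have "(\<lambda>n. norm (gint (gauss (d n) 0) w - w)) \<longlonglongrightarrow> 0"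
    by (subst (asm) tendsto_ennreal_iff) auto
  then have "(\<lambda>n. gint (gauss (d n) 0) w - w) \<longlonglongrightarrow> 0" by (rule tendsto_norm_zero_cancel)
  then show ?thesis unfolding d_def by (simp add: LIM_zero_cancel)
qed

end

section \<open>Real measures acting on regularized vectors\<close>

lemma (in exp_weighted) sum_cells_le:
  assumes "\<And>i. w i \<ge> 0" "\<And>s. w \<lfloor>s * real (Suc n)\<rfloor> \<le> g s" "integrable \<kappa> g"
  shows "(\<Sum>i\<in>mesh n. \<bar>\<integral>t. indicator (cell n i) t * a t \<partial>\<kappa>\<bar> * w i) \<le> (\<integral>t. g t \<partial>\<kappa>)"
proof -
  have [measurable]: "cell n i \<in> sets \<kappa>" for i unfolding sets_kappa by measurable
  have ia: "integrable \<kappa> (\<lambda>t. indicator (cell n i) t * a t)" for i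
    by (rule integrable_const_bound[of _ 1])
      (use weight_le in \<open>auto simp: indicator_def intro!: borel_measurable_times\<close>)
  have ii: "integrable \<kappa> (\<lambda>t. indicator (cell n i) t * w i)" for i
    by (intro integrable_mult_left integrable_real_indicator) (auto simp: less_top[symmetric])
  have le: "\<bar>\<integral>t. indicator (cell n i) t * a t \<partial>\<kappa>\<bar> * w i \<le> (\<integral>t. indicator (cell n i) t * w i \<partial>\<kappa>)" for i
  proof -
    have "\<bar>\<integral>t. indicator (cell n i) t * a t \<partial>\<kappa>\<bar> \<le> (\<integral>t. indicator (cell n i) t \<partial>\<kappa>)"
      unfolding real_norm_def[symmetric]
    proof (rule norm_integral_le[OF _ ia])
      show "norm (indicator (cell n i) t * a t) \<le> indicator (cell n i) t" for t
        using weight_le[of t] by (cases "t \<in> cell n i") auto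
      show "integrable \<kappa> (indicator (cell n i) :: real \<Rightarrow> real)"
        by (rule integrable_real_indicator) (auto simp: less_top[symmetric])
    qed
    from mult_right_mono[OF this assms(1)[of i]] show ?thesis by simp
  qed
  have "(\<Sum>i\<in>mesh n. \<bar>\<integral>t. indicator (cell n i) t * a t \<partial>\<kappa>\<bar> * w i) \<le> (\<Sum>i\<in>mesh n. \<integral>t. indicator (cell n i) t * w i \<partial>\<kappa>)"
    by (intro sum_mono le)
  also have "\<dots> = (\<integral>t. (\<Sum>i\<in>mesh n. indicator (cell n i) t * w i) \<partial>\<kappa>)"
    by (rule Bochner_Integration.integral_sum[symmetric]) (rule ii)
  \<comment> \<open>The cells are disjoint, so at each point the sum has at most one nonzero term,
    the value of \<open>w\<close> at the cell containing \<open>t\<close>.\<close>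
  also have "\<dots> \<le> (\<integral>t. g t \<partial>\<kappa>)"
  proof (rule integral_mono[OF _ assms(3)])
    show "integrable \<kappa> (\<lambda>t. \<Sum>i\<in>mesh n. indicator (cell n i) t * w i)" by (intro Bochner_Integration.integrable_sum ii)
    fix t
    have "(\<Sum>i\<in>mesh n. indicator (cell n i) t * w i) = (\<Sum>i\<in>mesh n. if i = \<lfloor>t * real (Suc n)\<rfloor> then w i else 0)"
      by (intro sum.cong) (auto simp: cell_def)
    also have "\<dots> \<le> w \<lfloor>t * real (Suc n)\<rfloor>" using assms(1) by simp
    also have "\<dots> \<le> g t" by (rule assms(2))
    finally show "(\<Sum>i\<in>mesh n. indicator (cell n i) t * w i) \<le> g t" .
  qed
  finally show ?thesis .
qed

lemma (in exp_weighted) weighted_exp_moment: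
  assumes "0 \<le> c" "c \<le> b"
  shows "(\<integral>\<^sup>+t. ennreal (\<bar>a t\<bar> * exp (c * \<bar>t\<bar>)) \<partial>\<kappa>) < \<infinity>"
proof -
  have "(\<integral>\<^sup>+t. ennreal (\<bar>a t\<bar> * exp (c * \<bar>t\<bar>)) \<partial>\<kappa>) \<le> (\<integral>\<^sup>+t. ennreal (exp (b * \<bar>t\<bar>)) \<partial>\<kappa>)"
  proof (intro nn_integral_mono ennreal_leI)
    fix t
    have "c * \<bar>t\<bar> \<le> b * \<bar>t\<bar>" using assms by (intro mult_right_mono) auto
    then have "\<bar>a t\<bar> * exp (c * \<bar>t\<bar>) \<le> 1 * exp (b * \<bar>t\<bar>)"
      by (intro mult_mono weight_le) auto
    then show "\<bar>a t\<bar> * exp (c * \<bar>t\<bar>) \<le> exp (b * \<bar>t\<bar>)" by simp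
  qed
  then show ?thesis using exp_moment by (rule le_less_trans)
qed

text \<open>The cells and cell weights are those of the Riemann sums for \<open>orbit_int\<close>;
  this is what lets the scalar and the V-valued approximations be matched term by term.\<close>

lemma (in exp_weighted) conv_riemann:
  assumes \<phi>: "continuous_on UNIV \<phi>" "C \<ge> 0" "\<And>t. \<bar>\<phi> t\<bar> \<le> C * exp (- (b * \<bar>t\<bar>))"
  shows "(\<lambda>n. \<Sum>i\<in>mesh n. (\<integral>s. indicator (cell n i) s * a s \<partial>\<kappa>) * \<phi> (t - node n i)) \<longlonglongrightarrow> conv \<kappa> a \<phi> t"
proof -
  have X: "continuous_on UNIV (\<lambda>s. \<phi> (t - s))"
    by (intro continuous_on_compose2[OF \<phi>(1)] continuous_intros) auto
  have bd: "norm (\<phi> (t - s)) \<le> C * exp (- (b * \<bar>t\<bar>)) * exp (b * \<bar>s\<bar>)" for s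
  proof -
    have "C * exp (- (b * \<bar>t - s\<bar>)) \<le> C * (exp (- (b * \<bar>t\<bar>)) * exp (b * \<bar>s\<bar>))"
      by (intro mult_left_mono exp_shift_le b_nonneg \<phi>)
    with \<phi>(3)[of "t - s"] show ?thesis by (simp add: mult_ac)
  qed
  obtain x where x: "has_bochner_int \<kappa> (\<lambda>s. a s *\<^sub>R \<phi> (t - s)) x"
    "(\<lambda>n. \<Sum>i\<in>mesh n. (\<integral>s. indicator (cell n i) s * a s \<partial>\<kappa>) *\<^sub>R \<phi> (t - node n i)) \<longlonglongrightarrow> x"
    by (rule has_bochner_int_riemann[OF sets_kappa weight_measurable X bd b_nonneg weighted_exp_moment[OF b_nonneg order_refl]])
  have "conv \<kappa> a \<phi> t = x"
    using x(1) unfolding conv_def has_bochner_int_iff_has_bochner_integral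
    by (simp add: has_bochner_integral_integral_eq)
  with x(2) show ?thesis by simp
qed

lemma (in exp_weighted) conv_exp_decay:
  assumes "exp_decay b \<phi>"
  shows "exp_decay b (conv \<kappa> a \<phi>)"
proof -
  obtain C where [measurable]: "\<phi> \<in> borel_measurable borel" and C: "C \<ge> 0" "\<And>t. \<bar>\<phi> t\<bar> \<le> C * exp (- (b * \<bar>t\<bar>))"
    using assms by (auto simp: exp_decay_def)
  let ?K = "\<integral>s. exp (b * \<bar>s\<bar>) \<partial>\<kappa>"
  have bd: "\<bar>conv \<kappa> a \<phi> t\<bar> \<le> C * ?K * exp (- (b * \<bar>t\<bar>))" for t
  proof -
    have le: "norm (a s * \<phi> (t - s)) \<le> C * exp (- (b * \<bar>t\<bar>)) * exp (b * \<bar>s\<bar>)" for s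
    proof -
      have "\<bar>a s\<bar> * \<bar>\<phi> (t - s)\<bar> \<le> 1 * (C * exp (- (b * \<bar>t - s\<bar>)))"
        by (intro mult_mono weight_le C) auto
      also have "\<dots> \<le> C * (exp (- (b * \<bar>t\<bar>)) * exp (b * \<bar>s\<bar>))"
        using mult_left_mono[OF exp_shift_le[OF b_nonneg, of t s] C(1)] by simp
      finally show ?thesis by (simp add: abs_mult mult_ac)
    qed
    have i: "integrable \<kappa> (\<lambda>s. C * exp (- (b * \<bar>t\<bar>)) * exp (b * \<bar>s\<bar>))"
      by (intro integrable_mult_right integrable_exp)
    have "integrable \<kappa> (\<lambda>s. a s * \<phi> (t - s))"
    proof (rule Bochner_Integration.integrable_bound[OF i])
      show "AE s in \<kappa>. norm (a s * \<phi> (t - s)) \<le> norm (C * exp (- (b * \<bar>t\<bar>)) * exp (b * \<bar>s\<bar>))"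
        using le C(1) by (intro AE_I2) (simp add: abs_mult)
    qed measurable
    from norm_integral_le[OF le this i] show ?thesis
      unfolding conv_def by (simp add: mult_ac)
  qed
  have "conv \<kappa> a \<phi> \<in> borel_measurable borel"
    unfolding conv_def by measurable
  moreover have "0 \<le> C * ?K" using C(1) by (intro mult_nonneg_nonneg integral_nonneg_AE) auto
  ultimately show ?thesis
    unfolding exp_decay_def using bd by blast
qed

locale weighted_group = bounded_group Z M \<omega> + exp_weighted \<kappa> a b
  for Z :: "real \<Rightarrow> 'v::quaternionic_banach \<Rightarrow> 'v" and M \<omega> \<kappa> a b +
  assumes omega_less: "\<omega> < b"
begin

abbreviation mop :: "'v \<Rightarrow> 'v" where
  "mop \<equiv> orbit_int \<kappa> a"

lemma orbit_weight_kappa: "orbit_weight \<kappa> a"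
  using weighted_exp_moment[OF omega_nonneg less_imp_le[OF omega_less]]
  by (simp add: orbit_weight_def sets_kappa)

lemmas mop_riemann = orbit_int[OF orbit_weight_kappa]
lemmas bounded_linear_mop = bounded_linear_orbit_int[OF orbit_weight_kappa]
lemmas mop_commute = orbit_int_commute[OF orbit_weight_kappa]

text \<open>An interchange of integrals carried out by Riemann sums of the outer one. A Riemann sum
  of \<open>mop (gint \<phi> w)\<close> involves finitely many translates of \<open>\<phi>\<close>,
  hence equals \<open>gint (S n) w\<close> with \<open>S n\<close> a Riemann sum of the convolution;
  the kernels \<open>S n\<close> then converge under a common exponential bound.\<close>

lemma mop_gint:
  assumes \<phi>: "exp_decay b \<phi>" "continuous_on UNIV \<phi>"
  shows "mop (gint \<phi> w) = gint (conv \<kappa> a \<phi>) w"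
proof -
  let ?h = "conv \<kappa> a \<phi>"
  let ?m = "\<lambda>t. M * norm w * exp (\<omega> * \<bar>t\<bar>)"
  obtain C where [measurable]: "\<phi> \<in> borel_measurable borel" and C: "C \<ge> 0" "\<And>t. \<bar>\<phi> t\<bar> \<le> C * exp (- (b * \<bar>t\<bar>))"
    using \<phi>(1) by (auto simp: exp_decay_def)
  define c where "c n i = (\<integral>s. indicator (cell n i) s * a s \<partial>\<kappa>)" for n i
  define S where "S n t = (\<Sum>i\<in>mesh n. c n i * \<phi> (t - node n i))" for n t
  let ?K = "\<integral>s. exp (b * \<bar>s\<bar>) \<partial>\<kappa>"
  let ?C = "C * (exp b * ?K)"
  let ?d = "\<lambda>n t. \<bar>S n t - ?h t\<bar>"
  let ?q = "\<lambda>n t. ?d n t * ?m t"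
  have sh: "exp_decay b (\<lambda>t. \<phi> (t - node n i))" for n i
    using exp_decay_shift[OF b_nonneg \<phi>(1), of "- node n i"] by simp
  have Sdec: "exp_decay b (S n)" for n
    unfolding S_def by (intro exp_decay_sum exp_decay_cmult sh)
  \<comment> \<open>The bound is uniform in \<open>n\<close>: each translate costs
    \<open>exp (b * \<bar>node n i\<bar>)\<close>, and the weighted sum of these costs is controlled
    by the exponential moment of \<kappa>.\<close>
  have Sbd: "\<bar>S n t\<bar> \<le> ?C * exp (- (b * \<bar>t\<bar>))" for n t
  proof -
    have "\<bar>S n t\<bar> \<le> (\<Sum>i\<in>mesh n. \<bar>c n i * \<phi> (t - node n i)\<bar>)"
      unfolding S_def by (rule sum_abs)
    also have "\<dots> \<le> (\<Sum>i\<in>mesh n. C * exp (- (b * \<bar>t\<bar>)) * (\<bar>c n i\<bar> * exp (b * \<bar>node n i\<bar>)))"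
    proof (rule sum_mono)
      fix i
      have "C * exp (- (b * \<bar>t - node n i\<bar>)) \<le> C * (exp (- (b * \<bar>t\<bar>)) * exp (b * \<bar>node n i\<bar>))"
        by (intro mult_left_mono exp_shift_le b_nonneg C)
      with C(2)[of "t - node n i"] have "\<bar>\<phi> (t - node n i)\<bar> \<le> C * (exp (- (b * \<bar>t\<bar>)) * exp (b * \<bar>node n i\<bar>))"
        by linarith
      from mult_left_mono[OF this, of "\<bar>c n i\<bar>"]
      show "\<bar>c n i * \<phi> (t - node n i)\<bar> \<le> C * exp (- (b * \<bar>t\<bar>)) * (\<bar>c n i\<bar> * exp (b * \<bar>node n i\<bar>))"
        by (simp add: abs_mult mult_ac)
    qed
    also have "\<dots> = C * exp (- (b * \<bar>t\<bar>)) * (\<Sum>i\<in>mesh n. \<bar>c n i\<bar> * exp (b * \<bar>node n i\<bar>))"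
      by (simp add: sum_distrib_left)
    finally have 1: "\<bar>S n t\<bar> \<le> C * exp (- (b * \<bar>t\<bar>)) * (\<Sum>i\<in>mesh n. \<bar>c n i\<bar> * exp (b * \<bar>node n i\<bar>))" .
    have "(\<Sum>i\<in>mesh n. \<bar>c n i\<bar> * exp (b * \<bar>node n i\<bar>)) \<le> (\<integral>s. exp b * exp (b * \<bar>s\<bar>) \<partial>\<kappa>)"
      unfolding c_def
    proof (rule sum_cells_le)
      fix s
      have "1 / real (Suc n) \<le> 1" by simp
      then have "\<bar>node n \<lfloor>s * real (Suc n)\<rfloor>\<bar> \<le> \<bar>s\<bar> + 1" using dist_node[of n s] by linarith
      then have "b * \<bar>node n \<lfloor>s * real (Suc n)\<rfloor>\<bar> \<le> b * (\<bar>s\<bar> + 1)"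
        by (rule mult_left_mono[OF _ b_nonneg])
      then show "exp (b * \<bar>node n \<lfloor>s * real (Suc n)\<rfloor>\<bar>) \<le> exp b * exp (b * \<bar>s\<bar>)"
        by (simp add: distrib_left add.commute flip: exp_add del: of_nat_Suc)
    qed (auto intro!: integrable_mult_right integrable_exp)
    also have "(\<integral>s. exp b * exp (b * \<bar>s\<bar>) \<partial>\<kappa>) = exp b * ?K" by (rule integral_mult_right_zero)
    finally have "C * exp (- (b * \<bar>t\<bar>)) * (\<Sum>i\<in>mesh n. \<bar>c n i\<bar> * exp (b * \<bar>node n i\<bar>)) \<le> C * exp (- (b * \<bar>t\<bar>)) * (exp b * ?K)"
      by (rule mult_left_mono) (use C(1) in simp)
    with 1 show ?thesis by (simp only: mult_ac)
  qed
  have Scv: "(\<lambda>n. S n t) \<longlonglongrightarrow> ?h t" for t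
    unfolding S_def c_def by (rule conv_riemann[OF \<phi>(2) C])
  have cdec: "exp_decay b (?h)" by (rule conv_exp_decay[OF \<phi>(1)])
  then obtain C' where C': "C' \<ge> 0" "\<And>t. \<bar>?h t\<bar> \<le> C' * exp (- (b * \<bar>t\<bar>))"
    by (auto simp: exp_decay_def)
  let ?c = "?C + C'"
  let ?u = "\<lambda>t. ?c * M * norm w * exp (- ((b - \<omega>) * \<bar>t\<bar>))"
  have eq: "(\<Sum>i\<in>mesh n. c n i *\<^sub>R Z (- node n i) (gint \<phi> w)) = gint (S n) w" for n
  proof -
    have "Z (- node n i) (gint \<phi> w) = gint (\<lambda>t. \<phi> (t - node n i)) w" for i
      using gint_translate[OF \<phi>(1) omega_less, of "- node n i" w] by simp
    then show ?thesis
      unfolding S_def using gint_sum[of "mesh n" b "\<lambda>i t. \<phi> (t - node n i)" "c n" w, OF sh omega_less] by simp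
  qed
  have nS: "ennreal (norm (gint (S n) w - gint (?h) w)) \<le>
      (\<integral>\<^sup>+t. ennreal (?q n t) \<partial>lborel)" for n
  proof -
    have "ennreal (norm (gint (S n) w - gint (?h) w)) \<le>
      (\<integral>\<^sup>+t. norm (S n t *\<^sub>R Z (- t) w - ?h t *\<^sub>R Z (- t) w) \<partial>lborel)"
      by (rule has_bochner_int_diff_le[OF has_bochner_int_gint[OF Sdec omega_less] has_bochner_int_gint[OF cdec omega_less]])
    also have "\<dots> \<le> (\<integral>\<^sup>+t. ennreal (?q n t) \<partial>lborel)"
    proof (intro nn_integral_mono ennreal_leI)
      fix t
      have "norm (S n t *\<^sub>R Z (- t) w - ?h t *\<^sub>R Z (- t) w) = ?d n t * norm (Z (- t) w)"
        by (simp flip: scaleR_left_diff_distrib)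
      also have "\<dots> \<le> ?q n t"
        by (intro mult_left_mono norm_orbit) simp
      finally show "norm (S n t *\<^sub>R Z (- t) w - ?h t *\<^sub>R Z (- t) w) \<le> ?q n t" .
    qed
    finally show ?thesis .
  qed
  have [measurable]: "S n \<in> borel_measurable borel" "?h \<in> borel_measurable borel" for n
    using Sdec cdec by (auto simp: exp_decay_def)
  have "(\<lambda>n. \<integral>\<^sup>+t. ennreal (?q n t) \<partial>lborel) \<longlonglongrightarrow> (\<integral>\<^sup>+t. 0 \<partial>(lborel :: real measure))"
  proof (rule nn_integral_dominated_convergence[where w="\<lambda>t. ennreal (?u t)"])
    have c0: "?c \<ge> 0" using C(1) C'(1) by (intro add_nonneg_nonneg mult_nonneg_nonneg integral_nonneg_AE) auto
    have "integrable lborel (\<lambda>t. ?u t)"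
      by (intro integrable_mult_right integrable_exp_neg_abs) (use omega_less in simp)
    then have "(\<integral>\<^sup>+t. ennreal (?u t) \<partial>lborel) =
        ennreal (\<integral>t. ?u t \<partial>lborel)"
      by (rule nn_integral_eq_integral) (use c0 M_pos in auto)
    then show "(\<integral>\<^sup>+t. ennreal (?u t) \<partial>lborel) < \<infinity>"
      by (simp only: ennreal_less_top infinity_ennreal_def)
    show "AE t in lborel. ennreal (?q n t) \<le> ennreal (?u t)" for n
    proof (intro AE_I2 ennreal_leI)
      fix t
      have "?d n t \<le> ?c * exp (- (b * \<bar>t\<bar>))"
        using Sbd[of n t] C'(2)[of t] abs_triangle_ineq4[of "S n t" "?h t"]
        unfolding distrib_right by linarith
      then have "?q n t \<le> ?c * exp (- (b * \<bar>t\<bar>)) * ?m t"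
        by (rule mult_right_mono) (use M_pos in auto)
      also have "\<dots> = ?c * M * norm w * (exp (- (b * \<bar>t\<bar>)) * exp (\<omega> * \<bar>t\<bar>))" by (simp only: mult_ac)
      also have "exp (- (b * \<bar>t\<bar>)) * exp (\<omega> * \<bar>t\<bar>) = exp (- ((b - \<omega>) * \<bar>t\<bar>))"
        by (simp add: left_diff_distrib flip: exp_add)
      finally show "?q n t \<le> ?u t" .
    qed
    show "AE t in lborel. (\<lambda>n. ennreal (?q n t)) \<longlonglongrightarrow> 0"
    proof (rule AE_I2)
      fix t
      have "(\<lambda>n. ?q n t) \<longlonglongrightarrow> \<bar>?h t - ?h t\<bar> * ?m t"
        by (intro tendsto_intros Scv)
      then show "(\<lambda>n. ennreal (?q n t)) \<longlonglongrightarrow> 0"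
        using tendsto_ennrealI by fastforce
    qed
  qed simp_all
  then have "(\<lambda>n. \<integral>\<^sup>+t. ennreal (?q n t) \<partial>lborel) \<longlonglongrightarrow> 0" by simp
  from ennreal_tendsto_0_le[OF nS this]
  have "(\<lambda>n. ennreal (norm (gint (S n) w - gint (?h) w))) \<longlonglongrightarrow> ennreal 0" by simp
  then have "(\<lambda>n. norm (gint (S n) w - gint (?h) w)) \<longlonglongrightarrow> 0"
    by (subst (asm) tendsto_ennreal_iff) auto
  then have "(\<lambda>n. gint (S n) w - gint (?h) w) \<longlonglongrightarrow> 0" by (rule tendsto_norm_zero_cancel)
  then have "(\<lambda>n. gint (S n) w) \<longlonglongrightarrow> gint (?h) w" by (simp add: LIM_zero_cancel)
  moreover have "(\<lambda>n. gint (S n) w) \<longlonglongrightarrow> mop (gint \<phi> w)"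
    using mop_riemann(2)[of "gint \<phi> w"] by (simp add: eq flip: c_def)
  ultimately show ?thesis using LIMSEQ_unique by blast
qed

end

section \<open>Polynomials of the generator\<close>

locale group_generator = bounded_group Z M \<omega>
  for Z :: "real \<Rightarrow> 'v::quaternionic_banach \<Rightarrow> 'v" and M \<omega> +
  fixes D :: "'v set" and T :: "'v \<Rightarrow> 'v"
  assumes generator: "is_generator Z D T"
begin

lemma generator_limit: "v \<in> D \<Longrightarrow> ((\<lambda>h. (1 / h) *\<^sub>R (Z h v - v)) \<longlongrightarrow> T v) (at_right 0)"
  using generator unfolding is_generator_def by blast

lemma generatorI:
  assumes "((\<lambda>h. (1 / h) *\<^sub>R (Z h v - v)) \<longlongrightarrow> w) (at_right 0)"
  shows "v \<in> D" "T v = w"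
proof -
  show "v \<in> D" using generator assms unfolding is_generator_def by blast
  then show "T v = w"
    using tendsto_unique[OF trivial_limit_at_right_real generator_limit assms] by blast
qed

lemma generator_commute:
  assumes S: "bounded_linear S" "\<And>h w. S (Z h w) = Z h (S w)" and v: "v \<in> D"
  shows "S v \<in> D" "T (S v) = S (T v)"
proof -
  have "((\<lambda>h. S ((1 / h) *\<^sub>R (Z h v - v))) \<longlongrightarrow> S (T v)) (at_right 0)"
    by (rule bounded_linear.tendsto[OF S(1) generator_limit[OF v]])
  moreover have "S ((1 / h) *\<^sub>R (Z h v - v)) = (1 / h) *\<^sub>R (Z h (S v) - S v)" for h
    using S(1) by (simp add: S(2) linear_scale[OF bounded_linear.linear] linear_diff[OF bounded_linear.linear])
  ultimately have "((\<lambda>h. (1 / h) *\<^sub>R (Z h (S v) - S v)) \<longlongrightarrow> S (T v)) (at_right 0)" by simp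
  then show "S v \<in> D" "T (S v) = S (T v)" by (rule generatorI)+
qed

lemma generator_add:
  assumes "v \<in> D" "w \<in> D"
  shows "v + w \<in> D" "T (v + w) = T v + T w"
proof -
  have "((\<lambda>h. (1 / h) *\<^sub>R (Z h v - v) + (1 / h) *\<^sub>R (Z h w - w)) \<longlongrightarrow> T v + T w) (at_right 0)"
    by (intro tendsto_add generator_limit assms)
  moreover have "(1 / h) *\<^sub>R (Z h v - v) + (1 / h) *\<^sub>R (Z h w - w) = (1 / h) *\<^sub>R (Z h (v + w) - (v + w))" for h
    by (simp add: linear_add[OF Z_linear] algebra_simps)
  ultimately have "((\<lambda>h. (1 / h) *\<^sub>R (Z h (v + w) - (v + w))) \<longlongrightarrow> T v + T w) (at_right 0)" by simp
  then show "v + w \<in> D" "T (v + w) = T v + T w" by (rule generatorI)+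
qed

lemma generator_scaleR:
  assumes "v \<in> D"
  shows "r *\<^sub>R v \<in> D" "T (r *\<^sub>R v) = r *\<^sub>R T v"
proof -
  have "bounded_linear (\<lambda>v::'v. r *\<^sub>R v)" by (rule bounded_linear_scaleR_right)
  from generator_commute[OF this _ assms] show "r *\<^sub>R v \<in> D" "T (r *\<^sub>R v) = r *\<^sub>R T v"
    by (simp_all add: Z_scaleR)
qed

lemma generator_zero: "0 \<in> D" "T 0 = 0"
proof -
  have "((\<lambda>h. (1 / h) *\<^sub>R (Z h 0 - 0)) \<longlongrightarrow> 0) (at_right 0)"
    by (simp add: linear_0[OF Z_linear])
  then show "0 \<in> D" "T 0 = 0" by (rule generatorI)+
qed

lemma generator_diff:
  assumes "v \<in> D" "w \<in> D"
  shows "v - w \<in> D" "T (v - w) = T v - T w"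
  using generator_add[OF assms(1) generator_scaleR(1)[OF assms(2), of "- 1"]]
    generator_scaleR(2)[OF assms(2), of "- 1"] by simp_all

lemma subspace_pow_dom: "subspace (pow_dom D T k)"
proof (induction k)
  case (Suc k)
  then show ?case
    unfolding subspace_def by (auto simp: generator_add generator_scaleR generator_zero)
qed (simp add: subspace_UNIV)

lemma pow_dom_Suc_subset: "pow_dom D T (Suc k) \<subseteq> pow_dom D T k"
proof (induction k)
  case (Suc k)
  then show ?case by auto
qed simp

lemma pow_dom_antimono: "j \<le> k \<Longrightarrow> pow_dom D T k \<subseteq> pow_dom D T j"
  by (induction k rule: dec_induct) (use pow_dom_Suc_subset in blast)+

lemma funpow_commute_on_pow_dom:
  assumes S: "\<And>v. v \<in> D \<Longrightarrow> S v \<in> D \<and> T (S v) = S (T v)"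
  shows "v \<in> pow_dom D T m \<Longrightarrow> S v \<in> pow_dom D T m \<and> (\<forall>k\<le>m. (T ^^ k) (S v) = S ((T ^^ k) v))"
proof (induction m arbitrary: v)
  case (Suc m)
  then have v: "v \<in> D" "T v \<in> pow_dom D T m" by auto
  from Suc.IH[OF v(2)] S[OF v(1)]
  have *: "S v \<in> pow_dom D T (Suc m)" "\<And>k. k \<le> m \<Longrightarrow> (T ^^ k) (S (T v)) = S ((T ^^ k) (T v))" by auto
  have "(T ^^ k) (S v) = S ((T ^^ k) v)" if "k \<le> Suc m" for k
    using that *(2) S[OF v(1)] by (cases k) (auto simp: funpow_swap1)
  with *(1) show ?case by blast
qed simp

lemma poly_op_commute:
  assumes lin: "linear S" and S: "\<And>v. v \<in> D \<Longrightarrow> S v \<in> D \<and> T (S v) = S (T v)"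
    and v: "v \<in> pow_dom D T (degree p)"
  shows "poly_op p T (S v) = S (poly_op p T v)"
  using funpow_commute_on_pow_dom[of S, OF S v]
  by (simp add: poly_op_def linear_sum[OF lin] linear_scale[OF lin])

section \<open>The symbol calculus on regularized vectors\<close>

lemma gint_gauss_pow:
  assumes "\<delta> > 0"
  shows "(T ^^ k) (gint (gauss \<delta> j) w) = gint (gauss \<delta> (j + k)) w"
proof (induction k)
  case (Suc k)
  then show ?case
    using generatorI(2)[OF gint_gauss_quotient[OF assms]] by simp
qed simp

text \<open>The same vector in two forms: the kernel form is compared with the Gaussian itself to
  prove convergence, and the operator form leads to the identity on the domain of the
  polynomial.\<close>

lemma mop_gint_gauss:
  assumes A: "weighted_group Z M \<omega> \<kappa> a b" and B: "weighted_group Z M \<omega> \<kappa>' a' b'"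
    and eq: "\<And>y. lap \<kappa>' a' (Complex 0 y) = cpoly p (Complex 0 y) * lap \<kappa> a (Complex 0 y)"
    and \<delta>: "\<delta> > 0"
  shows "orbit_int \<kappa>' a' (gint (gauss \<delta> 0) w) = gint (exp_weighted.poly_conv \<kappa> a \<delta> p) w"
    and "orbit_int \<kappa>' a' (gint (gauss \<delta> 0) w) =
      orbit_int \<kappa> a (poly_op p T (gint (gauss \<delta> 0) w))"
proof -
  interpret A: weighted_group Z M \<omega> \<kappa> a b by (rule A)
  interpret B: weighted_group Z M \<omega> \<kappa>' a' b' by (rule B)
  note lin = bounded_linear.linear[OF A.bounded_linear_mop]
  have "B.mop (gint (gauss \<delta> 0) w) = gint (conv \<kappa>' a' (gauss \<delta> 0)) w"
    by (rule B.mop_gint[OF exp_decay_gauss[OF \<delta>] continuous_gauss[OF \<delta>]])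
  also have "conv \<kappa>' a' (gauss \<delta> 0) = A.poly_conv \<delta> p"
    by (rule ext, rule conv_eq_poly_conv[OF A.exp_weighted_axioms B.exp_weighted_axioms \<delta> eq])
  finally show 1: "B.mop (gint (gauss \<delta> 0) w) = gint (A.poly_conv \<delta> p) w" .
  also have "\<dots> = (\<Sum>k\<le>degree p. coeff p k *\<^sub>R gint (conv \<kappa> a (gauss \<delta> k)) w)"
    unfolding A.poly_conv_def[abs_def]
    by (rule gint_sum[OF A.conv_exp_decay[OF exp_decay_gauss[OF \<delta>]] A.omega_less])
  also have "\<dots> = (\<Sum>k\<le>degree p. coeff p k *\<^sub>R A.mop (gint (gauss \<delta> k) w))"
    by (simp add: A.mop_gint[OF exp_decay_gauss[OF \<delta>] continuous_gauss[OF \<delta>]])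
  also have "\<dots> = A.mop (poly_op p T (gint (gauss \<delta> 0) w))"
    by (simp add: poly_op_def gint_gauss_pow[OF \<delta>] linear_sum[OF lin] linear_scale[OF lin])
  finally show "B.mop (gint (gauss \<delta> 0) w) = A.mop (poly_op p T (gint (gauss \<delta> 0) w))" .
qed

text \<open>The vector is approximated by its Gaussian regularizations. The polynomial of
  \<open>T\<close> is unbounded, so it is first moved past \<open>?E n\<close>; only bounded
  operators are then taken to the limit.\<close>

lemma mop_poly_op:
  assumes A: "weighted_group Z M \<omega> \<kappa> a b" and B: "weighted_group Z M \<omega> \<kappa>' a' b'"
    and eq: "\<And>y. lap \<kappa>' a' (Complex 0 y) = cpoly p (Complex 0 y) * lap \<kappa> a (Complex 0 y)"
    and v: "v \<in> pow_dom D T (degree p)"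
  shows "orbit_int \<kappa>' a' v = orbit_int \<kappa> a (poly_op p T v)"
proof -
  interpret A: weighted_group Z M \<omega> \<kappa> a b by (rule A)
  interpret B: weighted_group Z M \<omega> \<kappa>' a' b' by (rule B)
  define d where "d n = 1 / real (Suc n)" for n
  have d: "d n > 0" for n by (simp add: d_def)
  let ?E = "\<lambda>n. gint (gauss (d n) 0)"
  have E: "?E n w \<in> D \<and> T (?E n w) = ?E n (T w)" if "w \<in> D" for n w
    using generator_commute[OF bounded_linear_gint[OF exp_decay_gauss[OF d] A.omega_less]
        gint_commute[OF exp_decay_gauss[OF d] A.omega_less] that] by blast
  have lin: "linear (?E n)" for n
    by (rule bounded_linear.linear[OF bounded_linear_gint[OF exp_decay_gauss[OF d] A.omega_less]])
  have "(\<lambda>n. B.mop (?E n v)) \<longlonglongrightarrow> B.mop v"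
    unfolding d_def by (rule bounded_linear.tendsto[OF B.bounded_linear_mop gint_gauss_tendsto])
  moreover have "B.mop (?E n v) = A.mop (?E n (poly_op p T v))" for n
    using mop_gint_gauss(2)[OF A B eq d] poly_op_commute[OF lin E v] by simp
  moreover have "(\<lambda>n. A.mop (?E n (poly_op p T v))) \<longlonglongrightarrow> A.mop (poly_op p T v)"
    unfolding d_def by (rule bounded_linear.tendsto[OF A.bounded_linear_mop gint_gauss_tendsto])
  ultimately show ?thesis using LIMSEQ_unique by simp
qed

lemma mop_tendsto_id:
  assumes A: "weighted_group Z M \<omega> \<kappa> a b"
    and B: "\<And>n. weighted_group Z M \<omega> (\<kappa>' n) (a' n) (b' n)"
    and eq: "\<And>n y. lap (\<kappa>' n) (a' n) (Complex 0 y) =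
      cpoly (P n) (Complex 0 y) * lap \<kappa> a (Complex 0 y)"
    and bd: "\<And>n z. \<bar>Re z\<bar> \<le> b \<Longrightarrow> cmod (cpoly (P n) z * lap \<kappa> a z) \<le> K"
    and lim: "\<And>z. \<bar>Re z\<bar> \<le> b \<Longrightarrow> (\<lambda>n. cpoly (P n) z * lap \<kappa> a z) \<longlonglongrightarrow> 1"
    and on: "\<And>n. onorm (orbit_int (\<kappa>' n) (a' n)) \<le> K'"
  shows "(\<lambda>n. orbit_int (\<kappa>' n) (a' n) v) \<longlonglongrightarrow> v"
proof -
  interpret A: weighted_group Z M \<omega> \<kappa> a b by (rule A)
  define N where "N n = orbit_int (\<kappa>' n) (a' n)" for n
  have bl: "bounded_linear (N n)" for n unfolding N_def by (rule weighted_group.bounded_linear_mop[OF B])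
  have Nle: "norm (N n w) \<le> K' * norm w" for n w
    using order_trans[OF onorm[OF bl] mult_right_mono[OF on[of n, folded N_def]]] by simp
  have K': "K' \<ge> 0" using order_trans[OF onorm_pos_le[OF bl] on[of 0, folded N_def]] .
  have reg: "(\<lambda>n. N n (gint (gauss \<delta> 0) w) - gint (gauss \<delta> 0) w) \<longlonglongrightarrow> 0" if \<delta>: "\<delta> > 0" for \<delta> w
  proof -
    obtain e where e: "e \<longlonglongrightarrow> 0" "\<And>n r. \<bar>A.poly_conv \<delta> (P n) r - gauss \<delta> 0 r\<bar> \<le> e n * exp (- (b * \<bar>r\<bar>))"
      using A.poly_conv_tendsto_gauss[OF \<delta> bd lim] by blast
    have pdec: "exp_decay b (A.poly_conv \<delta> (P n))" for n
      unfolding A.poly_conv_def[abs_def]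
      by (intro exp_decay_sum exp_decay_cmult A.conv_exp_decay exp_decay_gauss \<delta>)
    let ?c = "M * norm w * (\<integral>t. exp (- ((b - \<omega>) * \<bar>t\<bar>)) \<partial>lborel)"
    have le: "norm (N n (gint (gauss \<delta> 0) w) - gint (gauss \<delta> 0) w) \<le> e n * ?c" for n
      unfolding N_def mop_gint_gauss(1)[OF A B eq \<delta>]
      by (rule gint_diff_le[OF pdec exp_decay_gauss[OF \<delta>] A.omega_less A.omega_less A.omega_less e(2)])
    have "(\<lambda>n. e n * ?c) \<longlonglongrightarrow> 0" by (rule tendsto_mult_left_zero[OF e(1)])
    then show ?thesis by (rule Lim_null_comparison[OF always_eventually[OF allI[OF le]]])
  qed
  have "(\<lambda>n. N n v) \<longlonglongrightarrow> v"
  proof (rule LIMSEQ_I)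
    fix r :: real assume r: "r > 0"
    \<comment> \<open>With \<open>x\<close> the regularized vector, the error at \<open>v\<close> is
      the error at \<open>x\<close> plus a term of norm at most
      \<open>(K' + 1) * norm (x - v)\<close>; each part receives \<open>r / 2\<close>.\<close>
    define \<eta> where "\<eta> = r / 2 / (K' + 1)"
    have \<eta>: "\<eta> > 0" using r K' by (simp add: \<eta>_def)
    obtain j where j: "norm (gint (gauss (1 / real (Suc j)) 0) v - v) < \<eta>"
      using LIMSEQ_D[OF gint_gauss_tendsto[of v] \<eta>] by blast
    define x where "x = gint (gauss (1 / real (Suc j)) 0) v"
    obtain n0 where n0: "\<And>n. n \<ge> n0 \<Longrightarrow> norm (N n x - x) < r / 2"
      using LIMSEQ_D[OF reg[of "1 / real (Suc j)" v], of "r / 2"] r unfolding x_def by auto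
    show "\<exists>n0. \<forall>n\<ge>n0. norm (N n v - v) < r"
    proof (intro exI[of _ n0] allI impI)
      fix n assume n: "n \<ge> n0"
      have "N n v - v = (N n x - x) + ((x - v) - N n (x - v))"
        by (simp add: linear_diff[OF bounded_linear.linear[OF bl]])
      also have "norm \<dots> \<le> norm (N n x - x) + (norm (x - v) + norm (N n (x - v)))"
        by (rule order_trans[OF norm_triangle_ineq add_left_mono[OF norm_triangle_ineq4]])
      also have "\<dots> \<le> norm (N n x - x) + (K' + 1) * norm (x - v)"
        using Nle[of n "x - v"] by (simp add: distrib_right)
      also have "\<dots> < r / 2 + (K' + 1) * \<eta>"
        using n0[OF n] j K' by (intro add_strict_mono mult_strict_left_mono) (auto simp: x_def)
      also have "(K' + 1) * \<eta> = r / 2"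
      proof -
        have "K' + 1 \<noteq> 0" using K' by simp
        from nonzero_eq_divide_eq[THEN iffD1, OF this \<eta>_def] show ?thesis by (simp only: mult.commute)
      qed
      finally show "norm (N n v - v) < r" by simp
    qed
  qed
  then show ?thesis by (simp add: N_def)
qed

end

section \<open>Moving a polynomial of the generator in front by a resolvent\<close>

text \<open>With \<open>Q w = w + \<rho> R w = T (R w)\<close>, applying \<open>P[T]\<close> to \<open>R\<^sup>m x\<close>
  gives \<open>p\<^sub>m Q\<^sup>m x\<close> plus terms in the range of \<open>R\<close>; since \<open>Q\<^sup>m x - x\<close> is also in
  that range, this trades one factor \<open>R\<close> for one more degree of smoothness of \<open>x\<close>.\<close>
locale generator_resolvent = group_generator Z M \<omega> D T
  for Z :: "real \<Rightarrow> 'v::quaternionic_banach \<Rightarrow> 'v" and M \<omega> D T +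
  fixes R :: "'v \<Rightarrow> 'v" and \<rho> :: real
  assumes R_dom: "\<And>w. R w \<in> D" and T_R: "\<And>w. T (R w) = w + \<rho> *\<^sub>R R w"
    and R_T: "\<And>v. v \<in> D \<Longrightarrow> R (T v - \<rho> *\<^sub>R v) = v"
begin

lemma R_eqI: "v \<in> D \<Longrightarrow> T v - \<rho> *\<^sub>R v = w \<Longrightarrow> R w = v"
  using R_T by blast

text \<open>\<open>R\<close> inverts T - \<rho> on \<open>D\<close>, so linearity is inherited from
  \<open>T\<close> through uniqueness of the preimage.\<close>

lemma R_linear: "linear R"
proof (rule linearI)
  show "R (x + y) = R x + R y" for x y
    by (rule R_eqI) (simp_all add: generator_add R_dom T_R algebra_simps)
  show "R (r *\<^sub>R x) = r *\<^sub>R R x" for r x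
    by (rule R_eqI) (simp_all add: generator_scaleR R_dom T_R algebra_simps)
qed

lemma R_inj: "R x = R y \<Longrightarrow> x = y"
  by (metis T_R add_right_cancel)

lemma R_commute: "v \<in> D \<Longrightarrow> R v \<in> D \<and> T (R v) = R (T v)"
proof -
  assume v: "v \<in> D"
  have "R (T v) = R ((T v - \<rho> *\<^sub>R v) + \<rho> *\<^sub>R v)" by simp
  also have "\<dots> = v + \<rho> *\<^sub>R R v"
    by (simp only: linear_add[OF R_linear] linear_scale[OF R_linear] R_T[OF v])
  finally show ?thesis by (simp add: R_dom T_R)
qed

definition Q :: "'v \<Rightarrow> 'v" where
  "Q w = w + \<rho> *\<^sub>R R w"

lemma Q_R: "Q (R w) = R (Q w)"
  by (simp add: Q_def linear_add[OF R_linear] linear_scale[OF R_linear])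

lemma Q_pow_R: "(Q ^^ k) (R w) = R ((Q ^^ k) w)"
  by (induction k) (simp_all add: Q_R)

lemma R_pow_dom: "v \<in> pow_dom D T k \<Longrightarrow> R v \<in> pow_dom D T (Suc k)"
proof (induction k arbitrary: v)
  case (Suc k)
  have "v \<in> pow_dom D T k" using Suc.prems pow_dom_Suc_subset by blast
  then have "\<rho> *\<^sub>R R v \<in> pow_dom D T (Suc k)"
    by (intro subspace_scale[OF subspace_pow_dom] Suc.IH)
  then have "v + \<rho> *\<^sub>R R v \<in> pow_dom D T (Suc k)"
    using Suc.prems by (intro subspace_add[OF subspace_pow_dom])
  then show ?case by (simp add: R_dom T_R)
qed (simp add: R_dom)

lemma R_pow_dom': "v \<in> pow_dom D T k \<Longrightarrow> R v \<in> pow_dom D T k"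
  using R_pow_dom pow_dom_Suc_subset by blast

lemma R_pow_pow_dom: "(R ^^ m) v \<in> pow_dom D T m"
proof (induction m)
  case (Suc m)
  from R_pow_dom[OF this] show ?case by (simp del: pow_dom.simps)
qed simp

lemma R_pow_preserves: "v \<in> pow_dom D T k \<Longrightarrow> (R ^^ m) v \<in> pow_dom D T k"
  by (induction m) (simp_all add: R_pow_dom')

lemma Q_pow_preserves: "v \<in> pow_dom D T k \<Longrightarrow> (Q ^^ m) v \<in> pow_dom D T k"
proof (induction m)
  case (Suc m)
  then show ?case
    unfolding funpow.simps comp_def Q_def
    by (intro subspace_add[OF subspace_pow_dom] subspace_scale[OF subspace_pow_dom] R_pow_dom') auto
qed simp

lemma Q_pow_diff: "v \<in> pow_dom D T k \<Longrightarrow> (Q ^^ m) v - v \<in> pow_dom D T (Suc k)"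
proof (induction m)
  case 0
  show ?case using subspace_0[OF subspace_pow_dom] by (simp del: pow_dom.simps)
next
  case (Suc m)
  have "(Q ^^ Suc m) v - v = ((Q ^^ m) v - v) + \<rho> *\<^sub>R R ((Q ^^ m) v)" by (simp add: Q_def)
  also have "\<dots> \<in> pow_dom D T (Suc k)"
    using Suc by (intro subspace_add[OF subspace_pow_dom] subspace_scale[OF subspace_pow_dom] R_pow_dom
        Q_pow_preserves) auto
  finally show ?case .
qed

text \<open>Each \<open>T\<close> consumes one \<open>R\<close> and leaves the everywhere defined
  operator \<open>Q\<close>.\<close>

lemma T_pow_R_pow: "k \<le> m \<Longrightarrow> (T ^^ k) ((R ^^ m) w) = (Q ^^ k) ((R ^^ (m - k)) w)"
proof (induction k)
  case (Suc k)
  then have "m - k = Suc (m - Suc k)" by simp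
  then have "(T ^^ Suc k) ((R ^^ m) w) = T (R ((Q ^^ k) ((R ^^ (m - Suc k)) w)))"
    using Suc by (simp add: Q_pow_R)
  then show ?case
    by (simp only: T_R funpow.simps comp_apply Q_def[of "(Q ^^ k) ((R ^^ (m - Suc k)) w)"])
qed simp

lemma poly_op_R_pow:
  "poly_op p T ((R ^^ degree p) w) = (\<Sum>k\<le>degree p. coeff p k *\<^sub>R (Q ^^ k) ((R ^^ (degree p - k)) w))"
  unfolding poly_op_def by (intro sum.cong) (simp_all add: T_pow_R_pow)

text \<open>The hypothesis on \<open>G\<close> and \<open>F\<close> is applied to
  \<open>(R ^^ degree p) u\<close>, which lies in the domain for every \<open>u\<close>. The
  resulting identity \<open>main\<close> for \<open>F u\<close> involves only everywhere defined
  operators. Solved for its leading term it raises the smoothness of \<open>F u\<close> one degree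
  at a time; once the domain is reached, injectivity of the power of \<open>R\<close> removes it
  from both sides.\<close>

lemma poly_op_via_resolvent:
  assumes F: "linear F" "\<And>w. F (R w) = R (F w)" and G: "\<And>w. G (R w) = R (G w)"
    and GF: "\<And>v. v \<in> pow_dom D T (degree p) \<Longrightarrow> G v = F (poly_op p T v)"
  shows "F u \<in> pow_dom D T (degree p)" "poly_op p T (F u) = G u"
proof -
  let ?m = "degree p"
  define x where "x = F u"
  define y where "y = G u"
  have FR: "F ((R ^^ j) w) = (R ^^ j) (F w)" for j w by (induction j) (simp_all add: F(2))
  have GR: "G ((R ^^ j) w) = (R ^^ j) (G w)" for j w by (induction j) (simp_all add: G)
  have FQ: "F ((Q ^^ j) w) = (Q ^^ j) (F w)" for j w
    by (induction j) (simp_all add: Q_def linear_add[OF F(1)] linear_scale[OF F(1)] F(2))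
  have main: "(R ^^ ?m) y = (\<Sum>k\<le>?m. coeff p k *\<^sub>R (Q ^^ k) ((R ^^ (?m - k)) x))"
  proof -
    have "(R ^^ ?m) y = F (poly_op p T ((R ^^ ?m) u))"
      unfolding y_def GR[symmetric] by (rule GF[OF R_pow_pow_dom])
    then show ?thesis
      by (simp add: poly_op_R_pow linear_sum[OF F(1)] linear_scale[OF F(1)] FQ FR x_def)
  qed
  have "x \<in> pow_dom D T j" if "j \<le> ?m" for j
    using that
  proof (induction j)
    case (Suc j)
    then have xj: "x \<in> pow_dom D T j" and j: "j < ?m" by auto
    note sub = subspace_pow_dom[of "Suc j"]
    \<comment> \<open>Below the top degree at least one factor \<open>R\<close> is left, and it
      gains one degree of smoothness over \<open>x\<close>.\<close>
    have "(\<Sum>k<?m. coeff p k *\<^sub>R (Q ^^ k) ((R ^^ (?m - k)) x)) \<in> pow_dom D T (Suc j)"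
    proof (intro subspace_sum[OF sub] subspace_scale[OF sub] Q_pow_preserves)
      fix k assume "k \<in> {..<?m}"
      then have "?m - k = Suc (?m - k - 1)" by auto
      then have "(R ^^ (?m - k)) x = R ((R ^^ (?m - k - 1)) x)" by (metis funpow.simps(2) comp_apply)
      then show "(R ^^ (?m - k)) x \<in> pow_dom D T (Suc j)"
        using R_pow_dom[OF R_pow_preserves[OF xj]] by simp
    qed
    moreover have "(R ^^ ?m) y \<in> pow_dom D T (Suc j)"
      using R_pow_pow_dom pow_dom_antimono[of "Suc j" ?m] j by (meson Suc_leI subsetD)
    moreover have "coeff p ?m *\<^sub>R ((Q ^^ ?m) x - x) \<in> pow_dom D T (Suc j)"
      by (intro subspace_scale[OF sub] Q_pow_diff xj)
    ultimately have "(R ^^ ?m) y - (\<Sum>k<?m. coeff p k *\<^sub>R (Q ^^ k) ((R ^^ (?m - k)) x))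
        - coeff p ?m *\<^sub>R ((Q ^^ ?m) x - x) \<in> pow_dom D T (Suc j)"
      by (intro subspace_diff[OF sub])
    also have "(R ^^ ?m) y - (\<Sum>k<?m. coeff p k *\<^sub>R (Q ^^ k) ((R ^^ (?m - k)) x))
        - coeff p ?m *\<^sub>R ((Q ^^ ?m) x - x) = coeff p ?m *\<^sub>R x"
      unfolding main by (simp add: lessThan_Suc_atMost[symmetric] scaleR_diff_right)
    finally have "(1 / coeff p ?m) *\<^sub>R coeff p ?m *\<^sub>R x \<in> pow_dom D T (Suc j)"
      by (rule subspace_scale[OF sub])
    \<comment> \<open>The step is taken only for \<open>j\<close> below the degree, so
      \<open>p\<close> is nonzero; for degree 0, including the zero polynomial, the domain is the
      whole space.\<close>
    moreover have "coeff p ?m \<noteq> 0" using j by auto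
    ultimately show ?case by (simp del: pow_dom.simps)
  qed simp
  then have x: "x \<in> pow_dom D T ?m" by simp
  then show "F u \<in> pow_dom D T (degree p)" by (simp add: x_def)
  have Rp: "(R ^^ j) v \<in> D \<and> T ((R ^^ j) v) = (R ^^ j) (T v)" if "v \<in> D" for j v
    by (induction j) (use R_commute that in auto)
  have Rl: "linear (R ^^ j)" for j
  proof (induction j)
    case (Suc j)
    from linear_compose[OF this R_linear] show ?case by (simp add: comp_def)
  qed (simp add: linear_id[unfolded id_def])
  have "(R ^^ ?m) (poly_op p T x) = poly_op p T ((R ^^ ?m) x)"
    by (rule poly_op_commute[OF Rl Rp x, symmetric])
  also have "\<dots> = (R ^^ ?m) y" by (simp add: poly_op_R_pow main)
  finally have eq: "(R ^^ ?m) (poly_op p T x) = (R ^^ ?m) y" .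
  have inj: "(R ^^ j) v = (R ^^ j) w \<Longrightarrow> v = w" for j v w
    by (induction j) (auto dest: R_inj)
  show "poly_op p T (F u) = G u" using inj[OF eq] by (simp add: x_def y_def)
qed

end

text \<open>The square root \<open>(T - \<omega>)\<^sup>-\<^sup>1\<close> of the pseudo-resolvent at the real point \<open>\<omega>\<close>; it need not be known
  to be bounded.\<close>
lemma (in group_generator) resolvent_exists:
  assumes "of_real \<omega> \<in> S_resolvent_set D T"
  obtains R where "generator_resolvent Z M \<omega> D T R \<omega>"
proof -
  let ?s = "of_real \<omega> :: quaternion"
  have Q: "Q_op T ?s v = T (T v) - (2 * \<omega>) *\<^sub>R T v + \<omega>\<^sup>2 *\<^sub>R v" for v
    by (simp add: Q_op_def of_real_def)
  obtain B where inj: "inj_on (Q_op T ?s) (pow_dom D T 2)"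
    and B: "\<And>w. B w \<in> pow_dom D T 2" "\<And>w. Q_op T ?s (B w) = w"
    using assms unfolding S_resolvent_set_def by blast
  have BD: "B w \<in> D" "T (B w) \<in> D" for w using B(1)[of w] by (simp_all add: numeral_2_eq_2)
  \<comment> \<open>At the real point \<omega> the operator \<open>Q_op\<close> is the square of T -
    \<omega>, so applying T - \<omega> to its inverse \<open>B\<close> yields a right inverse of T -
    \<omega>.\<close>
  define R where "R w = T (B w) - \<omega> *\<^sub>R B w" for w
  have RD: "R w \<in> D" for w unfolding R_def by (intro generator_diff generator_scaleR BD)
  have TR: "T (R w) = w + \<omega> *\<^sub>R R w" for w
  proof -
    have "T (R w) = T (T (B w)) - \<omega> *\<^sub>R T (B w)"
      unfolding R_def by (simp add: generator_diff generator_scaleR BD)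
    moreover have "w = T (T (B w)) - (2 * \<omega>) *\<^sub>R T (B w) + \<omega>\<^sup>2 *\<^sub>R B w" using B(2)[of w] Q by simp
    moreover have "(2 * \<omega>) *\<^sub>R T (B w) = \<omega> *\<^sub>R T (B w) + \<omega> *\<^sub>R T (B w)"
      by (simp only: mult_2 scaleR_add_left)
    moreover have "\<omega> *\<^sub>R R w = \<omega> *\<^sub>R T (B w) - \<omega>\<^sup>2 *\<^sub>R B w"
      by (simp add: R_def scaleR_diff_right power2_eq_square)
    moreover have "x = c - (a + a) + d \<Longrightarrow> c - a = x + (a - d)" for x a c d :: 'v
      by (simp add: algebra_simps)
    ultimately show ?thesis by metis
  qed
  have RT: "R (T v - \<omega> *\<^sub>R v) = v" if v: "v \<in> D" for v
  proof -
    \<comment> \<open>That \<open>R\<close> is also a left inverse follows from injectivity: this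
      difference is annihilated by T - \<omega>, hence by \<open>Q_op\<close>.\<close>
    let ?z = "R (T v - \<omega> *\<^sub>R v) - v"
    have z: "?z \<in> D" "T ?z = \<omega> *\<^sub>R ?z"
    proof -
      show "?z \<in> D" by (rule generator_diff(1)[OF RD v])
      show "T ?z = \<omega> *\<^sub>R ?z"
        unfolding generator_diff(2)[OF RD v] TR by (simp add: scaleR_diff_right)
    qed
    then have "?z \<in> pow_dom D T 2" by (simp add: numeral_2_eq_2 generator_scaleR)
    moreover have "Q_op T ?s ?z = Q_op T ?s 0"
    proof -
      have "T (T ?z) = \<omega> *\<^sub>R \<omega> *\<^sub>R ?z" using generator_scaleR(2)[OF z(1), of \<omega>] by (simp only: z(2))
      then have "Q_op T ?s ?z = (\<omega> * \<omega> - 2 * \<omega> * \<omega> + \<omega>\<^sup>2) *\<^sub>R ?z"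
        unfolding Q z(2) by (simp only: scaleR_add_left scaleR_diff_left scaleR_scaleR)
      moreover have "Q_op T ?s 0 = 0" unfolding Q by (simp add: generator_zero)
      ultimately show ?thesis by (simp add: power2_eq_square)
    qed
    moreover have "0 \<in> pow_dom D T 2" by (rule subspace_0[OF subspace_pow_dom])
    ultimately have "?z = 0" using inj by (meson inj_onD)
    then show ?thesis by simp
  qed
  show ?thesis
    by (rule that[of R]) (unfold_locales; fact RD TR RT)
qed

lemma (in generator_resolvent) bounded_commute_R:
  assumes "bounded_linear S" "\<And>h w. S (Z h w) = Z h (S w)"
  shows "S (R w) = R (S w)"
proof (rule R_eqI[symmetric])
  note S = generator_commute[OF assms R_dom, of w] and lin = bounded_linear.linear[OF assms(1)]
  show "S (R w) \<in> D" by (rule S)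
  show "T (S (R w)) - \<rho> *\<^sub>R S (R w) = S w"
    by (simp add: S T_R linear_add[OF lin] linear_scale[OF lin])
qed

section \<open>Inverting sequences\<close>

text \<open>The quaternionic integrand agrees with its real form only almost everywhere, so its
  strong measurability is established separately, from the joint continuity of left
  multiplication.\<close>

lemma strongly_measurable_qleft:
  assumes "strongly_measurable M f" "strongly_measurable M g"
  shows "strongly_measurable M (\<lambda>t. qleft (f t) (g t :: 'v::quaternionic_banach))"
proof (rule strongly_measurable_compose2[OF assms])
  fix u :: "nat \<Rightarrow> quaternion" and v :: "nat \<Rightarrow> 'v" and a b
  assume uv: "u \<longlonglongrightarrow> a" "v \<longlonglongrightarrow> b"
  have add: "qleft c (x - y) = qleft c x - qleft c y" for c and x y :: 'v
    using qleft_add_right[of c "x - y" y] by simp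
  have add': "qleft (c - d) x = qleft c x - qleft d x" for c d and x :: 'v
    using qleft_add_left[of "c - d" d x] by simp
  have "(\<lambda>i. norm (u i) * norm (v i - b) + norm (u i - a) * norm b) \<longlonglongrightarrow> norm a * norm (b - b) + norm (a - a) * norm b"
    by (intro tendsto_intros uv)
  then have lim: "(\<lambda>i. norm (u i) * norm (v i - b) + norm (u i - a) * norm b) \<longlonglongrightarrow> 0" by simp
  have le: "norm (qleft (u i) (v i) - qleft a b) \<le> norm (u i) * norm (v i - b) + norm (u i - a) * norm b" for i
  proof -
    have "qleft (u i) (v i) - qleft a b = qleft (u i) (v i - b) + qleft (u i - a) b"
      by (simp add: add add')
    then show ?thesis using norm_triangle_ineq[of "qleft (u i) (v i - b)" "qleft (u i - a) b"]
      by (simp add: norm_qleft)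
  qed
  have "(\<lambda>i. qleft (u i) (v i) - qleft a b) \<longlonglongrightarrow> 0"
    by (rule Lim_null_comparison[OF always_eventually[OF allI[OF le]] lim])
  then show "(\<lambda>i. qleft (u i) (v i)) \<longlonglongrightarrow> qleft a b" by (simp add: LIM_zero_cancel)
qed

text \<open>Symmetry on the imaginary axis of three slices forces the measure to be real; a real measure
  acts by real scalars, which commute with the group.\<close>
lemma (in bounded_group) real_symbol:
  assumes \<mu>: "\<mu> \<in> S_class \<omega>" and f: "laplace_on \<omega> \<epsilon> \<mu> f"
    and sym: "\<forall>u\<in>imaginary_units. \<forall>y.
      f (slice u (cnj (\<i> * of_real y))) = qcnj (f (slice u (\<i> * of_real y)))"
    and b: "\<omega> < b" "b < \<omega> + \<epsilon>"
  defines "\<kappa> \<equiv> variation \<mu>" and "a \<equiv> \<lambda>t. qRe (polar \<mu> t)"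
  shows "weighted_group Z M \<omega> \<kappa> a b"
    and "\<And>u z. u \<in> imaginary_units \<Longrightarrow> \<bar>Re z\<bar> \<le> b \<Longrightarrow> f (slice u z) = slice u (lap \<kappa> a z)"
    and "measure_op Z \<mu> = orbit_int \<kappa> a"
proof -
  have qm: "quaternionic_measure \<mu>" using \<mu> by (simp add: S_class_def)
  have \<epsilon>: "\<epsilon> > 0" and mom: "(\<integral>\<^sup>+t. ennreal (exp ((\<omega> + \<epsilon>) * \<bar>t\<bar>)) \<partial>\<kappa>) < \<infinity>"
    and fl: "\<And>s. \<bar>qRe s\<bar> < \<omega> + \<epsilon> \<Longrightarrow> f s = laplace \<mu> s"
    using f by (auto simp: laplace_on_def exp_moment_finite_def \<kappa>_def)
  have sets: "sets \<kappa> = sets borel" by (simp add: \<kappa>_def)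
  have momb: "(\<integral>\<^sup>+t. ennreal (exp (b * \<bar>t\<bar>)) \<partial>\<kappa>) < \<infinity>"
  proof (rule le_less_trans[OF nn_integral_mono mom])
    fix t
    have "b * \<bar>t\<bar> \<le> (\<omega> + \<epsilon>) * \<bar>t\<bar>" using b by (intro mult_right_mono) auto
    then show "ennreal (exp (b * \<bar>t\<bar>)) \<le> ennreal (exp ((\<omega> + \<epsilon>) * \<bar>t\<bar>))" by (intro ennreal_leI) simp
  qed
  have fin: "finite_measure (variation \<mu>)"
  proof
    have "emeasure \<kappa> (space \<kappa>) = (\<integral>\<^sup>+t. 1 \<partial>\<kappa>)" by simp
    also have "\<dots> \<le> (\<integral>\<^sup>+t. ennreal (exp (b * \<bar>t\<bar>)) \<partial>\<kappa>)"
      by (intro nn_integral_mono) (use b omega_nonneg in simp)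
    finally show "emeasure (variation \<mu>) (space (variation \<mu>)) \<noteq> \<infinity>" using momb by (auto simp: \<kappa>_def)
  qed
  note p = borel_measurable_polar[OF qm fin] norm_polar[OF qm fin]
  have am: "a \<in> borel_measurable borel"
  proof -
    have "qRe \<in> borel_measurable borel"
      by (intro borel_measurable_continuous_onI bounded_linear.continuous_on[OF bounded_linear_quaternion_parts(1)] continuous_on_id)
    then show ?thesis unfolding a_def using p(1) by measurable
  qed
  have axis: "\<bar>qRe (slice u z)\<bar> < \<omega> + \<epsilon>" if "u \<in> imaginary_units" "\<bar>Re z\<bar> \<le> b" for u z
    using that b by (simp add: qRe_slice del: insert_iff)
  have "laplace \<mu> (slice u (cnj (\<i> * of_real y))) = qcnj (laplace \<mu> (slice u (\<i> * of_real y)))"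
    if "u \<in> imaginary_units" for u y
    using bspec[OF sym that, THEN spec, of y] fl[OF axis[OF that]] b omega_nonneg by simp
  from polar_real[OF p fin sets_variation this]
  have ae: "AE t in \<kappa>. polar \<mu> t = of_real (a t)" unfolding \<kappa>_def a_def .
  have a1: "\<bar>a t\<bar> \<le> 1" for t unfolding a_def using norm_quaternion_ge(1)[of "polar \<mu> t"] p(2)[of t] by simp
  show wg: "weighted_group Z M \<omega> \<kappa> a b"
    by (unfold_locales; (fact sets am a1 momb)?) (use b omega_nonneg in auto)
  interpret weighted_group Z M \<omega> \<kappa> a b by (rule wg)
  show "f (slice u z) = slice u (lap \<kappa> a z)" if "u \<in> imaginary_units" "\<bar>Re z\<bar> \<le> b" for u z
    using fl[OF axis[OF that]] laplace_slice[OF that(1) p(1) ae[unfolded \<kappa>_def] integrable_weight_exp[OF that(2), unfolded \<kappa>_def] sets_variation]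
    by (simp add: \<kappa>_def)
  show "measure_op Z \<mu> = mop"
  proof
    fix v
    have "has_bochner_int \<kappa> (\<lambda>t. qleft (polar \<mu> t) (Z (- t) v)) (mop v)"
    proof (rule has_bochner_int_AE[OF mop_riemann(1)])
      have "polar \<mu> \<in> borel_measurable \<kappa>" using p(1) measurable_cong_sets[OF sets refl] by blast
      then show "strongly_measurable \<kappa> (\<lambda>t. qleft (polar \<mu> t) (Z (- t) v))"
        by (intro strongly_measurable_qleft strongly_measurable_borel
            strongly_measurable_continuous[OF sets continuous_orbit])
      show "AE t in \<kappa>. a t *\<^sub>R Z (- t) v = qleft (polar \<mu> t) (Z (- t) v)"
        using ae by eventually_elim (simp add: qleft_of_real)
    qed
    then show "measure_op Z \<mu> v = mop v" unfolding measure_op_def \<kappa>_def by (rule bochner_int_eqI)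
  qed
qed

text \<open>The measure inside \<open>fun_calc\<close> is an unspecified choice. Exposing it
  together with an admissible width lets the rest of the argument refer to that very
  measure.\<close>

lemma V_class_representative:
  assumes "f \<in> V_class \<omega>"
  obtains \<mu> \<epsilon> where "\<mu> \<in> S_class \<omega>" "laplace_on \<omega> \<epsilon> \<mu> f" "fun_calc \<omega> Z f = measure_op Z \<mu>"
proof -
  let ?P = "\<lambda>\<mu>. \<mu> \<in> S_class \<omega> \<and> (\<exists>\<epsilon>. laplace_on \<omega> \<epsilon> \<mu> f)"
  have "\<exists>\<mu>. ?P \<mu>" using assms by (auto simp: V_class_def)
  from someI_ex[OF this] show ?thesis using that unfolding fun_calc_def by blast
qed

theorem theorem5p4:
  fixes Z :: "real \<Rightarrow> 'v::quaternionic_banach \<Rightarrow> 'v"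
    and D :: "'v set" and T :: "'v \<Rightarrow> 'v"
    and M \<omega> :: real
    and P :: "nat \<Rightarrow> real poly" and f :: "quaternion \<Rightarrow> quaternion"
  assumes "strongly_continuous_group Z"
    and "is_generator Z D T"
    and "M > 0" and "\<omega> \<ge> 0"
    and "\<And>t. onorm (Z t) \<le> M * exp (\<omega> * \<bar>t\<bar>)"
    and "S_spectrum D T \<subseteq> {s. - \<omega> < qRe s \<and> qRe s < \<omega>}"
    and "f \<in> intrinsic_V_class \<omega>"
    and "inverting_sequence \<omega> Z P f"
  shows "\<forall>u. (\<forall>n. fun_calc \<omega> Z f u \<in> pow_dom D T (degree (P n))) \<and>
             (\<lambda>n. poly_op (P n) T (fun_calc \<omega> Z f u)) \<longlonglongrightarrow> u"
proof -
  interpret group_generator Z M \<omega> D T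
    by unfold_locales (use assms in auto)
  let ?Pf = "\<lambda>n s. qpoly (P n) s * f s"
  obtain \<mu>0 \<epsilon>0 where "\<mu>0 \<in> S_class \<omega>" and L0: "laplace_on \<omega> \<epsilon>0 \<mu>0 f"
    and intr: "\<And>s. \<bar>qRe s\<bar> < \<omega> + \<epsilon>0 \<Longrightarrow> f (qcnj s) = qcnj (f s)"
    using assms(7) unfolding intrinsic_V_class_def by blast
  then have fV: "f \<in> V_class \<omega>" and \<epsilon>0: "\<epsilon>0 > 0" unfolding V_class_def laplace_on_def by blast+
  \<comment> \<open>The chosen \<mu> may differ from the measure in the intrinsic class and have
    another width. The symmetry is a property of \<open>f\<close> and is used only on the imaginary
    axis, which lies in every strip.\<close>
  obtain \<mu> \<epsilon>1 where \<mu>: "\<mu> \<in> S_class \<omega>" "laplace_on \<omega> \<epsilon>1 \<mu> f" "fun_calc \<omega> Z f = measure_op Z \<mu>"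
    by (rule V_class_representative[OF fV, of Z])
  have PV: "?Pf n \<in> V_class \<omega>" for n
    using assms(8) unfolding inverting_sequence_def by blast
  obtain \<epsilon>2 K where \<epsilon>2: "\<epsilon>2 > 0"
    and bd: "\<And>s n. \<bar>qRe s\<bar> \<le> \<omega> + \<epsilon>2 \<Longrightarrow> norm (?Pf n s) \<le> K"
    and lim: "\<And>s. \<bar>qRe s\<bar> \<le> \<omega> + \<epsilon>2 \<Longrightarrow> (\<lambda>n. ?Pf n s) \<longlonglongrightarrow> 1"
    using assms(8) unfolding inverting_sequence_def by blast
  obtain K' where K': "\<And>n. onorm (fun_calc \<omega> Z (?Pf n)) \<le> K'"
    using assms(8) unfolding inverting_sequence_def by blast
  have "\<forall>n. \<exists>\<nu> \<epsilon>. \<nu> \<in> S_class \<omega> \<and> laplace_on \<omega> \<epsilon> \<nu> (?Pf n) \<and> fun_calc \<omega> Z (?Pf n) = measure_op Z \<nu>"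
    using V_class_representative[OF PV, of _ Z] by metis
  then obtain \<nu> \<epsilon>3 where \<nu>: "\<And>n. \<nu> n \<in> S_class \<omega>" "\<And>n. laplace_on \<omega> (\<epsilon>3 n) (\<nu> n) (?Pf n)"
    "\<And>n. fun_calc \<omega> Z (?Pf n) = measure_op Z (\<nu> n)"
    by metis
  have \<epsilon>1: "\<epsilon>1 > 0" and \<epsilon>3: "\<epsilon>3 n > 0" for n
    using \<mu>(2) \<nu>(2)[of n] by (simp_all add: laplace_on_def)
  define \<kappa> where "\<kappa> = variation \<mu>"
  define a where "a = (\<lambda>t. qRe (polar \<mu> t))"
  define \<kappa>' where "\<kappa>' n = variation (\<nu> n)" for n
  define a' where "a' n = (\<lambda>t. qRe (polar (\<nu> n) t))" for n
  \<comment> \<open>Strictly beyond \<omega> so that kernels outweigh the group, strictly inside the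
    strip of \<mu>, and within the strip of condition (ii).\<close>
  define b where "b = \<omega> + min \<epsilon>1 \<epsilon>2 / 2"
  define b' where "b' n = \<omega> + \<epsilon>3 n / 2" for n
  have b: "\<omega> < b" "b < \<omega> + \<epsilon>1" "b \<le> \<omega> + \<epsilon>2" using \<epsilon>1 \<epsilon>2 by (auto simp: b_def min_def)
  have b': "\<omega> < b' n" "b' n < \<omega> + \<epsilon>3 n" for n using \<epsilon>3[of n] by (auto simp: b'_def)
  have symf: "\<forall>u\<in>imaginary_units. \<forall>y. f (slice u (cnj (\<i> * of_real y))) = qcnj (f (slice u (\<i> * of_real y)))"
  proof (intro ballI allI)
    fix u y assume u: "u \<in> imaginary_units"
    show "f (slice u (cnj (\<i> * of_real y))) = qcnj (f (slice u (\<i> * of_real y)))"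
      unfolding slice_cnj[OF u] by (rule intr) (use qRe_slice[OF u] \<epsilon>0 omega_nonneg in simp)
  qed
  note F = real_symbol[OF \<mu>(1,2) symf b(1,2), folded \<kappa>_def a_def]
  interpret A: weighted_group Z M \<omega> \<kappa> a b by (rule F(1))
  have Pf: "?Pf n (slice u z) = slice u (cpoly (P n) z * lap \<kappa> a z)"
    if "u \<in> imaginary_units" "\<bar>Re z\<bar> \<le> b" for u z n
    by (simp only: F(2)[OF that] qpoly_slice[OF imaginary_unit(1)[OF that(1)]] slice_mult[OF imaginary_unit(1)[OF that(1)]])
  have cnj_poly: "cpoly (P n) (cnj z) = cnj (cpoly (P n) z)" for n z
    by (simp add: poly_altdef coeff_map_poly)
  \<comment> \<open>On a slice both factors are embedded complex numbers, so they multiply as such,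
    and real coefficients commute with conjugation. The chosen measures of the products are
    therefore real as well.\<close>
  have symPf: "\<forall>u\<in>imaginary_units. \<forall>y. ?Pf n (slice u (cnj (\<i> * of_real y))) = qcnj (?Pf n (slice u (\<i> * of_real y)))" for n
  proof (intro ballI allI)
    fix u y assume u: "u \<in> imaginary_units"
    have 0: "\<bar>Re (\<i> * of_real y)\<bar> \<le> b" "\<bar>Re (cnj (\<i> * of_real y))\<bar> \<le> b" using A.b_nonneg by simp_all
    show "?Pf n (slice u (cnj (\<i> * of_real y))) = qcnj (?Pf n (slice u (\<i> * of_real y)))"
      unfolding Pf[OF u 0(1)] Pf[OF u 0(2)] cnj_poly A.lap_cnj slice_cnj[OF u, symmetric]
      by (simp only: complex_cnj_mult)
  qed
  note G = real_symbol[OF \<nu>(1,2) symPf b', folded \<kappa>'_def a'_def]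
  \<comment> \<open>One slice is enough to read off the complex identities, bounds and limits,
    because the embedding is isometric.\<close>
  let ?i = "Quaternion 0 1 0 0"
  have i: "?i \<in> imaginary_units" by simp
  have eq: "lap (\<kappa>' n) (a' n) (Complex 0 y) = cpoly (P n) (Complex 0 y) * lap \<kappa> a (Complex 0 y)" for n y
  proof -
    have "\<bar>Re (Complex 0 y)\<bar> \<le> b" "\<bar>Re (Complex 0 y)\<bar> \<le> b' n"
      using A.b_nonneg b'[of n] omega_nonneg by auto
    from G(2)[OF i this(2)] Pf[OF i this(1), of n] show ?thesis
      by (simp only: slice_inject[OF i])
  qed
  have strip: "\<bar>qRe (slice ?i z)\<bar> \<le> \<omega> + \<epsilon>2" if "\<bar>Re z\<bar> \<le> b" for z
    using that b(3) qRe_slice[OF i] by simp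
  have bdA: "cmod (cpoly (P n) z * lap \<kappa> a z) \<le> K" if "\<bar>Re z\<bar> \<le> b" for n z
    using bd[OF strip[OF that], of n] by (simp only: Pf[OF i that] norm_slice[OF i])
  have limA: "(\<lambda>n. cpoly (P n) z * lap \<kappa> a z) \<longlonglongrightarrow> 1" if "\<bar>Re z\<bar> \<le> b" for z
  proof -
    have "(\<lambda>n. norm (?Pf n (slice ?i z) - 1)) \<longlonglongrightarrow> 0"
      using lim[OF strip[OF that]] by (simp add: LIM_zero_iff tendsto_norm_zero_iff)
    moreover have "norm (?Pf n (slice ?i z) - 1) = cmod (cpoly (P n) z * lap \<kappa> a z - 1)" for n
      unfolding Pf[OF i that] norm_slice[OF i, symmetric]
      using linear_diff[OF bounded_linear.linear[OF bounded_linear_slice], of ?i _ 1] by simp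
    ultimately show ?thesis by (simp add: LIM_zero_iff tendsto_norm_zero_iff)
  qed
  have onG: "onorm (orbit_int (\<kappa>' n) (a' n)) \<le> K'" for n
    using K'[of n] unfolding \<nu>(3) G(3) .
  \<comment> \<open>The strip in the spectral hypothesis is open, so its boundary point \<omega> is
    a real point of the resolvent set.\<close>
  have "of_real \<omega> \<in> S_resolvent_set D T"
    using assms(6) by (auto simp: S_spectrum_def of_real_def)
  then obtain R where R: "generator_resolvent Z M \<omega> D T R \<omega>" by (rule resolvent_exists)
  interpret R: generator_resolvent Z M \<omega> D T R \<omega> by (rule R)
  have fc: "fun_calc \<omega> Z f = A.mop" by (simp only: \<mu>(3) F(3))
  have inv: "A.mop u \<in> pow_dom D T (degree (P n))" "poly_op (P n) T (A.mop u) = orbit_int (\<kappa>' n) (a' n) u" for n u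
  proof -
    interpret B: weighted_group Z M \<omega> "\<kappa>' n" "a' n" "b' n" by (rule G(1))
    have GF: "B.mop v = A.mop (poly_op (P n) T v)" if "v \<in> pow_dom D T (degree (P n))" for v
      by (rule mop_poly_op[OF F(1) G(1) eq that])
    note * = R.poly_op_via_resolvent[OF bounded_linear.linear[OF A.bounded_linear_mop]
        R.bounded_commute_R[OF A.bounded_linear_mop A.mop_commute]
        R.bounded_commute_R[OF B.bounded_linear_mop B.mop_commute] GF]
    show "A.mop u \<in> pow_dom D T (degree (P n))" "poly_op (P n) T (A.mop u) = B.mop u"
      by (rule *, assumption)+
  qed
  show ?thesis
    unfolding fc inv(2)
    using inv(1) mop_tendsto_id[OF F(1) G(1) eq bdA limA onG] by blast
qed

end
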